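(* Let $\mathbf{k}$ be a field and let $n\ge 2$. Consider the ring of invariants $S^{\mathrm{SL}_2}$ (the homogeneous coordinate ring of the Grassmannian $G(2,n)$ in its Plücker embedding) with its multigrading in which $p_{ij}$ has degree $e_i+e_j$. Let $\Lambda=\{w\in\mathbb{Z}^n : |w|\in 2\mathbb{Z}\}$ and let $\mathbf{h}(w)=\dim_{\mathbf{k}}(S^{\mathrm{SL}_2})_w$ be the multigraded Hilbert function. Then: (a) $\mathbf{h}(w)=K(\lambda,\mu)$ with $\lambda=(|w|/2,|w|/2)$ and $\mu=w$, and the support of $\mathbf{h}$ is $$\{w\in\Lambda : |w|/2\ge w_j \text{ for all } 1\le j\le n\}.$$ (b) For $w\in\Lambda$, $$\mathbf{h}(w)=\sum_{\substack{J\subseteq[n]\\ |w_J|<|w|/2}}(-1)^{|J|}\binom{|w|/2-|w_J|+n-|J|-2}{n-2},$$ which gives a closed formula for the multigraded Poincaré–Hilbert series $\sum_{w\in\Lambda}\dim_{\mathbf{k}}(S^{\mathrm{SL}_2})_w\,z^w$. (c) The multigraded Hilbert function $\mathbf{h}$ is piecewise polynomial in $w\in\Lambda$, and its domains of polynomiality agree with the GIT chambers, whose walls are given by the equations $|w_J|=|w|/2$.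
   Context: $[n]=\{1,\dots,n\}$, $|w|=w_1+\cdots+w_n$, and $|w_J|=\sum_{j\in J}w_j$ for $J\subseteq[n]$. Let $S=\mathbf{k}[x_1,y_1,\dots,x_n,y_n]$, graded by $\mathbb{N}^n$ with $\deg x_i=\deg y_i=e_i$, the $i$-th standard basis vector. The group $\mathrm{SL}_2$ acts on $S$ through left multiplication on the $2\times n$ matrix with columns $(x_i,y_i)^T$, preserving the grading; invariants are taken with respect to the algebraic group (group scheme) $\mathrm{SL}_2$ (for infinite $\mathbf{k}$, the same as invariants of $\mathrm{SL}(2,\mathbf{k})$). The invariants $p_{ij}=x_iy_j-x_jy_i$, $i<j$, generate $S^{\mathrm{SL}_2}$, and $(S^{\mathrm{SL}_2})_w$ denotes the degree-$w$ part. $K(\lambda,\mu)$ is the Kostka number, the number of semistandard Young tableaux of shape $\lambda$ and content $\mu$. The GIT chambers are those for the diagonal action of $\mathrm{SL}_2$ on $(\mathbb{P}^1)^n$ linearized by the line bundles $L_w=\mathcal{O}(w_1,\dots,w_n)$, where $\mathbb{N}^n$ is identified with the effective divisors on $(\mathbb{P}^1)^n$: a point $(p_1,\dots,p_n)\in(\mathbb{P}^1)^n$ is stable (resp. semistable) for $L_w$ if for every set $J=\{j\in[n] : p_j=p\}$ of indices of points colliding at some $p$ one has $|w_J|<|w|/2$ (resp. $|w_J|\le|w|/2$). Convention: $\binom{a}{b}=0$ unless $0\le b\le a$.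
   Formalization: In (a) the support set also requires w ≥ 0 and the Kostka identity is stated for w in Λ∩N^n; in (b) the formula is stated for nonzero w in Λ∩N^n, with h(0)=1 and h=0 at weights with a negative entry; as printed, (a) fails at (1,1,1,-1) and (b) at w=0 and (1,-1). *)

theory Defs
  imports
    "HOL-Analysis.Analysis"
    "HOL-Library.Poly_Mapping"
    "HOL-Algebra.Algebraic_Closure_Type"
begin

(* Weights w in Z^n, N^n, R^n are extensional functions on [n] = {1..n}. *)

section \<open>Multivariate polynomials\<close>

text \<open>Polynomials in variables of type 'v over 'a are finitely supported maps from exponent
  vectors to coefficients; the ring structure is the convolution product of Poly_Mapping.\<close>

type_synonym ('v, 'a) mpoly = "('v \<Rightarrow>\<^sub>0 nat) \<Rightarrow>\<^sub>0 'a"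

definition mp_const :: "'a::zero \<Rightarrow> ('v, 'a) mpoly" where
  "mp_const c = Poly_Mapping.single 0 c"

definition mp_var :: "'v \<Rightarrow> ('v, 'a::zero_neq_one) mpoly" where
  "mp_var v = Poly_Mapping.single (Poly_Mapping.single v 1) 1"

definition mp_in_vars :: "'v set \<Rightarrow> ('v, 'a::zero) mpoly \<Rightarrow> bool" where
  "mp_in_vars V p \<longleftrightarrow> (\<forall>m\<in>Poly_Mapping.keys p. Poly_Mapping.keys m \<subseteq> V)"

text \<open>The ring homomorphism that is \<open>\<phi>\<close> on coefficients and sends each variable v to \<open>\<alpha> v\<close>.\<close>

definition mp_eval :: "('a::zero \<Rightarrow> 'b::comm_semiring_1) \<Rightarrow> ('v \<Rightarrow> 'b) \<Rightarrow> ('v, 'a) mpoly \<Rightarrow> 'b" where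
  "mp_eval \<phi> \<alpha> p =
     (\<Sum>m\<in>Poly_Mapping.keys p. \<phi> (Poly_Mapping.lookup p m) *
        (\<Prod>v\<in>Poly_Mapping.keys m. \<alpha> v ^ Poly_Mapping.lookup m v))"

definition mp_scale :: "'a::comm_semiring_1 \<Rightarrow> ('v, 'a) mpoly \<Rightarrow> ('v, 'a) mpoly" where
  "mp_scale c p = mp_const c * p"

lemma vector_space_mp_scale: "vector_space (mp_scale :: 'a::field \<Rightarrow> _)"
  by unfold_locales
    (simp_all add: mp_scale_def mp_const_def algebra_simps single_add mult_single flip: mult.assoc)

section \<open>Invariants of the group scheme \<open>SL\<^sub>2\<close>\<close>

datatype coord = Xc nat | Yc nat

datatype matrix_entry = Ma | Mb | Mc | Md

definition coord_ring :: "nat \<Rightarrow> (coord, 'k::field) mpoly set" where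
  "coord_ring n = {f. mp_in_vars (Xc ` {1..n} \<union> Yc ` {1..n}) f}"

text \<open>The universal matrix with rows (a, b) and (c, d) multiplies each column \<open>(x\<^sub>i, y\<^sub>i)\<close>
  from the left. The target is \<open>S \<otimes> k[a,b,c,d]\<close>, i.e. polynomials in a, b, c, d over S.\<close>

fun generic_column :: "coord \<Rightarrow> (matrix_entry, (coord, 'k::field) mpoly) mpoly" where
  "generic_column (Xc i) = mp_var Ma * mp_const (mp_var (Xc i)) + mp_var Mb * mp_const (mp_var (Yc i))"
| "generic_column (Yc i) = mp_var Mc * mp_const (mp_var (Xc i)) + mp_var Md * mp_const (mp_var (Yc i))"

definition coaction ::
  "(coord, 'k::field) mpoly \<Rightarrow> (matrix_entry, (coord, 'k) mpoly) mpoly" where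
  "coaction f = mp_eval (\<lambda>c. mp_const (mp_const c)) generic_column f"

text \<open>f is invariant iff its coaction equals \<open>f \<otimes> 1\<close> in
  \<open>S \<otimes> k[SL\<^sub>2] = S[a,b,c,d] / (ad - bc - 1)\<close>.\<close>

definition SL2_invariant :: "(coord, 'k::field) mpoly \<Rightarrow> bool" where
  "SL2_invariant f \<longleftrightarrow>
     (mp_var Ma * mp_var Md - mp_var Mb * mp_var Mc - 1) dvd (coaction f - mp_const f)"

definition invariant_ring :: "nat \<Rightarrow> (coord, 'k::field) mpoly set" where
  "invariant_ring n = {f \<in> coord_ring n. SL2_invariant f}"

definition has_multidegree :: "nat \<Rightarrow> (nat \<Rightarrow> int) \<Rightarrow> (coord, 'k::field) mpoly \<Rightarrow> bool" where
  "has_multidegree n w f \<longleftrightarrow>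
     (\<forall>m\<in>Poly_Mapping.keys f. \<forall>i\<in>{1..n}.
        int (Poly_Mapping.lookup m (Xc i) + Poly_Mapping.lookup m (Yc i)) = w i)"

definition hilbert_function :: "'k::field itself \<Rightarrow> nat \<Rightarrow> (nat \<Rightarrow> int) \<Rightarrow> nat" where
  "hilbert_function _ n w =
     vector_space.dim (mp_scale :: 'k \<Rightarrow> _) {f \<in> invariant_ring n. has_multidegree n w f}"

section \<open>Weights\<close>

definition int_weights :: "nat \<Rightarrow> (nat \<Rightarrow> int) set" where
  "int_weights n = {1..n} \<rightarrow>\<^sub>E UNIV"

definition nonneg_weights :: "nat \<Rightarrow> (nat \<Rightarrow> int) set" where
  "nonneg_weights n = {1..n} \<rightarrow>\<^sub>E {0..}"

definition zero_weight :: "nat \<Rightarrow> nat \<Rightarrow> int" where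
  "zero_weight n = (\<lambda>i\<in>{1..n}. 0)"

definition even_lattice :: "nat \<Rightarrow> (nat \<Rightarrow> int) set" where
  "even_lattice n = {w \<in> int_weights n. even (\<Sum>i\<in>{1..n}. w i)}"

text \<open>Only used on the even lattice, where the division is exact.\<close>

definition half_weight :: "nat \<Rightarrow> (nat \<Rightarrow> int) \<Rightarrow> int" where
  "half_weight n w = (\<Sum>i\<in>{1..n}. w i) div 2"

definition real_weight :: "nat \<Rightarrow> (nat \<Rightarrow> int) \<Rightarrow> nat \<Rightarrow> real" where
  "real_weight n w = (\<lambda>i\<in>{1..n}. real_of_int (w i))"

section \<open>Kostka numbers\<close>

definition cells :: "nat list \<Rightarrow> (nat \<times> nat) set" where
  "cells lam = {(r, c). r < length lam \<and> c < lam ! r}"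

definition ssyt :: "nat list \<Rightarrow> (nat \<Rightarrow> nat) \<Rightarrow> (nat \<times> nat \<Rightarrow> nat) set" where
  "ssyt lam mu =
     {T \<in> cells lam \<rightarrow>\<^sub>E {1..}.
        (\<forall>r c c'. (r, c) \<in> cells lam \<longrightarrow> (r, c') \<in> cells lam \<longrightarrow> c < c' \<longrightarrow> T (r, c) \<le> T (r, c')) \<and>
        (\<forall>r r' c. (r, c) \<in> cells lam \<longrightarrow> (r', c) \<in> cells lam \<longrightarrow> r < r' \<longrightarrow> T (r, c) < T (r', c)) \<and>
        (\<forall>j\<ge>1. card {x \<in> cells lam. T x = j} = mu j)}"

definition kostka :: "nat list \<Rightarrow> (nat \<Rightarrow> nat) \<Rightarrow> nat" where
  "kostka lam mu = card (ssyt lam mu)"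

definition weight_content :: "nat \<Rightarrow> (nat \<Rightarrow> int) \<Rightarrow> nat \<Rightarrow> nat" where
  "weight_content n w j = (if j \<in> {1..n} then nat (w j) else 0)"

section \<open>The alternating sum and the Poincare-Hilbert series\<close>

definition binom :: "int \<Rightarrow> int \<Rightarrow> int" where
  "binom a b = (if 0 \<le> b \<and> b \<le> a then int (nat a choose nat b) else 0)"

text \<open>At w = 0 no J satisfies the strict inequality, so the sum is 0 although the invariants of
  degree 0 are the constants. That weight is therefore treated separately.\<close>

definition alternating_sum :: "nat \<Rightarrow> (nat \<Rightarrow> int) \<Rightarrow> int" where
  "alternating_sum n w =
     (\<Sum>J | J \<subseteq> {1..n} \<and> (\<Sum>j\<in>J. w j) < half_weight n w.
        (-1) ^ card J *
        binom (half_weight n w - (\<Sum>j\<in>J. w j) + int n - int (card J) - 2) (int n - 2))"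

text \<open>A formal series in \<open>z\<^sub>1, \<dots>, z\<^sub>n\<close> is given by its family of coefficients:
  the value at w is the coefficient of \<open>z\<^sup>w\<close>.\<close>

definition poincare_hilbert_series :: "'k::field itself \<Rightarrow> nat \<Rightarrow> (nat \<Rightarrow> int) \<Rightarrow> int" where
  "poincare_hilbert_series K n =
     (\<lambda>w. if w \<in> even_lattice n then int (hilbert_function K n w) else 0)"

section \<open>Variation of GIT on \<open>(P\<^sup>1)\<^sup>n\<close>\<close>

text \<open>Effective divisor classes of \<open>(P\<^sup>1)\<^sup>n\<close>, with real coefficients.\<close>

definition effective_cone :: "nat \<Rightarrow> (nat \<Rightarrow> real) set" where
  "effective_cone n = {1..n} \<rightarrow>\<^sub>E {0..}"

text \<open>Points of the projective line are the lines through the origin of \<open>K\<^sup>2\<close>. Geometric points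
  are used: a finite field has too few rational points to see all collision patterns.\<close>

definition proj_line :: "('K::field \<times> 'K) set set" where
  "proj_line = {{(c * a, c * b) | c. True} | a b. (a, b) \<noteq> (0, 0)}"

definition configurations :: "nat \<Rightarrow> (nat \<Rightarrow> ('K::field \<times> 'K) set) set" where
  "configurations n = {1..n} \<rightarrow>\<^sub>E proj_line"

definition semistable_locus ::
  "'k::field itself \<Rightarrow> nat \<Rightarrow> (nat \<Rightarrow> real) \<Rightarrow> (nat \<Rightarrow> ('k alg_closure \<times> 'k alg_closure) set) set" where
  "semistable_locus _ n w =
     {p \<in> configurations n. \<forall>q\<in>proj_line.
        (\<Sum>j | j \<in> {1..n} \<and> p j = q. w j) \<le> (\<Sum>j\<in>{1..n}. w j) / 2}"

definition stable_locus ::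
  "'k::field itself \<Rightarrow> nat \<Rightarrow> (nat \<Rightarrow> real) \<Rightarrow> (nat \<Rightarrow> ('k alg_closure \<times> 'k alg_closure) set) set" where
  "stable_locus _ n w =
     {p \<in> configurations n. \<forall>q\<in>proj_line.
        (\<Sum>j | j \<in> {1..n} \<and> p j = q. w j) < (\<Sum>j\<in>{1..n}. w j) / 2}"

text \<open>The weights with nonempty semistable locus; the GIT fan subdivides this cone.\<close>

definition G_effective_cone :: "'k::field itself \<Rightarrow> nat \<Rightarrow> (nat \<Rightarrow> real) set" where
  "G_effective_cone K n = {w \<in> effective_cone n. semistable_locus K n w \<noteq> {}}"

text \<open>A chamber is a GIT equivalence class (same semistable locus) without strictly semistable
  points and with nonempty semistable locus.\<close>

definition GIT_chambers :: "'k::field itself \<Rightarrow> nat \<Rightarrow> (nat \<Rightarrow> real) set set" where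
  "GIT_chambers K n =
     {{v \<in> effective_cone n. semistable_locus K n v = semistable_locus K n w} | w.
        w \<in> G_effective_cone K n \<and> semistable_locus K n w = stable_locus K n w}"

definition wall :: "nat \<Rightarrow> nat set \<Rightarrow> (nat \<Rightarrow> real) set" where
  "wall n J = {w \<in> effective_cone n. (\<Sum>j\<in>J. w j) = (\<Sum>j\<in>{1..n}. w j) / 2}"

section \<open>Piecewise polynomial functions on the even lattice\<close>

definition polynomial_on_cone :: "nat \<Rightarrow> ((nat \<Rightarrow> int) \<Rightarrow> real) \<Rightarrow> (nat \<Rightarrow> real) set \<Rightarrow> bool" where
  "polynomial_on_cone n f C \<longleftrightarrow>
     (\<exists>P :: (nat, real) mpoly. mp_in_vars {1..n} P \<and>
        (\<forall>w\<in>even_lattice n. real_weight n w \<in> C \<longrightarrow> f w = mp_eval id (real_weight n w) P))"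

definition polyhedral_cone :: "nat \<Rightarrow> (nat \<Rightarrow> real) set \<Rightarrow> bool" where
  "polyhedral_cone n C \<longleftrightarrow>
     (\<exists>A. finite A \<and> C = {w \<in> {1..n} \<rightarrow>\<^sub>E UNIV. \<forall>a\<in>A. 0 \<le> (\<Sum>i\<in>{1..n}. a i * w i)})"

text \<open>Finitely many closed polyhedral cones cut out the support of f inside the even lattice,
  and f is polynomial on each of them. Cones may have any dimension and may overlap.\<close>

definition piecewise_polynomial :: "nat \<Rightarrow> ((nat \<Rightarrow> int) \<Rightarrow> real) \<Rightarrow> bool" where
  "piecewise_polynomial n f \<longleftrightarrow>
     (\<exists>\<C>. finite \<C> \<and> (\<forall>C\<in>\<C>. polyhedral_cone n C \<and> polynomial_on_cone n f C) \<and>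
        {w \<in> even_lattice n. f w \<noteq> 0} = {w \<in> even_lattice n. real_weight n w \<in> \<Union>\<C>})"

text \<open>Domains of polynomiality are the maximal nonempty open cones in the effective cone (with
  its topology as a subspace of \<open>R\<^sup>n\<close>) that lie in the support and on which f is polynomial. Without
  the closure under scaling a bounded open set could be enlarged across a wall, since it meets the
  lattice in finitely many points.\<close>

definition polynomial_open_cone :: "nat \<Rightarrow> ((nat \<Rightarrow> int) \<Rightarrow> real) \<Rightarrow> (nat \<Rightarrow> real) set \<Rightarrow> bool" where
  "polynomial_open_cone n f U \<longleftrightarrow>
     U \<noteq> {} \<and> openin (subtopology (powertop_real {1..n}) (effective_cone n)) U \<and>
     (\<forall>w\<in>U. \<forall>t>0. (\<lambda>i\<in>{1..n}. t * w i) \<in> U) \<and>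
     (\<forall>w\<in>even_lattice n. real_weight n w \<in> U \<longrightarrow> f w \<noteq> 0) \<and>
     polynomial_on_cone n f U"

definition polynomiality_domains :: "nat \<Rightarrow> ((nat \<Rightarrow> int) \<Rightarrow> real) \<Rightarrow> (nat \<Rightarrow> real) set set" where
  "polynomiality_domains n f =
     {U. polynomial_open_cone n f U \<and> (\<forall>V. polynomial_open_cone n f V \<and> U \<subseteq> V \<longrightarrow> V = U)}"

end

theory Submission
  imports Defs
begin

text \<open>An invariant is fixed by the shear \<open>y \<mapsto> y + x\<close> and by the torus. Shear invariance forces every nonzero
  invariant to contain a monomial that satisfies the ballot inequalities of a semistandard two-row
  tableau, so the dimension is at most the Kostka number. The products of brackets read off the columns
  of the tableaux have distinct leading monomials, so the bound is attained, over every field. Ballot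
  words are counted by the Clebsch-Gordan rule as a difference of two weight multiplicities, whose
  generating function expands to the alternating sum.

  In a chamber the sum runs over the light sets of the chamber and each summand is a polynomial. Evaluated at the
  points \<open>-2 \<cdot> 1\<^sub>K\<close>, the difference of the polynomials of two chambers shows that the difference of the
  indicator functions of their light sets is an eigenfunction on the discrete cube. A maximum
  principle makes it vanish, so distinct chambers have distinct polynomials and no polynomial
  open cone, connected or not, meets two chambers.\<close>

text \<open>The field is arbitrary: complete reducibility and differentiation fail in positive
  characteristic, and a finite field has too few matrices. Divisibility by
  \<open>ad - bc - 1\<close> compensates for this, since it allows the coaction to be specialised to
  any matrix of determinant 1 over any commutative ring that receives k. The shear is taken over S
  and the torus element over Laurent polynomials in a free variable.

  The eigenvalue \<open>n - 2\<close> arises as follows. As a polynomial in the distance d, the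
  binomial coefficient with upper entry \<open>n - 2 - d\<close> and lower entry
  \<open>n - 2\<close> has the roots 1, ..., n - 2. Of the distances 0, ..., n this leaves 0, n - 1
  and n. Exactly one of a set and its complement is light, so the two large distances fold back to 1
  and 0, and only K and its neighbours remain. The eigenfunctions for \<open>n - 2\<close> are the
  linear forms in n signs; the empty set and the singletons are light in every chamber, and
  vanishing there leaves only the zero form.\<close>

abbreviation lkp where "lkp \<equiv> Poly_Mapping.lookup"
abbreviation keys_of where "keys_of \<equiv> Poly_Mapping.keys"
abbreviation deg :: "'a::zero poly \<Rightarrow> nat" where "deg \<equiv> Polynomial.degree"
abbreviation sgl where "sgl \<equiv> Poly_Mapping.single"

section \<open>Evaluation of polynomials\<close>

definition semiring_hom :: "('a::comm_semiring_1 \<Rightarrow> 'b::comm_semiring_1) \<Rightarrow> bool" where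
  "semiring_hom h \<longleftrightarrow> h 0 = 0 \<and> h 1 = 1 \<and> (\<forall>x y. h (x + y) = h x + h y) \<and> (\<forall>x y. h (x * y) = h x * h y)"

lemma semiring_homI:
  "h 0 = 0 \<Longrightarrow> h 1 = 1 \<Longrightarrow> (\<And>x y. h (x + y) = h x + h y) \<Longrightarrow> (\<And>x y. h (x * y) = h x * h y)
    \<Longrightarrow> semiring_hom h"
  by (simp add: semiring_hom_def)

context
  fixes h :: "'a::comm_semiring_1 \<Rightarrow> 'b::comm_semiring_1"
  assumes h: "semiring_hom h"
begin

lemma hom_zero: "h 0 = 0" and hom_one: "h 1 = 1"
  and hom_add: "h (x + y) = h x + h y" and hom_mult: "h (x * y) = h x * h y"
  using h by (auto simp: semiring_hom_def)

lemma hom_sum: "h (\<Sum>i\<in>A. f i) = (\<Sum>i\<in>A. h (f i))"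
  by (induction A rule: infinite_finite_induct) (auto simp: hom_zero hom_add)

lemma hom_prod: "h (\<Prod>i\<in>A. f i) = (\<Prod>i\<in>A. h (f i))"
  by (induction A rule: infinite_finite_induct) (auto simp: hom_one hom_mult)

lemma hom_power: "h (x ^ k) = h x ^ k"
  by (induction k) (auto simp: hom_one hom_mult)

lemma hom_mp_eval: "h (mp_eval \<phi> \<alpha> p) = mp_eval (\<lambda>c. h (\<phi> c)) (\<lambda>v. h (\<alpha> v)) p"
  by (simp add: mp_eval_def hom_sum hom_mult hom_prod hom_power)

end

lemma hom_uminus:
  fixes h :: "'a::comm_ring_1 \<Rightarrow> 'b::comm_ring_1"
  assumes "semiring_hom h" shows "h (- x) = - h x"
proof -
  have "h (- x) + h x = 0"
    using hom_add[OF assms, of "-x" x] by (simp add: hom_zero[OF assms])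
  then show ?thesis by (simp add: eq_neg_iff_add_eq_0)
qed

lemma hom_diff:
  fixes h :: "'a::comm_ring_1 \<Rightarrow> 'b::comm_ring_1"
  assumes "semiring_hom h" shows "h (x - y) = h x - h y"
  using hom_add[OF assms, of x "-y"] by (simp add: hom_uminus[OF assms])

lemma semiring_hom_comp: "semiring_hom g \<Longrightarrow> semiring_hom h \<Longrightarrow> semiring_hom (\<lambda>x. g (h x))"
  by (simp add: semiring_hom_def)

lemma semiring_hom_single_0: "semiring_hom (sgl (0 :: 'm::comm_monoid_add))"
  by (intro semiring_homI) (auto simp: single_add mult_single)

lemma semiring_hom_mp_const: "semiring_hom mp_const"
  using semiring_hom_single_0 by (simp add: mp_const_def[abs_def])

definition monomial_eval :: "('v \<Rightarrow> 'b::comm_semiring_1) \<Rightarrow> ('v \<Rightarrow>\<^sub>0 nat) \<Rightarrow> 'b" where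
  "monomial_eval \<alpha> m = (\<Prod>v\<in>keys_of m. \<alpha> v ^ lkp m v)"

lemma monomial_eval_superset:
  "finite S \<Longrightarrow> keys_of m \<subseteq> S \<Longrightarrow> monomial_eval \<alpha> m = (\<Prod>v\<in>S. \<alpha> v ^ lkp m v)"
  unfolding monomial_eval_def by (rule prod.mono_neutral_left) (auto simp: in_keys_iff)

lemma monomial_eval_add: "monomial_eval \<alpha> (a + b) = monomial_eval \<alpha> a * monomial_eval \<alpha> b"
proof -
  let ?S = "keys_of a \<union> keys_of b"
  have "keys_of (a + b) \<subseteq> ?S" by (rule keys_add)
  then show ?thesis
    by (simp add: monomial_eval_superset[of ?S] lookup_add power_add prod.distrib)
qed

lemma monomial_eval_zero [simp]: "monomial_eval \<alpha> 0 = 1"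
  by (simp add: monomial_eval_def)

lemma monomial_eval_single [simp]: "monomial_eval \<alpha> (sgl v k) = \<alpha> v ^ k"
  by (simp add: monomial_eval_def)

lemma monomial_eval_cong:
  "(\<And>v. v \<in> keys_of m \<Longrightarrow> \<alpha> v = \<beta> v) \<Longrightarrow> monomial_eval \<alpha> m = monomial_eval \<beta> m"
  by (simp add: monomial_eval_def)

lemma mp_eval_alt: "mp_eval \<phi> \<alpha> p = (\<Sum>m\<in>keys_of p. \<phi> (lkp p m) * monomial_eval \<alpha> m)"
  by (simp add: mp_eval_def monomial_eval_def)

lemma poly_mapping_sum_single:
  fixes p :: "'m \<Rightarrow>\<^sub>0 'a::comm_monoid_add"
  shows "p = (\<Sum>m\<in>keys_of p. sgl m (lkp p m))"
proof (rule poly_mapping_eqI)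
  fix k
  have "lkp (\<Sum>m\<in>keys_of p. sgl m (lkp p m)) k
      = (\<Sum>m\<in>keys_of p. if m = k then lkp p m else 0)"
    by (simp add: lookup_sum lookup_single when_def)
  also have "\<dots> = lkp p k" by (auto simp: in_keys_iff)
  finally show "lkp p k = lkp (\<Sum>m\<in>keys_of p. sgl m (lkp p m)) k" by simp
qed

text \<open>Terms moved to pairwise distinct exponents cannot cancel. This controls the support
  after division by a variable and after setting variables to constants.\<close>

lemma keys_sum_single_inj:
  fixes c :: "'i \<Rightarrow> 'a::comm_monoid_add"
  assumes "finite M" "inj_on g M" "\<And>m. m \<in> M \<Longrightarrow> c m \<noteq> 0"
  shows "keys_of (\<Sum>m\<in>M. sgl (g m) (c m)) = g ` M"
proof -
  have *: "lkp (\<Sum>m\<in>M. sgl (g m) (c m)) (g m) = c m" if "m \<in> M" for m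
  proof -
    have "lkp (\<Sum>m\<in>M. sgl (g m) (c m)) (g m) = (\<Sum>m'\<in>M. if m' = m then c m else 0)"
      unfolding lookup_sum lookup_single when_def
      by (rule sum.cong) (use assms(2) that in \<open>auto simp: inj_on_def\<close>)
    then show ?thesis using assms(1) that by simp
  qed
  show "keys_of (\<Sum>m\<in>M. sgl (g m) (c m)) = g ` M"
  proof
    show "keys_of (\<Sum>m\<in>M. sgl (g m) (c m)) \<subseteq> g ` M"
      using keys_sum[of "\<lambda>m. sgl (g m) (c m)" M] by (auto split: if_splits)
    show "g ` M \<subseteq> keys_of (\<Sum>m\<in>M. sgl (g m) (c m))"
      using * assms(3) by (auto simp: in_keys_iff)
  qed
qed

context
  fixes \<phi> :: "'a::comm_semiring_1 \<Rightarrow> 'b::comm_semiring_1" and \<alpha> :: "'v \<Rightarrow> 'b"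
  assumes \<phi>: "semiring_hom \<phi>"
begin

lemma mp_eval_superset:
  "finite S \<Longrightarrow> keys_of p \<subseteq> S \<Longrightarrow> mp_eval \<phi> \<alpha> p = (\<Sum>m\<in>S. \<phi> (lkp p m) * monomial_eval \<alpha> m)"
  unfolding mp_eval_alt by (rule sum.mono_neutral_left) (auto simp: in_keys_iff hom_zero[OF \<phi>])

lemma mp_eval_add: "mp_eval \<phi> \<alpha> (p + q) = mp_eval \<phi> \<alpha> p + mp_eval \<phi> \<alpha> q"
proof -
  let ?S = "keys_of p \<union> keys_of q"
  have "keys_of (p + q) \<subseteq> ?S" by (rule keys_add)
  then show ?thesis
    by (simp add: mp_eval_superset[of ?S] lookup_add hom_add[OF \<phi>] algebra_simps sum.distrib)
qed

lemma mp_eval_zero [simp]: "mp_eval \<phi> \<alpha> 0 = 0"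
  by (simp add: mp_eval_def)

lemma mp_eval_single: "mp_eval \<phi> \<alpha> (sgl m c) = \<phi> c * monomial_eval \<alpha> m"
  by (cases "c = 0") (simp_all add: mp_eval_alt hom_zero[OF \<phi>])

lemma mp_eval_sum: "mp_eval \<phi> \<alpha> (\<Sum>i\<in>A. f i) = (\<Sum>i\<in>A. mp_eval \<phi> \<alpha> (f i))"
  by (induction A rule: infinite_finite_induct) (auto simp: mp_eval_add)

lemma mp_eval_mult: "mp_eval \<phi> \<alpha> (p * q) = mp_eval \<phi> \<alpha> p * mp_eval \<phi> \<alpha> q"
proof -
  have "p * q = (\<Sum>a\<in>keys_of p. \<Sum>b\<in>keys_of q. sgl (a + b) (lkp p a * lkp q b))"
    by (subst poly_mapping_sum_single[of p], subst poly_mapping_sum_single[of q])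
      (simp add: sum_product mult_single)
  then show ?thesis
    by (simp add: mp_eval_sum mp_eval_single hom_mult[OF \<phi>] monomial_eval_add)
      (simp add: mp_eval_alt sum_product ac_simps)
qed

lemma semiring_hom_mp_eval: "semiring_hom (mp_eval \<phi> \<alpha>)"
  using mp_eval_single[of 0 1]
  by (intro semiring_homI) (simp_all add: mp_eval_add mp_eval_mult hom_one[OF \<phi>])

lemma mp_eval_const [simp]: "mp_eval \<phi> \<alpha> (mp_const c) = \<phi> c"
  by (simp add: mp_const_def mp_eval_single)

lemma mp_eval_var [simp]: "mp_eval \<phi> \<alpha> (mp_var v) = \<alpha> v"
  by (simp add: mp_var_def mp_eval_single hom_one[OF \<phi>])

end

lemma monomial_eval_var:
  "monomial_eval mp_var m = (sgl m 1 :: ('v, 'a::{comm_semiring_1, zero_neq_one}) mpoly)"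
proof -
  have pw: "mp_var v ^ k = (sgl (sgl v k) 1 :: ('v, 'a) mpoly)" for v :: 'v and k
    by (induction k) (auto simp: mp_var_def mult_single simp flip: single_add)
  have pr: "(\<Prod>v\<in>A. sgl (sgl v (lkp m v)) 1) = (sgl (\<Sum>v\<in>A. sgl v (lkp m v)) 1 :: ('v, 'a) mpoly)"
    for A :: "'v set" and m by (induction A rule: infinite_finite_induct) (auto simp: mult_single)
  show ?thesis unfolding monomial_eval_def pw pr using poly_mapping_sum_single[of m] by simp
qed

lemma mp_eval_id: "mp_eval mp_const mp_var p = p"
  using poly_mapping_sum_single[of p]
  by (simp add: mp_eval_alt monomial_eval_var mp_const_def mult_single)

section \<open>Invariants\<close>

definition col :: "(nat \<Rightarrow> 'b) \<Rightarrow> (nat \<Rightarrow> 'b) \<Rightarrow> coord \<Rightarrow> 'b" where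
  "col x y v = (case v of Xc i \<Rightarrow> x i | Yc i \<Rightarrow> y i)"

lemma col_simps [simp]: "col x y (Xc i) = x i" "col x y (Yc i) = y i"
  by (simp_all add: col_def)

lemma col_eqI: "(\<And>i. \<alpha> (Xc i) = x i) \<Longrightarrow> (\<And>i. \<alpha> (Yc i) = y i) \<Longrightarrow> \<alpha> = col x y"
  by (rule ext, rename_tac v, case_tac v) auto

abbreviation vX :: "nat \<Rightarrow> (coord, 'k::field) mpoly" where "vX i \<equiv> mp_var (Xc i)"
abbreviation vY :: "nat \<Rightarrow> (coord, 'k::field) mpoly" where "vY i \<equiv> mp_var (Yc i)"

lemma semiring_hom_mp_const2: "semiring_hom (\<lambda>c. mp_const (mp_const c))"
  by (rule semiring_hom_comp[OF semiring_hom_mp_const semiring_hom_mp_const])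

lemma semiring_hom_coaction: "semiring_hom (coaction :: (coord, 'k::field) mpoly \<Rightarrow> _)"
  unfolding coaction_def[abs_def] by (rule semiring_hom_mp_eval[OF semiring_hom_mp_const2])

text \<open>A congruence modulo \<open>ad - bc - 1\<close> survives every substitution that makes
  the determinant 1. This is how invariance under the group scheme is exploited: the target ring may
  be much larger than the field.\<close>

lemma SL2_invariant_eval:
  fixes f :: "(coord, 'k::field) mpoly" and a b c d :: "'r::comm_ring_1"
  assumes "SL2_invariant f" and \<phi>: "semiring_hom \<phi>" and det: "a * d - b * c = 1"
  shows "mp_eval \<phi> (col (\<lambda>i. a * x i + b * y i) (\<lambda>i. c * x i + d * y i)) f = mp_eval \<phi> (col x y) f"
proof -
  define E where "E = mp_eval \<phi> (col x y)"
  \<comment> \<open>The coaction is a polynomial in the matrix entries with coefficients in S, so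
    \<open>E\<close> evaluates the coefficients and \<Theta> the entries.\<close>
  define \<Theta> where "\<Theta> = mp_eval E (case_matrix_entry a b c d)"
  have E: "semiring_hom E" unfolding E_def by (rule semiring_hom_mp_eval[OF \<phi>])
  have \<Theta>: "semiring_hom \<Theta>" unfolding \<Theta>_def by (rule semiring_hom_mp_eval[OF E])
  have Ev: "E (mp_const r) = \<phi> r" "E (vX i) = x i" "E (vY i) = y i" for r i
    unfolding E_def by (simp_all add: \<phi>)
  have \<Theta>v: "\<Theta> (mp_const r) = E r" "\<Theta> (mp_var Ma) = a" "\<Theta> (mp_var Mb) = b"
    "\<Theta> (mp_var Mc) = c" "\<Theta> (mp_var Md) = d" for r
    unfolding \<Theta>_def by (simp_all add: E)
  obtain g where g: "coaction f - mp_const f =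
      (mp_var Ma * mp_var Md - mp_var Mb * mp_var Mc - 1) * g"
    using assms(1) unfolding SL2_invariant_def dvd_def by blast
  have "\<Theta> (coaction f) - \<Theta> (mp_const f) = 0"
    unfolding hom_diff[OF \<Theta>, symmetric] g
    by (simp add: hom_mult[OF \<Theta>] hom_diff[OF \<Theta>] hom_one[OF \<Theta>] \<Theta>v det)
  moreover have "\<Theta> (coaction f)
      = mp_eval \<phi> (col (\<lambda>i. a * x i + b * y i) (\<lambda>i. c * x i + d * y i)) f"
    unfolding coaction_def hom_mp_eval[OF \<Theta>]
    by (subst col_eqI[where \<alpha>="\<lambda>v. \<Theta> (generic_column v)"])
      (auto simp: \<Theta>v Ev hom_add[OF \<Theta>] hom_mult[OF \<Theta>])
  ultimately show ?thesis by (simp add: \<Theta>v E_def)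
qed

lemma SL2_invariant_const: "SL2_invariant (mp_const c)"
  by (simp add: SL2_invariant_def coaction_def semiring_hom_mp_const2)

lemma SL2_invariant_add: "SL2_invariant f \<Longrightarrow> SL2_invariant g \<Longrightarrow> SL2_invariant (f + g)"
proof -
  assume a: "SL2_invariant f" "SL2_invariant g"
  have "coaction (f + g) - mp_const (f + g) = (coaction f - mp_const f) + (coaction g - mp_const g)"
    by (simp add: hom_add[OF semiring_hom_coaction] hom_add[OF semiring_hom_mp_const])
  then show ?thesis using a unfolding SL2_invariant_def by (metis dvd_add)
qed

lemma SL2_invariant_mult: "SL2_invariant f \<Longrightarrow> SL2_invariant g \<Longrightarrow> SL2_invariant (f * g)"
proof -
  assume a: "SL2_invariant f" "SL2_invariant g"
  have "coaction (f * g) - mp_const (f * g)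
      = (coaction f - mp_const f) * coaction g + mp_const f * (coaction g - mp_const g)"
    by (simp add: hom_mult[OF semiring_hom_coaction] hom_mult[OF semiring_hom_mp_const] algebra_simps)
  then show ?thesis using a unfolding SL2_invariant_def by (metis dvd_add dvd_mult dvd_mult2)
qed

definition bracket :: "nat \<Rightarrow> nat \<Rightarrow> (coord, 'k::field) mpoly" where
  "bracket i j = vX i * vY j - vX j * vY i"

text \<open>The generic matrix multiplies a 2 by 2 minor by \<open>ad - bc\<close>, so the cofactor
  of \<open>ad - bc - 1\<close> is the minor itself.\<close>

lemma SL2_invariant_bracket: "SL2_invariant (bracket i j :: (coord, 'k::field) mpoly)"
proof -
  have "coaction (bracket i j) - mp_const (bracket i j) =
     (mp_var Ma * mp_var Md - mp_var Mb * mp_var Mc - 1) * mp_const (bracket i j :: (coord, 'k) mpoly)"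
    unfolding bracket_def hom_diff[OF semiring_hom_coaction] hom_mult[OF semiring_hom_coaction]
      hom_diff[OF semiring_hom_mp_const] hom_mult[OF semiring_hom_mp_const]
    by (simp add: coaction_def semiring_hom_mp_const2 algebra_simps)
  then show ?thesis unfolding SL2_invariant_def by (metis dvd_triv_left)
qed

section \<open>Torus weights of invariants\<close>

definition xdeg :: "nat \<Rightarrow> (coord \<Rightarrow>\<^sub>0 nat) \<Rightarrow> nat" where
  "xdeg n m = (\<Sum>i\<in>{1..n}. lkp m (Xc i))"

definition ydeg :: "nat \<Rightarrow> (coord \<Rightarrow>\<^sub>0 nat) \<Rightarrow> nat" where
  "ydeg n m = (\<Sum>i\<in>{1..n}. lkp m (Yc i))"

abbreviation coord_vars :: "nat \<Rightarrow> coord set" where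
  "coord_vars n \<equiv> Xc ` {1..n} \<union> Yc ` {1..n}"

lemma monomial_eval_col:
  assumes "keys_of m \<subseteq> coord_vars n"
  shows "monomial_eval (col x y) m = (\<Prod>i\<in>{1..n}. x i ^ lkp m (Xc i)) * (\<Prod>i\<in>{1..n}. y i ^ lkp m (Yc i))"
proof -
  have "monomial_eval (col x y) m = (\<Prod>v\<in>coord_vars n. col x y v ^ lkp m v)"
    by (rule monomial_eval_superset) (use assms in auto)
  also have "\<dots> = (\<Prod>v\<in>Xc ` {1..n}. col x y v ^ lkp m v) * (\<Prod>v\<in>Yc ` {1..n}. col x y v ^ lkp m v)"
    by (rule prod.union_disjoint) auto
  finally show ?thesis by (simp add: prod.reindex inj_on_def)
qed

lemma monomial_eval_scale:
  assumes "keys_of m \<subseteq> coord_vars n"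
  shows "monomial_eval (col (\<lambda>i. s * x i) (\<lambda>i. t * y i)) m
    = s ^ xdeg n m * t ^ ydeg n m * monomial_eval (col x y) m"
  by (simp add: monomial_eval_col[OF assms] power_mult_distrib prod.distrib xdeg_def ydeg_def power_sum ac_simps)

lemma mp_eval_scale_y:
  assumes V: "mp_in_vars (coord_vars n) f" and y: "\<And>m. m \<in> keys_of f \<Longrightarrow> ydeg n m = B"
  shows "mp_eval \<phi> (col x (\<lambda>i. t * y i)) f = t ^ B * mp_eval \<phi> (col x y) f"
proof -
  have "monomial_eval (col x (\<lambda>i. t * y i)) m = t ^ B * monomial_eval (col x y) m"
    if "m \<in> keys_of f" for m
    using monomial_eval_scale[of m n 1 x t y] that V y by (auto simp: mp_in_vars_def)
  then show ?thesis
    by (simp add: mp_eval_alt sum_distrib_left ac_simps cong: sum.cong)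
qed

text \<open>The torus is evaluated in Laurent polynomials over S, that is \<open>int \<Rightarrow>\<^sub>0 S\<close>, with
  \<open>a = t\<close> and \<open>d = 1/t\<close>.\<close>

lemma SL2_invariant_xdeg_eq_ydeg:
  fixes f :: "(coord, 'k::field) mpoly"
  assumes inv: "SL2_invariant f" and V: "mp_in_vars (coord_vars n) f" and m: "m \<in> keys_of f"
  shows "xdeg n m = ydeg n m"
proof (rule ccontr)
  assume ne: "xdeg n m \<noteq> ydeg n m"
  define \<phi> :: "'k \<Rightarrow> int \<Rightarrow>\<^sub>0 (coord, 'k) mpoly" where "\<phi> = (\<lambda>c. sgl 0 (mp_const c))"
  have \<phi>: "semiring_hom \<phi>" unfolding \<phi>_def
    by (rule semiring_hom_comp[OF semiring_hom_single_0 semiring_hom_mp_const])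
  define t :: "int \<Rightarrow>\<^sub>0 (coord, 'k) mpoly" where "t = sgl 1 1"
  define t' :: "int \<Rightarrow>\<^sub>0 (coord, 'k) mpoly" where "t' = sgl (-1) 1"
  have pw: "t ^ k = sgl (int k) 1" "t' ^ k = sgl (- int k) 1" for k
    by (induction k) (auto simp: t_def t'_def mult_single)
  define x where "x = (\<lambda>i. sgl (0::int) (vX i :: (coord, 'k) mpoly))"
  define y where "y = (\<lambda>i. sgl (0::int) (vY i :: (coord, 'k) mpoly))"
  have eqc: "col x y = (\<lambda>v. sgl 0 (mp_var v))"
    by (rule sym, rule col_eqI) (simp_all add: x_def y_def)
  have me: "monomial_eval (col x y) m' = sgl 0 (sgl m' 1)" for m'
    unfolding eqc monomial_eval_var[symmetric] monomial_eval_def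
    by (simp add: hom_prod[OF semiring_hom_single_0] hom_power[OF semiring_hom_single_0])
  have "mp_eval \<phi> (col (\<lambda>i. t * x i + 0 * y i) (\<lambda>i. 0 * x i + t' * y i)) f = mp_eval \<phi> (col x y) f"
    by (rule SL2_invariant_eval[OF inv \<phi>]) (simp add: t_def t'_def mult_single)
  also have "mp_eval \<phi> (col x y) f = sgl 0 f"
    unfolding eqc \<phi>_def hom_mp_eval[OF semiring_hom_single_0, symmetric] by (simp add: mp_eval_id)
  also have "mp_eval \<phi> (col (\<lambda>i. t * x i + 0 * y i) (\<lambda>i. 0 * x i + t' * y i)) f
      = (\<Sum>m'\<in>keys_of f. sgl (int (xdeg n m') - int (ydeg n m')) (sgl m' (lkp f m')))"
    unfolding mp_eval_alt
  proof (rule sum.cong)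
    fix m' assume m': "m' \<in> keys_of f"
    then have V': "keys_of m' \<subseteq> coord_vars n" using V by (auto simp: mp_in_vars_def)
    show "\<phi> (lkp f m') * monomial_eval (col (\<lambda>i. t * x i + 0 * y i) (\<lambda>i. 0 * x i + t' * y i)) m'
        = sgl (int (xdeg n m') - int (ydeg n m')) (sgl m' (lkp f m'))"
      by (simp add: monomial_eval_scale[OF V'] me) (simp add: \<phi>_def pw mult_single mp_const_def)
  qed simp
  \<comment> \<open>Compare the coefficient of the monomial m in the Laurent degree
    \<open>xdeg n m - ydeg n m\<close>, nonzero by assumption. On the left it is the coefficient of
    m in f; on the right everything sits in degree 0.\<close>
  finally have "lkp (lkp (\<Sum>m'\<in>keys_of f. sgl (int (xdeg n m') - int (ydeg n m')) (sgl m' (lkp f m')))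
      (int (xdeg n m) - int (ydeg n m))) m = lkp (lkp (sgl (0::int) f) (int (xdeg n m) - int (ydeg n m))) m"
    by simp
  moreover have "lkp (lkp (\<Sum>m'\<in>keys_of f. sgl (int (xdeg n m') - int (ydeg n m')) (sgl m' (lkp f m')))
      (int (xdeg n m) - int (ydeg n m))) m = (\<Sum>m'\<in>keys_of f. if m' = m then lkp f m else 0)"
    unfolding lookup_sum by (rule sum.cong) (auto simp: lookup_single when_def)
  ultimately show False using m ne by (auto simp: lookup_single when_def in_keys_iff)
qed

section \<open>The upper bound\<close>

definition shear_hom :: "(coord, 'k::field) mpoly \<Rightarrow> (coord, 'k) mpoly" where
  "shear_hom = mp_eval mp_const (col vX (\<lambda>i. vX i + vY i))"

lemma SL2_invariant_shear: "SL2_invariant f \<Longrightarrow> shear_hom f = f"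
proof -
  assume "SL2_invariant f"
  \<comment> \<open>The positional arguments follow the order of \<open>a * d - b * c\<close>, so a
    = d = c = 1 and b = 0: x is fixed and y becomes x + y.\<close>
  from SL2_invariant_eval[OF this semiring_hom_mp_const, of 1 1 0 1 vX vY]
  have "shear_hom f = mp_eval mp_const (col vX vY) f" by (simp add: shear_hom_def)
  also have "col vX vY = (mp_var :: coord \<Rightarrow> (coord, 'a) mpoly)" by (rule sym, rule col_eqI) auto
  finally show ?thesis by (simp add: mp_eval_id)
qed

lemma semiring_hom_shear: "semiring_hom shear_hom"
  unfolding shear_hom_def by (rule semiring_hom_mp_eval[OF semiring_hom_mp_const])

lemma mp_eval_shear:
  assumes "semiring_hom \<phi>"
  shows "mp_eval \<phi> (col x y) (shear_hom f) = mp_eval \<phi> (col x (\<lambda>i. x i + y i)) f"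
  unfolding shear_hom_def hom_mp_eval[OF semiring_hom_mp_eval[OF assms]]
  by (subst col_eqI[where \<alpha>="\<lambda>v. mp_eval \<phi> (col x y) (col vX (\<lambda>i. vX i + vY i) v)"])
    (auto simp: assms mp_eval_add)

lemma degree_monomial_eval_le:
  fixes x :: "nat \<Rightarrow> 'b::comm_ring_1 poly"
  assumes "keys_of m \<subseteq> coord_vars n" "\<And>i. deg (x i) \<le> 1" "\<And>i. deg (y i) = 0"
  shows "deg (monomial_eval (col x y) m) \<le> xdeg n m"
proof -
  have "deg (\<Prod>i\<in>A. x i ^ lkp m (Xc i)) \<le> (\<Sum>i\<in>A. lkp m (Xc i))" for A
  proof (induction A rule: infinite_finite_induct)
    case (insert i A)
    have "deg (x i ^ lkp m (Xc i)) \<le> lkp m (Xc i)"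
      by (rule order_trans[OF degree_power_le]) (use assms(2)[of i] in auto)
    with insert show ?case by (auto intro!: order_trans[OF degree_mult_le] add_mono)
  qed auto
  moreover have "deg (\<Prod>i\<in>A. y i ^ lkp m (Yc i)) = 0" for A
  proof (induction A rule: infinite_finite_induct)
    case (insert i A)
    have "deg (y i ^ lkp m (Yc i)) \<le> 0"
      by (rule order_trans[OF degree_power_le]) (use assms(3)[of i] in auto)
    with insert have "deg (y i ^ lkp m (Yc i) * (\<Prod>i\<in>A. y i ^ lkp m (Yc i))) \<le> 0 + 0"
      by (intro order_trans[OF degree_mult_le] add_mono) auto
    with insert show ?case by simp
  qed auto
  ultimately show ?thesis
    unfolding monomial_eval_col[OF assms(1)] xdeg_def
    by (metis (no_types, lifting) add.right_neutral degree_mult_le le_trans)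
qed

text \<open>With t an indeterminate, homogeneity and shear invariance turn \<open>t\<^sup>B f(x + t y, y)\<close> into
  \<open>f(x + t y, t y) = f(x + t y, -x)\<close>, whose degree in t is at most A.\<close>

lemma shear_invariant_ydeg_le_xdeg:
  fixes f :: "(coord, 'k::field) mpoly"
  assumes V: "mp_in_vars (coord_vars n) f" and nz: "f \<noteq> 0" and sh: "shear_hom f = f"
    and A: "\<And>m. m \<in> keys_of f \<Longrightarrow> xdeg n m = A"
    and B: "\<And>m. m \<in> keys_of f \<Longrightarrow> ydeg n m = B"
  shows "B \<le> A"
proof (rule ccontr)
  assume "\<not> B \<le> A"
  define \<phi> :: "'k \<Rightarrow> (coord, 'k) mpoly poly" where "\<phi> = (\<lambda>c. [:mp_const c:])"
  have \<phi>: "semiring_hom \<phi>" unfolding \<phi>_def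
    by (intro semiring_homI) (auto simp: hom_zero[OF semiring_hom_mp_const] one_pCons
        hom_one[OF semiring_hom_mp_const] hom_add[OF semiring_hom_mp_const] hom_mult[OF semiring_hom_mp_const])
  define x :: "nat \<Rightarrow> (coord, 'k) mpoly poly" where "x = (\<lambda>i. [:vX i, vY i:])"
  define y :: "nat \<Rightarrow> (coord, 'k) mpoly poly" where "y = (\<lambda>i. [:vY i:])"
  define z :: "nat \<Rightarrow> (coord, 'k) mpoly poly" where "z = (\<lambda>i. [:- vX i:])"
  define t :: "(coord, 'k) mpoly poly" where "t = Polynomial.monom 1 1"
  define P where "P = mp_eval \<phi> (col x y) f"
  have "t ^ B * P = mp_eval \<phi> (col x (\<lambda>i. t * y i)) f"
    unfolding P_def by (rule mp_eval_scale_y[OF V B, symmetric])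
  \<comment> \<open>Here \<open>t y = (x + t y) + (- x)\<close>, so the second row is the shear of
    \<open>z = - x\<close> by the first row, and shear invariance removes it.\<close>
  also have "(\<lambda>i. t * y i) = (\<lambda>i. x i + z i)"
    by (auto simp: t_def x_def y_def z_def monom_Suc monom_0)
  also have "mp_eval \<phi> (col x \<dots>) f = mp_eval \<phi> (col x z) f"
    using mp_eval_shear[OF \<phi>, of x z f] sh by simp
  finally have eq: "t ^ B * P = mp_eval \<phi> (col x z) f" .
  have "deg (mp_eval \<phi> (col x z) f) \<le> A"
    unfolding mp_eval_alt
  proof (rule degree_sum_le)
    fix m assume m: "m \<in> keys_of f"
    have "deg (monomial_eval (col x z) m) \<le> A"
      using degree_monomial_eval_le[of m n x z] m V A[OF m] by (auto simp: x_def z_def mp_in_vars_def)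
    moreover have "deg (\<phi> (lkp f m)) = 0" by (simp add: \<phi>_def)
    ultimately show "deg (\<phi> (lkp f m) * monomial_eval (col x z) m) \<le> A"
      using degree_mult_le[of "\<phi> (lkp f m)" "monomial_eval (col x z) m"] by simp
  qed simp
  \<comment> \<open>The degree in t is at most A < B. The coefficient of \<open>t ^ B\<close> in
    \<open>t ^ B * P\<close> is the constant term of P, and setting t = 0 in P gives back f.\<close>
  then have "poly.coeff (t ^ B * P) B = 0"
    unfolding eq using \<open>\<not> B \<le> A\<close> by (intro coeff_eq_0) simp
  moreover have "t ^ B = Polynomial.monom 1 B" by (simp add: t_def monom_power)
  ultimately have "poly.coeff P 0 = 0" by (simp add: coeff_monom_mult)
  then have "poly P 0 = 0" by (simp add: poly_0_coeff_0)
  moreover have "poly P 0 = f"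
  proof -
    have h: "semiring_hom (\<lambda>p :: (coord, 'k) mpoly poly. poly p 0)" by (intro semiring_homI) auto
    have "poly P 0 = mp_eval mp_const (\<lambda>v. poly (col x y v) 0) f"
      unfolding P_def hom_mp_eval[OF h] by (simp add: \<phi>_def)
    also have "(\<lambda>v. poly (col x y v) 0) = mp_var"
      by (rule trans[OF col_eqI[of _ vX vY] col_eqI[of mp_var vX vY, symmetric]]) (auto simp: x_def y_def)
    finally show ?thesis by (simp add: mp_eval_id)
  qed
  ultimately show False using nz by simp
qed

lemma lookup_monomial_mult:
  fixes g :: "('v, 'a::comm_semiring_1) mpoly"
  shows "lkp (sgl a 1 * g) (a + m) = lkp g m"
proof -
  have "sgl a 1 * g = (\<Sum>m\<in>keys_of g. sgl (a + m) (lkp g m))"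
    by (subst poly_mapping_sum_single[of g]) (simp add: sum_distrib_left mult_single)
  then show ?thesis
    by (auto simp: lookup_sum lookup_single when_def in_keys_iff)
qed

lemma monomial_mult_cancel:
  fixes g :: "('v, 'a::comm_semiring_1) mpoly"
  shows "sgl a 1 * g = sgl a 1 * h \<Longrightarrow> g = h"
  by (metis lookup_monomial_mult poly_mapping_eqI)

text \<open>Column strictness in terms of contents. Let the exponents of \<open>Xc j\<close> and
  \<open>Yc j\<close> count the entries j of the first and second row: the second-row entries up to
  i must stand below first-row entries less than i, which explains the half-open range.\<close>

definition ballot :: "nat \<Rightarrow> (coord \<Rightarrow>\<^sub>0 nat) \<Rightarrow> bool" where
  "ballot n m \<longleftrightarrow> (\<forall>i\<in>{1..n}. (\<Sum>j\<in>{1..i}. lkp m (Yc j)) \<le> (\<Sum>j\<in>{1..<i}. lkp m (Xc j)))"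

lemma ex_in_keys: "p \<noteq> 0 \<Longrightarrow> \<exists>m. m \<in> keys_of p"
  by (metis in_keys_iff lookup_zero poly_mapping_eqI)

lemma divide_by_variable:
  fixes f :: "('v, 'a::comm_semiring_1) mpoly"
  assumes dv: "\<And>m. m \<in> keys_of f \<Longrightarrow> lkp m v \<ge> 1"
  obtains g where "f = mp_var v * g" "keys_of f = (\<lambda>m. sgl v 1 + m) ` keys_of g"
proof -
  have bck: "sgl v 1 + (m - sgl v 1) = m" if "m \<in> keys_of f" for m
    using dv[OF that] by (intro poly_mapping_eqI) (auto simp: lookup_add lookup_minus lookup_single when_def)
  define g where "g = (\<Sum>m\<in>keys_of f. sgl (m - sgl v 1) (lkp f m))"
  have "inj_on (\<lambda>m. m - sgl v 1) (keys_of f)"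
    by (rule inj_on_inverseI[where g="\<lambda>m. sgl v 1 + m"]) (rule bck)
  then have k: "keys_of g = (\<lambda>m. m - sgl v 1) ` keys_of f"
    unfolding g_def by (intro keys_sum_single_inj) (auto simp: in_keys_iff)
  show ?thesis
  proof
    show "keys_of f = (\<lambda>m. sgl v 1 + m) ` keys_of g"
      unfolding k image_image by (rule sym, rule trans[OF image_cong[OF refl bck]]) simp_all
    have "mp_var v * g = (\<Sum>m\<in>keys_of f. sgl m (lkp f m))"
      unfolding g_def sum_distrib_left by (rule sum.cong) (auto simp: mp_var_def mult_single bck simp del: One_nat_def)
    then show "f = mp_var v * g" using poly_mapping_sum_single[of f] by simp
  qed
qed

text \<open>The induction removes a factor \<open>x\<^sub>n\<close> if f is divisible by it. Otherwise the previous lemma gives the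
  ballot inequality for the whole word, and setting \<open>x\<^sub>n = 0\<close>, \<open>y\<^sub>n = 1\<close> removes the last column.\<close>

lemma shear_invariant_ballot_monomial:
  fixes f :: "(coord, 'k::field) mpoly"
  assumes "mp_in_vars (coord_vars n) f" "f \<noteq> 0" "shear_hom f = f"
    and "\<And>m i. m \<in> keys_of f \<Longrightarrow> i \<in> {1..n} \<Longrightarrow> lkp m (Xc i) + lkp m (Yc i) = w i"
    and "\<And>m. m \<in> keys_of f \<Longrightarrow> ydeg n m = B"
  shows "\<exists>m\<in>keys_of f. ballot n m"
  using assms
\<comment> \<open>Division by the last x-variable lowers the weight sum, and deletion of the last
  column lowers n; the measure decreases in both cases.\<close>
proof (induction "n + (\<Sum>i\<in>{1..n}. w i)" arbitrary: n w B f rule: less_induct)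
  case less
  note V = less.prems(1) and nz = less.prems(2) and sh = less.prems(3) and w = less.prems(4)
    and B = less.prems(5)
  show ?case
  proof (cases n)
    case 0
    then show ?thesis using ex_in_keys[OF nz] by (auto simp: ballot_def)
  next
    case (Suc n')
    have n: "n \<in> {1..n}" using Suc by simp
    show ?thesis
    proof (cases "\<forall>m\<in>keys_of f. lkp m (Xc n) \<ge> 1")
      case True
      then obtain g where g: "f = vX n * g"
        and k: "keys_of f = (\<lambda>m. sgl (Xc n) 1 + m) ` keys_of g"
        by (metis divide_by_variable)
      have g0: "g \<noteq> 0" using g nz by auto
      have "vX n * shear_hom g = vX n * g"
        using sh unfolding g hom_mult[OF semiring_hom_shear]
        by (simp add: shear_hom_def semiring_hom_mp_const)
      then have shg: "shear_hom g = g" unfolding mp_var_def by (rule monomial_mult_cancel)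
      have Vg: "mp_in_vars (coord_vars n) g"
        unfolding mp_in_vars_def
      proof
        fix m assume m: "m \<in> keys_of g"
        have "keys_of m \<subseteq> keys_of (sgl (Xc n) 1 + m)"
          by (auto simp: in_keys_iff lookup_add)
        also have "\<dots> \<subseteq> coord_vars n" using V k m by (auto simp: mp_in_vars_def)
        finally show "keys_of m \<subseteq> coord_vars n" .
      qed
      have wn: "w n \<ge> 1"
      proof -
        obtain m where "m \<in> keys_of f" using ex_in_keys[OF nz] by blast
        then show ?thesis using w[of m n] True n by force
      qed
      define w' where "w' = w(n := w n - 1)"
      have less': "n + (\<Sum>i\<in>{1..n}. w' i) < n + (\<Sum>i\<in>{1..n}. w i)"
        using wn n unfolding w'_def by (intro add_strict_left_mono sum_strict_mono_ex1) auto
      have w'g: "lkp m (Xc i) + lkp m (Yc i) = w' i" if "m \<in> keys_of g" "i \<in> {1..n}" for m i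
        using w[of "sgl (Xc n) 1 + m" i] that k unfolding w'_def
        by (auto simp: lookup_add lookup_single when_def split: if_splits)
      have Bg: "ydeg n m = B" if "m \<in> keys_of g" for m
        using B[of "sgl (Xc n) 1 + m"] that k by (auto simp: ydeg_def lookup_add lookup_single when_def)
      from less.hyps[OF less' Vg g0 shg w'g Bg]
      obtain m where m: "m \<in> keys_of g" "ballot n m" by blast
      \<comment> \<open>The x-sums run over \<open>j < i\<close> with i at most n, so the restored
        factor \<open>Xc n\<close> enters none of them.\<close>
      have "ballot n (sgl (Xc n) 1 + m)"
        using m(2) unfolding ballot_def
        by (auto simp: lookup_add lookup_single when_def sum.distrib)
      then show ?thesis using m k by auto
    next
      case False
      then obtain m0 where m0: "m0 \<in> keys_of f" "lkp m0 (Xc n) = 0" by (auto simp: not_le)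
      define A where "A = (\<Sum>i\<in>{1..n}. w i) - B"
      have AB: "xdeg n m + ydeg n m = (\<Sum>i\<in>{1..n}. w i)" if "m \<in> keys_of f" for m
        unfolding xdeg_def ydeg_def sum.distrib[symmetric] using w[OF that] by simp
      have xA: "xdeg n m = A" if "m \<in> keys_of f" for m
        using AB[OF that] B[OF that] by (simp add: A_def)
      have BA: "B \<le> A" by (rule shear_invariant_ydeg_le_xdeg[OF V nz sh xA B])
      \<comment> \<open>\<open>M\<close> holds the monomials that survive setting the last x to 0.
        In them the last y has the full exponent \<open>w n\<close>, so setting that y to 1 removes
        the common factor \<open>s\<close> and merges no two monomials.\<close>
      define M where "M = {m \<in> keys_of f. lkp m (Xc n) = 0}"
      define s where "s = sgl (Yc n) (w n)"
      have M: "finite M" "m0 \<in> M" using m0 by (auto simp: M_def)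
      have bck: "m - s + s = m" if "m \<in> M" for m
        using that w[of m n] n unfolding s_def M_def
        by (intro poly_mapping_eqI) (auto simp: lookup_add lookup_minus lookup_single when_def)
      define g where "g = (\<Sum>m\<in>M. sgl (m - s) (lkp f m))"
      have kg: "keys_of g = (\<lambda>m. m - s) ` M"
      proof -
        have "inj_on (\<lambda>m. m - s) M" by (rule inj_on_inverseI[where g="\<lambda>m. m + s"]) (rule bck)
        then show ?thesis
          unfolding g_def using M(1) by (intro keys_sum_single_inj) (auto simp: M_def in_keys_iff)
      qed
      have no_n: "lkp m' (Xc n) = 0" "lkp m' (Yc n) = 0" if m': "m' \<in> keys_of g" for m'
      proof -
        obtain m where m: "m \<in> M" "m' = m - s" using m' kg by blast
        then have "lkp m (Xc n) = 0" "lkp m (Yc n) = w n" using w[of m n] n unfolding M_def by simp_all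
        then show "lkp m' (Xc n) = 0" "lkp m' (Yc n) = 0"
          unfolding m(2) s_def lookup_minus by simp_all
      qed
      have lk: "lkp (m - s) v = lkp m v" if "v \<noteq> Yc n" for m v
        using that by (auto simp: s_def lookup_minus lookup_single when_def)
      define x :: "nat \<Rightarrow> (coord, 'k) mpoly" where "x = vX(n := 0)"
      define y :: "nat \<Rightarrow> (coord, 'k) mpoly" where "y = vY(n := 1)"
      have ge: "mp_eval mp_const (col x y) f = g"
      proof -
        have "mp_const (lkp f m) * monomial_eval (col x y) m = sgl (m - s) (lkp f m)" if "m \<in> M" for m
        proof -
          have "monomial_eval (col x y) m = monomial_eval (col x y) (m - s) * monomial_eval (col x y) s"
            using bck[OF that] by (metis monomial_eval_add)
          also have "monomial_eval (col x y) s = 1" by (simp add: s_def y_def)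
          also have "monomial_eval (col x y) (m - s) = monomial_eval mp_var (m - s)"
          proof (rule monomial_eval_cong)
            fix v assume "v \<in> keys_of (m - s)"
            then have "v \<noteq> Xc n" "v \<noteq> Yc n"
              using no_n[of "m - s"] that unfolding kg by (auto simp: in_keys_iff)
            then show "col x y v = mp_var v" by (cases v) (auto simp: x_def y_def)
          qed
          finally show ?thesis by (simp add: monomial_eval_var mp_const_def mult_single)
        qed
        moreover have "mp_const (lkp f m) * monomial_eval (col x y) m = 0"
          if m: "m \<in> keys_of f - M" for m
        proof -
          obtain k where "lkp m (Xc n) = Suc k"
            using m by (cases "lkp m (Xc n)") (simp_all add: M_def)
          then have "Xc n \<in> keys_of m" "col x y (Xc n) ^ lkp m (Xc n) = 0"
            by (simp_all add: in_keys_iff x_def)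
          then have "monomial_eval (col x y) m = 0" unfolding monomial_eval_def
            by (blast intro: prod_zero[OF finite_keys])
          then show ?thesis by simp
        qed
        moreover have "M \<subseteq> keys_of f" unfolding M_def by blast
        ultimately show ?thesis unfolding mp_eval_alt g_def
          by (metis (no_types, lifting) sum.mono_neutral_cong_right[OF finite_keys])
      qed
      \<comment> \<open>The substitution is compatible with the shear because the constant column
        (0, 1) satisfies y + x = y.\<close>
      have shg: "shear_hom g = g"
      proof -
        have "shear_hom g = mp_eval mp_const (\<lambda>v. shear_hom (col x y v)) f"
          unfolding ge[symmetric] hom_mp_eval[OF semiring_hom_shear]
          by (simp add: shear_hom_def semiring_hom_mp_const)
        also have "(\<lambda>v. shear_hom (col x y v)) = col x (\<lambda>i. x i + y i)"
        proof (rule col_eqI)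
          have v: "shear_hom (vX i) = vX i" "shear_hom (vY i) = vX i + vY i" for i
            by (simp_all add: shear_hom_def semiring_hom_mp_const)
          show "shear_hom (col x y (Xc i)) = x i" for i
            by (simp add: x_def v hom_zero[OF semiring_hom_shear])
          show "shear_hom (col x y (Yc i)) = x i + y i" for i
            by (simp add: x_def y_def v hom_one[OF semiring_hom_shear])
        qed
        also have "mp_eval mp_const \<dots> f = mp_eval mp_const (col x y) (shear_hom f)"
          by (rule mp_eval_shear[OF semiring_hom_mp_const, symmetric])
        finally show ?thesis by (simp add: sh ge)
      qed
      have g0: "g \<noteq> 0" using kg M by auto
      have Vg: "mp_in_vars (coord_vars n') g"
        unfolding mp_in_vars_def
      proof
        fix m' assume m': "m' \<in> keys_of g"
        then obtain m where m: "m \<in> M" "m' = m - s" using kg by auto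
        have "keys_of m' \<subseteq> keys_of m"
          unfolding m by (auto simp: in_keys_iff lookup_minus)
        also have "\<dots> \<subseteq> coord_vars n" using V m by (auto simp: mp_in_vars_def M_def)
        finally have "keys_of m' \<subseteq> coord_vars n" .
        moreover have "Xc n \<notin> keys_of m'" "Yc n \<notin> keys_of m'"
          using no_n[OF m'] by (auto simp: in_keys_iff)
        ultimately show "keys_of m' \<subseteq> coord_vars n'"
          unfolding Suc by (auto simp: atLeastAtMostSuc_conv)
      qed
      have less': "n' + (\<Sum>i\<in>{1..n'}. w i) < n + (\<Sum>i\<in>{1..n}. w i)" using Suc by simp
      have wg: "lkp m' (Xc i) + lkp m' (Yc i) = w i" if "m' \<in> keys_of g" "i \<in> {1..n'}" for m' i
        using that w Suc unfolding kg M_def by (auto simp: lk)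
      have Bg: "ydeg n' m' = B - w n" if m': "m' \<in> keys_of g" for m'
      proof -
        obtain m where m: "m \<in> M" "m' = m - s" using kg m' by auto
        have "lkp m (Yc n) = w n" using w[of m n] n m unfolding M_def by simp
        moreover have "(\<Sum>i\<in>{1..n'}. lkp m' (Yc i)) = (\<Sum>i\<in>{1..n'}. lkp m (Yc i))"
          unfolding m(2) by (intro sum.cong lk) (use Suc in auto)
        ultimately have "ydeg n m = ydeg n' m' + w n" unfolding ydeg_def Suc by simp
        then show ?thesis using B[of m] m by (simp add: M_def)
      qed
      from less.hyps[OF less' Vg g0 shg wg Bg]
      obtain m' where m': "m' \<in> keys_of g" "ballot n' m'" by blast
      then obtain m where m: "m \<in> M" "m' = m - s" using kg by auto
      have "ballot n m" unfolding ballot_def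
      proof
        fix i assume i: "i \<in> {1..n}"
        show "(\<Sum>j\<in>{1..i}. lkp m (Yc j)) \<le> (\<Sum>j\<in>{1..<i}. lkp m (Xc j))"
        \<comment> \<open>For i = n the inequality is \<open>B \<le> A\<close>: the last x does not
          divide m, so the x-variables before n already account for the x-degree A.\<close>
        proof (cases "i = n")
          case True
          have "(\<Sum>j\<in>{1..n}. lkp m (Yc j)) = B" using B[of m] m by (simp add: ydeg_def M_def)
          moreover have "(\<Sum>j\<in>{1..<n}. lkp m (Xc j)) = A"
          proof -
            have "{1..n} = insert n {1..<n}" using n by auto
            then show ?thesis using xA[of m] m by (simp add: xdeg_def M_def)
          qed
          ultimately show ?thesis using BA True by simp
        next
          case False
          then have i': "i \<in> {1..n'}" using i Suc by auto
          have "(\<Sum>j\<in>{1..i}. lkp m' (Yc j)) = (\<Sum>j\<in>{1..i}. lkp m (Yc j))"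
            using i' Suc unfolding m by (intro sum.cong lk) auto
          moreover have "(\<Sum>j\<in>{1..<i}. lkp m' (Xc j)) = (\<Sum>j\<in>{1..<i}. lkp m (Xc j))"
            unfolding m by (intro sum.cong lk) auto
          ultimately show ?thesis using m'(2) i' unfolding ballot_def by metis
        qed
      qed
      then show ?thesis using m by (auto simp: M_def)
    qed
  qed
qed

section \<open>Two-row tableaux and ballot monomials\<close>

text \<open>In a weakly increasing row the entries up to i occupy an initial segment. A row is
  therefore recovered from its cumulative counts.\<close>

lemma mono_row_le_iff:
  fixes a :: "nat \<Rightarrow> nat"
  assumes mono: "\<And>c c'. c < c' \<Longrightarrow> c' < h \<Longrightarrow> a c \<le> a c'" and c: "c < h"
  shows "a c \<le> i \<longleftrightarrow> c < card {c'. c' < h \<and> a c' \<le> i}"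
proof
  assume ai: "a c \<le> i"
  have "{..c} \<subseteq> {c'. c' < h \<and> a c' \<le> i}"
  proof
    fix c' assume "c' \<in> {..c}"
    then have "c' < h" "a c' \<le> a c" using mono[of c' c] c by (cases "c' = c"; simp)+
    then show "c' \<in> {c'. c' < h \<and> a c' \<le> i}" using ai by simp
  qed
  from card_mono[OF _ this] show "c < card {c'. c' < h \<and> a c' \<le> i}" by simp
next
  assume l: "c < card {c'. c' < h \<and> a c' \<le> i}"
  show "a c \<le> i"
  proof (rule ccontr)
    assume "\<not> a c \<le> i"
    then have "c' < c" if "c' < h" "a c' \<le> i" for c'
      using mono[of c c'] that by (cases "c = c'"; cases "c < c'"; simp)
    then have "{c'. c' < h \<and> a c' \<le> i} \<subseteq> {..<c}" by auto
    from card_mono[OF _ this] show False using l by simp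
  qed
qed

lemma card_row_le:
  fixes a :: "nat \<Rightarrow> nat"
  assumes "\<And>c. c < h \<Longrightarrow> a c \<ge> 1"
  shows "card {c. c < h \<and> a c \<le> i} = (\<Sum>j\<in>{1..i}. card {c. c < h \<and> a c = j})"
proof -
  have "{c. c < h \<and> a c \<le> i} = (\<Union>j\<in>{1..i}. {c. c < h \<and> a c = j})" using assms by auto
  also have "card \<dots> = (\<Sum>j\<in>{1..i}. card {c. c < h \<and> a c = j})"
    by (rule card_UN_disjoint) auto
  finally show ?thesis .
qed

text \<open>The weakly increasing row in which j occurs \<alpha> j times, read off as the quantile
  function of the cumulative counts.\<close>

definition row_of :: "(nat \<Rightarrow> nat) \<Rightarrow> nat \<Rightarrow> nat" where
  "row_of \<alpha> c = (LEAST i. c < (\<Sum>j\<in>{1..i}. \<alpha> j))"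

context
  fixes \<alpha> :: "nat \<Rightarrow> nat" and h n :: nat
  assumes h: "(\<Sum>j\<in>{1..n}. \<alpha> j) = h"
begin

lemma row_of_le_iff: assumes "c < h" shows "row_of \<alpha> c \<le> i \<longleftrightarrow> c < (\<Sum>j\<in>{1..i}. \<alpha> j)"
proof
  have mono: "(\<Sum>j\<in>{1..i}. \<alpha> j) \<le> (\<Sum>j\<in>{1..i'}. \<alpha> j)" if "i \<le> i'" for i i'
    by (rule sum_mono2) (use that in auto)
  have "c < (\<Sum>j\<in>{1..row_of \<alpha> c}. \<alpha> j)"
    unfolding row_of_def by (rule LeastI[of _ n]) (use assms h in simp)
  then show "row_of \<alpha> c \<le> i \<Longrightarrow> c < (\<Sum>j\<in>{1..i}. \<alpha> j)" using mono by (meson less_le_trans)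
  show "c < (\<Sum>j\<in>{1..i}. \<alpha> j) \<Longrightarrow> row_of \<alpha> c \<le> i" unfolding row_of_def by (rule Least_le)
qed

lemma row_of_range: "c < h \<Longrightarrow> row_of \<alpha> c \<in> {1..n}"
  using row_of_le_iff[of c 0] row_of_le_iff[of c n] h by (auto simp: not_le)

lemma row_of_mono: "c < c' \<Longrightarrow> c' < h \<Longrightarrow> row_of \<alpha> c \<le> row_of \<alpha> c'"
  using row_of_le_iff[of c "row_of \<alpha> c'"] row_of_le_iff[of c' "row_of \<alpha> c'"] by simp

lemma card_row_of: assumes "i \<in> {1..n}" shows "card {c. c < h \<and> row_of \<alpha> c = i} = \<alpha> i"
proof -
  have le: "(\<Sum>j\<in>{1..i}. \<alpha> j) \<le> h" unfolding h[symmetric] by (rule sum_mono2) (use assms in auto)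
  have eq: "row_of \<alpha> c = i \<longleftrightarrow> row_of \<alpha> c \<le> i \<and> \<not> row_of \<alpha> c \<le> i - 1" for c
    using assms by auto
  have "{c. c < h \<and> row_of \<alpha> c = i} = {(\<Sum>j\<in>{1..i-1}. \<alpha> j)..<(\<Sum>j\<in>{1..i}. \<alpha> j)}"
  proof (intro subset_antisym subsetI)
    fix c assume "c \<in> {c. c < h \<and> row_of \<alpha> c = i}"
    then have "c < h" "row_of \<alpha> c \<le> i" "\<not> row_of \<alpha> c \<le> i - 1" using eq by blast+
    then show "c \<in> {(\<Sum>j\<in>{1..i-1}. \<alpha> j)..<(\<Sum>j\<in>{1..i}. \<alpha> j)}"
      unfolding row_of_le_iff[OF \<open>c < h\<close>] atLeastLessThan_iff by (meson not_less)
  next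
    fix c assume c: "c \<in> {(\<Sum>j\<in>{1..i-1}. \<alpha> j)..<(\<Sum>j\<in>{1..i}. \<alpha> j)}"
    then have ch: "c < h" using le by (meson atLeastLessThan_iff less_le_trans)
    then have "row_of \<alpha> c = i"
      using c unfolding eq row_of_le_iff[OF ch] atLeastLessThan_iff by (meson not_less)
    then show "c \<in> {c. c < h \<and> row_of \<alpha> c = i}" using ch by simp
  qed
  moreover have "(\<Sum>j\<in>{1..i}. \<alpha> j) = (\<Sum>j\<in>{1..i-1}. \<alpha> j) + \<alpha> i"
    using assms by (cases i) auto
  ultimately show ?thesis by simp
qed

end

text \<open>The product, over the columns, of the diagonal terms of the corresponding brackets; it
  will be their leading monomial.\<close>

definition tableau_monomial :: "nat \<Rightarrow> (nat \<times> nat \<Rightarrow> nat) \<Rightarrow> (coord \<Rightarrow>\<^sub>0 nat)" where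
  "tableau_monomial h T = (\<Sum>c<h. sgl (Xc (T (0, c))) 1 + sgl (Yc (T (1, c))) 1)"

lemma lookup_tableau_monomial:
  "lkp (tableau_monomial h T) (Xc i) = card {c. c < h \<and> T (0, c) = i}"
  "lkp (tableau_monomial h T) (Yc i) = card {c. c < h \<and> T (1, c) = i}"
proof -
  have *: "(\<Sum>c<h. if P c then 1 else 0 :: nat) = card {c. c < h \<and> P c}" for P :: "nat \<Rightarrow> bool"
    by (simp add: sum.If_cases Int_def)
  show "lkp (tableau_monomial h T) (Xc i) = card {c. c < h \<and> T (0, c) = i}"
    "lkp (tableau_monomial h T) (Yc i) = card {c. c < h \<and> T (1, c) = i}"
    unfolding *[symmetric] tableau_monomial_def
    by (auto simp: lookup_sum lookup_add lookup_single when_def intro!: sum.cong)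
qed

lemma cells_two_rows: "cells [h, h] = {0, 1} \<times> {..<h}"
  by (auto simp: cells_def less_Suc_eq)

lemma card_Pair_image: "card (Pair r ` A) = card A"
  by (rule card_image) (simp add: inj_on_def)

lemma in_ssyt_two_rows_iff:
  "T \<in> ssyt [h, h] \<mu> \<longleftrightarrow> T \<in> extensional ({0, 1} \<times> {..<h}) \<and>
     (\<forall>c<h. T (0, c) \<ge> 1 \<and> T (0, c) < T (1, c)) \<and>
     (\<forall>c c'. c < c' \<longrightarrow> c' < h \<longrightarrow> T (0, c) \<le> T (0, c') \<and> T (1, c) \<le> T (1, c')) \<and>
     (\<forall>j\<ge>1. card {c. c < h \<and> T (0, c) = j} + card {c. c < h \<and> T (1, c) = j} = \<mu> j)"
proof -
  have card: "card {x \<in> {0, 1} \<times> {..<h}. T x = j}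
      = card {c. c < h \<and> T (0, c) = j} + card {c. c < h \<and> T (1, c) = j}" for j
  proof -
    have eq: "{x \<in> {0, 1} \<times> {..<h}. T x = j}
        = Pair 0 ` {c. c < h \<and> T (0, c) = j} \<union> Pair 1 ` {c. c < h \<and> T (1, c) = j}" by auto
    show ?thesis
      unfolding eq by (subst card_Un_disjoint) (auto simp: card_Pair_image)
  qed
  show ?thesis
  proof
    assume T: "T \<in> ssyt [h, h] \<mu>"
    note T' = T[unfolded ssyt_def cells_two_rows mem_Collect_eq]
    note P = T'[THEN conjunct1] and R = T'[THEN conjunct2, THEN conjunct1, rule_format]
      and C = T'[THEN conjunct2, THEN conjunct2, THEN conjunct1, rule_format]
      and M = T'[THEN conjunct2, THEN conjunct2, THEN conjunct2]
    have "T (0, c) \<ge> 1 \<and> T (0, c) < T (1, c)" if "c < h" for c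
      using PiE_mem[OF P, of "(0, c)"] C[of 0 c 1] that by simp
    moreover have "T (0, c) \<le> T (0, c') \<and> T (1, c) \<le> T (1, c')" if "c < c'" "c' < h" for c c'
      using R[of 0 c c'] R[of 1 c c'] that by simp
    moreover have "T \<in> extensional ({0, 1} \<times> {..<h})" using P by (simp add: PiE_def)
    ultimately show "T \<in> extensional ({0, 1} \<times> {..<h}) \<and>
     (\<forall>c<h. T (0, c) \<ge> 1 \<and> T (0, c) < T (1, c)) \<and>
     (\<forall>c c'. c < c' \<longrightarrow> c' < h \<longrightarrow> T (0, c) \<le> T (0, c') \<and> T (1, c) \<le> T (1, c')) \<and>
     (\<forall>j\<ge>1. card {c. c < h \<and> T (0, c) = j} + card {c. c < h \<and> T (1, c) = j} = \<mu> j)"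
      using M unfolding card by blast
  next
    assume T: "T \<in> extensional ({0, 1} \<times> {..<h}) \<and>
     (\<forall>c<h. T (0, c) \<ge> 1 \<and> T (0, c) < T (1, c)) \<and>
     (\<forall>c c'. c < c' \<longrightarrow> c' < h \<longrightarrow> T (0, c) \<le> T (0, c') \<and> T (1, c) \<le> T (1, c')) \<and>
     (\<forall>j\<ge>1. card {c. c < h \<and> T (0, c) = j} + card {c. c < h \<and> T (1, c) = j} = \<mu> j)"
    then have col: "\<And>c. c < h \<Longrightarrow> T (0, c) \<ge> 1 \<and> T (0, c) < T (1, c)"
      and row: "\<And>c c'. c < c' \<Longrightarrow> c' < h \<Longrightarrow> T (0, c) \<le> T (0, c') \<and> T (1, c) \<le> T (1, c')" by simp_all
    have "T x \<in> {1..}" if "x \<in> {0, 1} \<times> {..<h}" for x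
    proof -
      have "x = (0, snd x) \<or> x = (1, snd x)" "snd x < h" using that by auto
      then show ?thesis using col[of "snd x"] by (metis atLeast_iff le_less_trans less_imp_le)
    qed
    then have 1: "T \<in> {0, 1} \<times> {..<h} \<rightarrow>\<^sub>E {1..}"
      using T by (simp only: PiE_iff) blast
    have 2: "T (r, c) \<le> T (r, c')"
      if "(r, c) \<in> {0, 1} \<times> {..<h}" "(r, c') \<in> {0, 1} \<times> {..<h}" "c < c'" for r c c'
      using row[of c c'] that by auto
    have 3: "T (r, c) < T (r', c)"
      if "(r, c) \<in> {0, 1} \<times> {..<h}" "(r', c) \<in> {0, 1} \<times> {..<h}" "r < r'" for r r' c
    proof -
      have "r = 0" "r' = 1" "c < h" using that by auto
      then show ?thesis using col[of c] by simp
    qed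
    have 4: "card {x \<in> {0, 1} \<times> {..<h}. T x = j} = \<mu> j" if "j \<ge> 1" for j
      unfolding card using T that by simp
    show "T \<in> ssyt [h, h] \<mu>"
      unfolding ssyt_def cells_two_rows mem_Collect_eq
      by (intro conjI allI impI) (rule 1 2 3 4; assumption)+
  qed
qed

definition ballot_monomials :: "nat \<Rightarrow> (nat \<Rightarrow> int) \<Rightarrow> (coord \<Rightarrow>\<^sub>0 nat) set" where
  "ballot_monomials n w = {m. keys_of m \<subseteq> coord_vars n \<and>
     (\<forall>i\<in>{1..n}. int (lkp m (Xc i) + lkp m (Yc i)) = w i) \<and> xdeg n m = ydeg n m \<and> ballot n m}"

lemma weight_sum_ballot:
  assumes "\<And>i. i \<in> {1..n} \<Longrightarrow> int (lkp m (Xc i) + lkp m (Yc i)) = w i"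
  shows "(\<Sum>i\<in>{1..n}. w i) = int (xdeg n m + ydeg n m)"
  unfolding xdeg_def ydeg_def sum.distrib[symmetric] of_nat_sum by (rule sum.cong) (use assms in auto)

text \<open>A semistandard tableau with two rows is determined by the number of occurrences of each
  letter in each row. Column strictness becomes the ballot condition, and equal row lengths become
  equal x- and y-degree.\<close>

lemma bij_betw_tableau_monomial:
  fixes w :: "nat \<Rightarrow> int"
  assumes w: "w \<in> even_lattice n" "w \<in> nonneg_weights n"
  defines "h \<equiv> nat (half_weight n w)"
  shows "bij_betw (tableau_monomial h) (ssyt [h, h] (weight_content n w)) (ballot_monomials n w)"
proof -
  have w0: "w i \<ge> 0" if "i \<in> {1..n}" for i using w(2) that by (auto simp: nonneg_weights_def)
  have h2: "(\<Sum>i\<in>{1..n}. w i) = 2 * int h"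
  proof -
    have "(\<Sum>i\<in>{1..n}. w i) \<ge> 0" using w0 by (rule sum_nonneg)
    then show ?thesis using w(1) by (auto simp: h_def half_weight_def even_lattice_def)
  qed
  let ?S = "ssyt [h, h] (weight_content n w)" and ?f = "tableau_monomial h"
  have S: "(\<And>c. c < h \<Longrightarrow> T (0, c) \<ge> 1 \<and> T (1, c) \<ge> 1 \<and> T (0, c) < T (1, c))"
    "(\<And>c c'. c < c' \<Longrightarrow> c' < h \<Longrightarrow> T (0, c) \<le> T (0, c'))"
    "(\<And>c c'. c < c' \<Longrightarrow> c' < h \<Longrightarrow> T (1, c) \<le> T (1, c'))"
    "(\<And>j. j \<ge> 1 \<Longrightarrow> card {c. c < h \<and> T (0, c) = j} + card {c. c < h \<and> T (1, c) = j} = weight_content n w j)"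
    if "T \<in> ?S" for T
    using that unfolding in_ssyt_two_rows_iff by (fastforce, blast+)
  \<comment> \<open>The content is 0 beyond n, so an entry larger than n would occur zero
    times.\<close>
  have le_n: "T (0, c) \<le> n \<and> T (1, c) \<le> n" if T: "T \<in> ?S" and c: "c < h" for T c
  proof -
    have "v \<le> n" if "v = T (0, c) \<or> v = T (1, c)" for v
    proof (rule ccontr)
      assume "\<not> v \<le> n"
      moreover have "v \<ge> 1" using S(1)[OF T c] that by auto
      ultimately have "card {c. c < h \<and> T (0, c) = v} + card {c. c < h \<and> T (1, c) = v} = 0"
        using S(4)[OF T] by (simp add: weight_content_def)
      then show False using that c by auto
    qed
    then show ?thesis by auto
  qed
  have inS: "?f T \<in> ballot_monomials n w" if T: "T \<in> ?S" for T
  proof -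
    note s = S[OF T]
    have keys: "keys_of (?f T) \<subseteq> coord_vars n"
    proof
      fix v assume "v \<in> keys_of (?f T)"
      then show "v \<in> coord_vars n" using s(1) le_n[OF T]
        by (cases v) (fastforce simp: in_keys_iff lookup_tableau_monomial)+
    qed
    have "int (lkp (?f T) (Xc i) + lkp (?f T) (Yc i)) = w i" if "i \<in> {1..n}" for i
      using s(4)[of i] that w0[of i] by (simp add: lookup_tableau_monomial weight_content_def)
    moreover have "xdeg n (?f T) = h" "ydeg n (?f T) = h"
    proof -
      have "{c. c < h \<and> T (0, c) \<le> n} = {..<h}" "{c. c < h \<and> T (1, c) \<le> n} = {..<h}"
        using le_n[OF T] by auto
      then show "xdeg n (?f T) = h" "ydeg n (?f T) = h"
        using card_row_le[of h "\<lambda>c. T (0, c)" n] card_row_le[of h "\<lambda>c. T (1, c)" n] s(1)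
        by (simp_all add: xdeg_def ydeg_def lookup_tableau_monomial)
    qed
    moreover have "ballot n (?f T)"
      unfolding ballot_def
    proof
      fix i assume i: "i \<in> {1..n}"
      have "(\<Sum>j\<in>{1..i}. lkp (?f T) (Yc j)) = card {c. c < h \<and> T (1, c) \<le> i}"
        using card_row_le[of h "\<lambda>c. T (1, c)" i] s(1) by (simp add: lookup_tableau_monomial)
      \<comment> \<open>A column whose lower entry is at most i has upper entry at most i -
        1.\<close>
      also have "\<dots> \<le> card {c. c < h \<and> T (0, c) \<le> i - 1}"
        by (rule card_mono) (use s(1) in force)+
      also have "\<dots> = (\<Sum>j\<in>{1..i-1}. lkp (?f T) (Xc j))"
        using card_row_le[of h "\<lambda>c. T (0, c)" "i - 1"] s(1) by (simp add: lookup_tableau_monomial)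
      also have "{1..i-1} = {1..<i}" using i by auto
      finally show "(\<Sum>j\<in>{1..i}. lkp (?f T) (Yc j)) \<le> (\<Sum>j\<in>{1..<i}. lkp (?f T) (Xc j))" .
    qed
    ultimately show ?thesis using keys by (auto simp: ballot_monomials_def)
  qed
  have inj: "inj_on ?f ?S"
  proof (rule inj_onI)
    fix T T' assume T: "T \<in> ?S" and T': "T' \<in> ?S" and eq: "?f T = ?f T'"
    have cnt: "card {c. c < h \<and> T (r, c) \<le> i} = card {c. c < h \<and> T' (r, c) \<le> i}" if "r \<in> {0, 1}" for r i
    proof -
      have "card {c. c < h \<and> T (r, c) = j} = card {c. c < h \<and> T' (r, c) = j}" for j
        using that arg_cong[OF eq, of "\<lambda>m. lkp m (Xc j)"] arg_cong[OF eq, of "\<lambda>m. lkp m (Yc j)"]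
        by (auto simp: lookup_tableau_monomial)
      then show ?thesis
        using card_row_le[of h "\<lambda>c. T (r, c)" i] card_row_le[of h "\<lambda>c. T' (r, c)" i] S(1)[OF T] S(1)[OF T'] that
        by auto
    qed
    have iff: "T (r, c) \<le> i \<longleftrightarrow> T' (r, c) \<le> i" if r: "r \<in> {0, 1}" and c: "c < h" for r c i
    proof -
      have "T (r, c) \<le> i \<longleftrightarrow> c < card {c'. c' < h \<and> T (r, c') \<le> i}"
        by (rule mono_row_le_iff[OF _ c]) (use r S(2,3)[OF T] in auto)
      moreover have "T' (r, c) \<le> i \<longleftrightarrow> c < card {c'. c' < h \<and> T' (r, c') \<le> i}"
        by (rule mono_row_le_iff[OF _ c]) (use r S(2,3)[OF T'] in auto)
      ultimately show ?thesis using cnt[OF r] by simp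
    qed
    have "T x = T' x" if "x \<in> {0, 1} \<times> {..<h}" for x
      using that iff by (metis (no_types, lifting) SigmaE lessThan_iff le_antisym order_refl)
    moreover have "T \<in> extensional ({0, 1} \<times> {..<h})" "T' \<in> extensional ({0, 1} \<times> {..<h})"
      using T T' by (auto simp: in_ssyt_two_rows_iff)
    ultimately show "T = T'" by (intro extensionalityI)
  qed
  have surj: "m \<in> ?f ` ?S" if m: "m \<in> ballot_monomials n w" for m
  proof -
    define \<alpha> \<beta> where "\<alpha> = (\<lambda>i. lkp m (Xc i))" and "\<beta> = (\<lambda>i. lkp m (Yc i))"
    have sum: "int (\<alpha> i + \<beta> i) = w i" if "i \<in> {1..n}" for i
      using m that by (simp add: ballot_monomials_def \<alpha>_def \<beta>_def)
    have "xdeg n m = ydeg n m" using m by (simp add: ballot_monomials_def)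
    moreover have "int (xdeg n m + ydeg n m) = 2 * int h"
      using weight_sum_ballot[of n m w] m h2 by (simp add: ballot_monomials_def)
    ultimately have A: "(\<Sum>j\<in>{1..n}. \<alpha> j) = h" and B: "(\<Sum>j\<in>{1..n}. \<beta> j) = h"
      unfolding \<alpha>_def \<beta>_def xdeg_def[symmetric] ydeg_def[symmetric] by linarith+
    define T where "T = (\<lambda>x\<in>{0, 1} \<times> {..<h}. if fst x = (0::nat) then row_of \<alpha> (snd x) else row_of \<beta> (snd x))"
    have Tv: "T (0, c) = row_of \<alpha> c" "T (1, c) = row_of \<beta> c" if "c < h" for c
      using that by (auto simp: T_def)
    have cnt: "card {c. c < h \<and> T (0, c) = j} = (if j \<in> {1..n} then \<alpha> j else 0)"
      "card {c. c < h \<and> T (1, c) = j} = (if j \<in> {1..n} then \<beta> j else 0)" for j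
    proof -
      have "{c. c < h \<and> T (0, c) = j} = {c. c < h \<and> row_of \<alpha> c = j}"
        "{c. c < h \<and> T (1, c) = j} = {c. c < h \<and> row_of \<beta> c = j}" using Tv by auto
      then show "card {c. c < h \<and> T (0, c) = j} = (if j \<in> {1..n} then \<alpha> j else 0)"
        "card {c. c < h \<and> T (1, c) = j} = (if j \<in> {1..n} then \<beta> j else 0)"
        using card_row_of[OF A] card_row_of[OF B] row_of_range[OF A] row_of_range[OF B] by auto
    qed
    have lt: "row_of \<alpha> c < row_of \<beta> c" if c: "c < h" for c
    proof -
      let ?i = "row_of \<beta> c"
      have i: "?i \<in> {1..n}" by (rule row_of_range[OF B c])
      have "c < (\<Sum>j\<in>{1..?i}. \<beta> j)" using row_of_le_iff[OF B c, of ?i] by simp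
      also have "\<dots> \<le> (\<Sum>j\<in>{1..<?i}. \<alpha> j)"
        using m i by (auto simp: ballot_monomials_def ballot_def \<alpha>_def \<beta>_def)
      also have "{1..<?i} = {1..?i - 1}" using i by auto
      finally have "row_of \<alpha> c \<le> ?i - 1" using row_of_le_iff[OF A c] by blast
      then show ?thesis using i by auto
    qed
    have "T \<in> ?S" unfolding in_ssyt_two_rows_iff
    proof (intro conjI allI impI)
      show "T \<in> extensional ({0, 1} \<times> {..<h})" by (simp add: T_def)
      show "T (0, c) \<ge> 1" if "c < h" for c using Tv[OF that] row_of_range[OF A that] by simp
      show "T (0, c) < T (1, c)" if "c < h" for c using Tv[OF that] lt[OF that] by simp
      show "T (0, c) \<le> T (0, c')" if "c < c'" "c' < h" for c c'
        using that row_of_mono[OF A that] Tv by simp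
      show "T (1, c) \<le> T (1, c')" if "c < c'" "c' < h" for c c'
        using that row_of_mono[OF B that] Tv by simp
      show "card {c. c < h \<and> T (0, c) = j} + card {c. c < h \<and> T (1, c) = j} = weight_content n w j"
        if "j \<ge> 1" for j
        unfolding cnt using sum[of j] by (auto simp: weight_content_def simp flip: nat_int_add)
    qed
    moreover have "?f T = m"
    proof (rule poly_mapping_eqI)
      fix v
      have out: "lkp m v = 0" if "v \<notin> coord_vars n"
        using m that by (auto simp: ballot_monomials_def in_keys_iff)
      show "lkp (?f T) v = lkp m v"
      proof (cases v)
        case (Xc i)
        have "lkp m v = 0" if "i \<notin> {1..n}" by (rule out) (use that Xc in auto)
        then show ?thesis unfolding Xc lookup_tableau_monomial cnt by (auto simp: \<alpha>_def)
      next
        case (Yc i)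
        have "lkp m v = 0" if "i \<notin> {1..n}" by (rule out) (use that Yc in auto)
        then show ?thesis unfolding Yc lookup_tableau_monomial cnt by (auto simp: \<beta>_def)
      qed
    qed
    ultimately show ?thesis by blast
  qed
  show ?thesis unfolding bij_betw_def using inj inS surj by blast
qed

section \<open>The Hilbert function counts tableaux\<close>

text \<open>A linear functional on exponents that separates the two terms of a bracket. It only
  preorders the monomials, which suffices because all other terms of the products considered are
  strictly lower.\<close>

definition height :: "nat \<Rightarrow> (coord \<Rightarrow>\<^sub>0 nat) \<Rightarrow> nat" where
  "height n m = (\<Sum>i\<in>{1..n}. i * lkp m (Yc i))"

definition cdeg :: "(coord \<Rightarrow>\<^sub>0 nat) \<Rightarrow> nat \<Rightarrow> nat" where
  "cdeg m i = lkp m (Xc i) + lkp m (Yc i)"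

lemma height_add: "height n (a + b) = height n a + height n b"
  by (simp add: height_def lookup_add algebra_simps sum.distrib)

lemma cdeg_add: "cdeg (a + b) = (\<lambda>i. cdeg a i + cdeg b i)"
  by (auto simp: cdeg_def lookup_add)

text \<open>The leading coefficient is 1, so that independence holds in every characteristic. The
  column degree and the variables of the lower terms are recorded because they place bracket
  products in the right graded piece.\<close>

definition leads :: "nat \<Rightarrow> (coord, 'k::field) mpoly \<Rightarrow> (coord \<Rightarrow>\<^sub>0 nat) \<Rightarrow> bool" where
  "leads n p m \<longleftrightarrow> keys_of m \<subseteq> coord_vars n \<and>
     (\<exists>q. p = sgl m 1 + q \<and> (\<forall>m'\<in>keys_of q.
        height n m' < height n m \<and> cdeg m' = cdeg m \<and> keys_of m' \<subseteq> coord_vars n))"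

lemma leads_one: "leads n 1 0"
  unfolding leads_def by (intro conjI exI[of _ 0]) auto

lemma keys_add_subset:
  fixes a b :: "'v \<Rightarrow>\<^sub>0 nat"
  shows "keys_of a \<subseteq> V \<Longrightarrow> keys_of b \<subseteq> V \<Longrightarrow> keys_of (a + b) \<subseteq> V"
  using keys_add[of a b] by blast

lemma leads_mult:
  assumes "leads n p a" "leads n q b"
  shows "leads n (p * q) (a + b)"
proof -
  obtain p' where p: "p = sgl a 1 + p'" and p': "\<And>m. m \<in> keys_of p' \<Longrightarrow>
      height n m < height n a \<and> cdeg m = cdeg a \<and> keys_of m \<subseteq> coord_vars n"
    using assms(1) unfolding leads_def by blast
  obtain q' where q: "q = sgl b 1 + q'" and q': "\<And>m. m \<in> keys_of q' \<Longrightarrow>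
      height n m < height n b \<and> cdeg m = cdeg b \<and> keys_of m \<subseteq> coord_vars n"
    using assms(2) unfolding leads_def by blast
  have V: "keys_of a \<subseteq> coord_vars n" "keys_of b \<subseteq> coord_vars n"
    using assms by (auto simp: leads_def)
  define r where "r = sgl a 1 * q' + (p' * sgl b 1 + p' * q')"
  have "p * q = sgl (a + b) 1 + r"
    by (simp add: p q r_def mult_single algebra_simps)
  moreover have "height n m < height n (a + b) \<and> cdeg m = cdeg (a + b) \<and> keys_of m \<subseteq> coord_vars n"
    if m: "m \<in> keys_of r" for m
  proof -
    have "m \<in> keys_of (sgl a (1::'a) * q') \<or> m \<in> keys_of (p' * sgl b 1) \<or> m \<in> keys_of (p' * q')"
      using m keys_add[of "sgl a (1::'a) * q'" "p' * sgl b 1 + p' * q'"] keys_add[of "p' * sgl b 1" "p' * q'"]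
      unfolding r_def by blast
    then obtain m1 m2 where m12: "m = m1 + m2" and
      c: "m1 = a \<and> m2 \<in> keys_of q' \<or> m1 \<in> keys_of p' \<and> m2 = b \<or>
       m1 \<in> keys_of p' \<and> m2 \<in> keys_of q'"
    proof (elim disjE)
      assume "m \<in> keys_of (sgl a (1::'a) * q')"
      then obtain x y where "m = x + y" "x \<in> keys_of (sgl a (1::'a))" "y \<in> keys_of q'"
        using keys_mult[of "sgl a (1::'a)" q'] by blast
      then show thesis using that[of x y] by simp
    next
      assume "m \<in> keys_of (p' * sgl b 1)"
      then obtain x y where "m = x + y" "x \<in> keys_of p'" "y \<in> keys_of (sgl b (1::'a))"
        using keys_mult[of p' "sgl b 1"] by blast
      then show thesis using that[of x y] by simp
    next
      assume "m \<in> keys_of (p' * q')"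
      then obtain x y where "m = x + y" "x \<in> keys_of p'" "y \<in> keys_of q'"
        using keys_mult[of p' q'] by blast
      then show thesis using that[of x y] by simp
    qed
    from c show ?thesis
    proof (elim disjE conjE)
      assume "m1 = a" "m2 \<in> keys_of q'"
      then show ?thesis using q'[of m2] keys_add_subset[of m1 "coord_vars n" m2] V
        unfolding m12 height_add cdeg_add by simp
    next
      assume "m1 \<in> keys_of p'" "m2 = b"
      then show ?thesis using p'[of m1] keys_add_subset[of m1 "coord_vars n" m2] V
        unfolding m12 height_add cdeg_add by simp
    next
      assume "m1 \<in> keys_of p'" "m2 \<in> keys_of q'"
      then show ?thesis using p'[of m1] q'[of m2] keys_add_subset[of m1 "coord_vars n" m2]
        unfolding m12 height_add cdeg_add by simp
    qed
  qed
  ultimately show ?thesis unfolding leads_def using keys_add_subset[OF V] by blast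
qed

lemma leads_prod:
  "finite A \<Longrightarrow> (\<And>i. i \<in> A \<Longrightarrow> leads n (p i) (m i)) \<Longrightarrow> leads n (\<Prod>i\<in>A. p i) (\<Sum>i\<in>A. m i)"
  by (induction A rule: finite_induct) (auto simp: leads_one intro: leads_mult)

text \<open>The diagonal term has height j and the other term, with the two indices exchanged, has
  height i < j.\<close>

lemma leads_bracket:
  assumes "i \<in> {1..n}" "j \<in> {1..n}" "i < j"
  shows "leads n (bracket i j) (sgl (Xc i) 1 + sgl (Yc j) 1)"
  unfolding leads_def
proof (intro conjI exI ballI)
  show "keys_of (sgl (Xc i) 1 + sgl (Yc j) (1::nat)) \<subseteq> coord_vars n"
    using assms by (intro keys_add_subset) auto
  show "bracket i j = sgl (sgl (Xc i) 1 + sgl (Yc j) 1) 1 + sgl (sgl (Xc j) 1 + sgl (Yc i) 1) (- 1 :: 'a)"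
    by (simp add: bracket_def mp_var_def mult_single single_uminus)
  fix m assume "m \<in> keys_of (sgl (sgl (Xc j) 1 + sgl (Yc i) (1::nat)) (- 1 :: 'a))"
  then have m: "m = sgl (Xc j) 1 + sgl (Yc i) 1" by (auto split: if_splits)
  have h: "height n (sgl (Xc a) (1::nat)) = 0" "b \<in> {1..n} \<Longrightarrow> height n (sgl (Yc b) 1) = b" for a b
    by (auto simp: height_def lookup_single when_def if_distrib[of "\<lambda>x. _ * x"] cong: if_cong)
  show "height n m < height n (sgl (Xc i) 1 + sgl (Yc j) 1)"
    using assms unfolding m height_add by (simp only: h)
  show "cdeg m = cdeg (sgl (Xc i) 1 + sgl (Yc j) 1)"
    unfolding m by (auto simp: cdeg_def lookup_add lookup_single when_def)
  show "keys_of m \<subseteq> coord_vars n"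
    using assms unfolding m by (intro keys_add_subset) auto
qed

lemma leads_lookup:
  assumes "leads n p m"
  shows "lkp p m = 1" "lkp p m' \<noteq> 0 \<Longrightarrow> m' = m \<or> height n m' < height n m"
    "lkp p m' \<noteq> 0 \<Longrightarrow> cdeg m' = cdeg m" "lkp p m' \<noteq> 0 \<Longrightarrow> keys_of m' \<subseteq> coord_vars n"
proof -
  obtain q where p: "p = sgl m 1 + q" and q: "\<And>m'. m' \<in> keys_of q \<Longrightarrow>
      height n m' < height n m \<and> cdeg m' = cdeg m \<and> keys_of m' \<subseteq> coord_vars n"
    and V: "keys_of m \<subseteq> coord_vars n"
    using assms unfolding leads_def by blast
  have "lkp q m = 0" using q[of m] by (auto simp: in_keys_iff)
  then show "lkp p m = 1" by (simp add: p lookup_add)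
  have "m' = m \<or> m' \<in> keys_of q" if "lkp p m' \<noteq> 0" for m'
    using that by (auto simp: p lookup_add lookup_single when_def in_keys_iff split: if_splits)
  then show "lkp p m' \<noteq> 0 \<Longrightarrow> m' = m \<or> height n m' < height n m" "lkp p m' \<noteq> 0 \<Longrightarrow> cdeg m' = cdeg m"
    "lkp p m' \<noteq> 0 \<Longrightarrow> keys_of m' \<subseteq> coord_vars n"
    using q V by blast+
qed

definition tableau_bracket :: "nat \<Rightarrow> (nat \<times> nat \<Rightarrow> nat) \<Rightarrow> (coord, 'k::field) mpoly" where
  "tableau_bracket h T = (\<Prod>c<h. bracket (T (0, c)) (T (1, c)))"

lemma SL2_invariant_tableau_bracket: "SL2_invariant (tableau_bracket h T :: (coord, 'k::field) mpoly)"
proof -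
  have "SL2_invariant (\<Prod>c\<in>A. bracket (T (0, c)) (T (1, c)) :: (coord, 'k) mpoly)" if "finite A" for A
    using that
  proof induction
    case empty
    then show ?case using SL2_invariant_const[of 1] by (simp add: mp_const_def)
  qed (simp add: SL2_invariant_mult SL2_invariant_bracket)
  then show ?thesis by (simp add: tableau_bracket_def)
qed

lemma finite_ballot_monomials: "finite (ballot_monomials n w)"
proof -
  let ?V = "coord_vars n"
  define N where "N = Max (insert 0 ((\<lambda>i. nat (w i)) ` {1..n}))"
  have "(\<lambda>m. restrict (lkp m) ?V) ` ballot_monomials n w \<subseteq> ?V \<rightarrow>\<^sub>E {..N}"
  proof (intro image_subsetI restrict_PiE_iff[THEN iffD2] ballI)
    fix m v assume m: "m \<in> ballot_monomials n w" and v: "v \<in> ?V"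
    then obtain i where i: "i \<in> {1..n}" "v = Xc i \<or> v = Yc i" by auto
    have "int (lkp m (Xc i) + lkp m (Yc i)) = w i" using m i by (simp add: ballot_monomials_def)
    then have "lkp m v \<le> nat (w i)" using i by auto
    also have "\<dots> \<le> N" unfolding N_def using i by (intro Max_ge) auto
    finally show "lkp m v \<in> {..N}" by simp
  qed
  moreover have "finite (?V \<rightarrow>\<^sub>E {..N})" by (intro finite_PiE) auto
  moreover have "inj_on (\<lambda>m. restrict (lkp m) ?V) (ballot_monomials n w)"
  proof (rule inj_onI, rule poly_mapping_eqI)
    fix m m' v assume m: "m \<in> ballot_monomials n w" "m' \<in> ballot_monomials n w"
      and eq: "restrict (lkp m) ?V = restrict (lkp m') ?V"
    show "lkp m v = lkp m' v"
    proof (cases "v \<in> ?V")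
      case True
      then show ?thesis using fun_cong[OF eq, of v] by simp
    next
      case False
      then have "v \<notin> keys_of m" "v \<notin> keys_of m'"
        using m by (auto simp: ballot_monomials_def)
      then show ?thesis by (simp add: in_keys_iff)
    qed
  qed
  ultimately show ?thesis by (meson finite_imageD finite_subset)
qed

section \<open>Invariants of a fixed multidegree\<close>

definition weight_space :: "'k::field itself \<Rightarrow> nat \<Rightarrow> (nat \<Rightarrow> int) \<Rightarrow> (coord, 'k) mpoly set" where
  "weight_space _ n w = {f \<in> invariant_ring n. has_multidegree n w f}"

lemma weight_space_key:
  assumes "f \<in> weight_space TYPE('k::field) n w" "m \<in> keys_of f"
  shows "keys_of m \<subseteq> coord_vars n" "xdeg n m = ydeg n m"
    "i \<in> {1..n} \<Longrightarrow> int (lkp m (Xc i) + lkp m (Yc i)) = w i"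
proof -
  have V: "mp_in_vars (coord_vars n) f" and inv: "SL2_invariant f" and d: "has_multidegree n w f"
    using assms(1) by (auto simp: weight_space_def invariant_ring_def coord_ring_def)
  show "keys_of m \<subseteq> coord_vars n" using V assms(2) by (auto simp: mp_in_vars_def)
  show "xdeg n m = ydeg n m" by (rule SL2_invariant_xdeg_eq_ydeg[OF inv V assms(2)])
  show "i \<in> {1..n} \<Longrightarrow> int (lkp m (Xc i) + lkp m (Yc i)) = w i"
    using d assms(2) unfolding has_multidegree_def by blast
qed

text \<open>Torus invariance makes the y-degree of all monomials equal to half the total weight.
  This is the homogeneity that the shear argument requires.\<close>

lemma weight_space_ballot_key:
  assumes f: "f \<in> weight_space TYPE('k::field) n w" and nz: "f \<noteq> 0"
  shows "\<exists>m\<in>keys_of f. m \<in> ballot_monomials n w"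
proof -
  have V: "mp_in_vars (coord_vars n) f" and inv: "SL2_invariant f"
    using f by (auto simp: weight_space_def invariant_ring_def coord_ring_def)
  have "\<exists>m\<in>keys_of f. ballot n m"
  proof (rule shear_invariant_ballot_monomial[OF V nz SL2_invariant_shear[OF inv]])
    fix m i assume "m \<in> keys_of f" "i \<in> {1..n}"
    then show "lkp m (Xc i) + lkp m (Yc i) = nat (w i)"
      using weight_space_key(3)[OF f] by (metis nat_int)
  next
    fix m assume m: "m \<in> keys_of f"
    have "(\<Sum>i\<in>{1..n}. w i) = int (xdeg n m + ydeg n m)"
      by (rule weight_sum_ballot) (rule weight_space_key(3)[OF f m])
    then show "ydeg n m = nat ((\<Sum>i\<in>{1..n}. w i) div 2)"
      using weight_space_key(2)[OF f m] by simp
  qed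
  then show ?thesis using weight_space_key[OF f] by (auto simp: ballot_monomials_def)
qed

lemma lookup_mp_scale: "lkp (mp_scale c f) m = c * lkp f m"
proof -
  have "mp_scale c f = (\<Sum>m\<in>keys_of f. sgl m (c * lkp f m))"
    by (subst poly_mapping_sum_single[of f]) (simp add: mp_scale_def mp_const_def sum_distrib_left mult_single)
  then show ?thesis by (auto simp: lookup_sum lookup_single when_def in_keys_iff)
qed

lemma weight_space_iff:
  "f \<in> weight_space TYPE('k::field) n w \<longleftrightarrow> SL2_invariant f \<and> (\<forall>m\<in>keys_of f.
     keys_of m \<subseteq> coord_vars n \<and> (\<forall>i\<in>{1..n}. int (lkp m (Xc i) + lkp m (Yc i)) = w i))"
  unfolding weight_space_def invariant_ring_def coord_ring_def mp_in_vars_def has_multidegree_def by blast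

lemma subspace_weight_space:
  "module.subspace mp_scale (weight_space TYPE('k::field) n w)"
proof -
  interpret VS: vector_space "mp_scale :: 'k \<Rightarrow> _" by (rule vector_space_mp_scale)
  have sc: "keys_of (mp_scale c f) \<subseteq> keys_of f" for c :: 'k and f
    by (auto simp: in_keys_iff lookup_mp_scale)
  show ?thesis
  proof (rule VS.subspaceI)
    show "0 \<in> weight_space TYPE('k) n w"
      using SL2_invariant_const[of 0] by (simp add: weight_space_iff mp_const_def)
  next
    fix f g assume "f \<in> weight_space TYPE('k) n w" "g \<in> weight_space TYPE('k) n w"
    then show "f + g \<in> weight_space TYPE('k) n w"
      using keys_add[of f g] SL2_invariant_add[of f g] unfolding weight_space_iff by (meson UnE subsetD)
  next
    fix c :: 'k and f assume "f \<in> weight_space TYPE('k) n w"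
    then show "mp_scale c f \<in> weight_space TYPE('k) n w"
      using sc[of c f] SL2_invariant_mult[OF SL2_invariant_const, of f c]
      unfolding weight_space_iff mp_scale_def by (meson subsetD)
  qed
qed

lemma tableau_bracket_in_weight_space:
  assumes "leads n (tableau_bracket h T :: (coord, 'k::field) mpoly) m" "m \<in> ballot_monomials n w"
  shows "tableau_bracket h T \<in> weight_space TYPE('k) n w"
proof -
  let ?p = "tableau_bracket h T :: (coord, 'k) mpoly"
  have "keys_of m' \<subseteq> coord_vars n \<and> (\<forall>i\<in>{1..n}. int (lkp m' (Xc i) + lkp m' (Yc i)) = w i)"
    if "m' \<in> keys_of ?p" for m'
  proof -
    have nz: "lkp ?p m' \<noteq> 0" using that by (simp add: in_keys_iff)
    have "lkp m' (Xc i) + lkp m' (Yc i) = lkp m (Xc i) + lkp m (Yc i)" for i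
      using fun_cong[OF leads_lookup(3)[OF assms(1) nz], of i] by (simp only: cdeg_def)
    then show ?thesis using assms(2) leads_lookup(4)[OF assms(1) nz]
      unfolding ballot_monomials_def by simp
  qed
  then show ?thesis
    unfolding weight_space_iff using SL2_invariant_tableau_bracket by blast
qed

text \<open>In a linear relation choose a term with nonzero coefficient whose leading monomial has
  maximal height. No other such term contains that monomial: its own leading monomial is different,
  and the rest of it is strictly lower.\<close>

lemma independent_if_leads:
  fixes P :: "(coord, 'k::field) mpoly set"
  assumes fin: "finite P" and l: "\<And>x. x \<in> P \<Longrightarrow> leads n x (ld x)" and inj: "inj_on ld P"
  shows "\<not> module.dependent mp_scale P"
proof -
  interpret VS: vector_space "mp_scale :: 'k \<Rightarrow> _" by (rule vector_space_mp_scale)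
  show ?thesis
  proof (rule VS.independent_if_scalars_zero[OF fin], rule ccontr)
    fix c x assume z: "(\<Sum>x\<in>P. mp_scale (c x) x) = 0" and x: "x \<in> P" "c x \<noteq> 0"
    let ?N = "{x \<in> P. c x \<noteq> 0}"
    have N: "finite (height n ` ld ` ?N)" "height n ` ld ` ?N \<noteq> {}" using fin x by auto
    obtain y where y: "y \<in> P" "c y \<noteq> 0" and "Max (height n ` ld ` ?N) = height n (ld y)"
      using Max_in[OF N] by auto
    then have max: "height n (ld z) \<le> height n (ld y)" if "z \<in> P" "c z \<noteq> 0" for z
      using Max_ge[OF N(1), of "height n (ld z)"] that by auto
    have "c z * lkp z (ld y) = (if z = y then c y else 0)" if z: "z \<in> P" for z
    proof (cases "z = y")
      case True
      then show ?thesis using leads_lookup(1)[OF l[OF y(1)]] by simp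
    next
      case False
      then have ne: "ld y \<noteq> ld z" using inj y z by (auto simp: inj_on_def)
      have "c z = 0 \<or> lkp z (ld y) = 0"
        using leads_lookup(2)[OF l[OF z], of "ld y"] ne max[OF z] by force
      then show ?thesis using False by auto
    qed
    then have "lkp (\<Sum>x\<in>P. mp_scale (c x) x) (ld y) = (\<Sum>z\<in>P. if z = y then c y else 0)"
      unfolding lookup_sum lookup_mp_scale by (rule sum.cong[OF refl])
    then show False using z y fin by simp
  qed
qed

text \<open>Restriction of coefficients to the ballot monomials is injective on the invariants of degree w, which bounds
  the dimension from above; the bracket monomials of the tableaux attain the bound.\<close>

theorem hilbert_function_eq_card:
  assumes w: "w \<in> even_lattice n" "w \<in> nonneg_weights n"
  shows "hilbert_function TYPE('k::field) n w = card (ballot_monomials n w)"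
proof -
  interpret VS: vector_space "mp_scale :: 'k \<Rightarrow> _" by (rule vector_space_mp_scale)
  interpret VP: vector_space_pair "mp_scale :: 'k \<Rightarrow> _" "mp_scale :: 'k \<Rightarrow> (coord, 'k) mpoly \<Rightarrow> _" ..
  define h where "h = nat (half_weight n w)"
  let ?W = "weight_space TYPE('k) n w" and ?M = "ballot_monomials n w"
  let ?S = "ssyt [h, h] (weight_content n w)"
  have bij: "bij_betw (tableau_monomial h) ?S ?M"
    unfolding h_def by (rule bij_betw_tableau_monomial[OF w])
  let ?b = "tableau_bracket h :: _ \<Rightarrow> (coord, 'k) mpoly"
  have lead: "leads n (?b T) (tableau_monomial h T)" if T: "T \<in> ?S" for T
    unfolding tableau_bracket_def tableau_monomial_def
  proof (rule leads_prod)
    fix c assume "c \<in> {..<h}"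
    then have c: "c < h" by simp
    have lt: "T (0, c) < T (1, c)" using T c unfolding in_ssyt_two_rows_iff by blast
    have mem: "tableau_monomial h T \<in> ?M" using bij T by (auto simp: bij_betw_def)
    have "Xc (T (0, c)) \<in> keys_of (tableau_monomial h T)"
      "Yc (T (1, c)) \<in> keys_of (tableau_monomial h T)"
      using c by (auto simp: in_keys_iff lookup_tableau_monomial)
    then have "T (0, c) \<in> {1..n}" "T (1, c) \<in> {1..n}"
      using mem by (auto simp: ballot_monomials_def)
    then show "leads n (bracket (T (0, c)) (T (1, c))) (sgl (Xc (T (0, c))) 1 + sgl (Yc (T (1, c))) 1)"
      using lt by (rule leads_bracket)
  qed simp
  define ld where "ld = (\<lambda>x. tableau_monomial h (inv_into ?S ?b x))"
  define P where "P = ?b ` ?S"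
  have finS: "finite ?S" using bij finite_ballot_monomials bij_betw_finite by blast
  have injb: "inj_on ?b ?S"
  proof (rule inj_onI)
    fix T T' assume T: "T \<in> ?S" "T' \<in> ?S" "?b T = ?b T'"
    have "tableau_monomial h T = tableau_monomial h T'"
      using leads_lookup(1)[OF lead[OF T(1)]] leads_lookup(2)[OF lead[OF T(1)], of "tableau_monomial h T'"]
        leads_lookup(1)[OF lead[OF T(2)]] leads_lookup(2)[OF lead[OF T(2)], of "tableau_monomial h T"] T(3)
      by auto
    then show "T = T'" using bij T by (auto simp: bij_betw_def inj_on_def)
  qed
  have ldb: "ld (?b T) = tableau_monomial h T" if "T \<in> ?S" for T
    unfolding ld_def using that injb by simp
  have lP: "leads n x (ld x)" if "x \<in> P" for x using that lead ldb by (auto simp: P_def)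
  have "inj_on (ld \<circ> ?b) ?S"
    using bij inj_on_cong[of ?S "ld \<circ> ?b" "tableau_monomial h"] ldb by (simp add: bij_betw_def)
  then have injP: "inj_on ld P" unfolding P_def by (rule inj_on_imageI)
  have "finite P" unfolding P_def using finS by (rule finite_imageI)
  then have indP: "VS.independent P" using lP injP by (rule independent_if_leads)
  have cardP: "card P = card ?M" "finite P"
    unfolding P_def using card_image[OF injb] bij_betw_same_card[OF bij] finS by simp_all
  have PW: "P \<subseteq> ?W"
    unfolding P_def
  proof
    fix x assume "x \<in> ?b ` ?S"
    then obtain T where T: "T \<in> ?S" "x = ?b T" by blast
    then have "tableau_monomial h T \<in> ?M" using bij by (auto simp: bij_betw_def)
    then show "x \<in> ?W" unfolding T(2) by (rule tableau_bracket_in_weight_space[OF lead[OF T(1)]])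
  qed
  define L where "L = (\<lambda>f :: (coord, 'k) mpoly. \<Sum>m\<in>?M. sgl m (lkp f m))"
  have Ll: "lkp (L f) m = (if m \<in> ?M then lkp f m else 0)" for f m
    by (simp add: L_def lookup_sum lookup_single when_def finite_ballot_monomials)
  have lin: "Vector_Spaces.linear mp_scale mp_scale L"
    unfolding Vector_Spaces.linear_iff
    by (intro conjI allI vector_space_mp_scale poly_mapping_eqI) (auto simp: Ll lookup_add lookup_mp_scale)
  have injL: "inj_on L ?W"
  proof (rule inj_onI)
    fix f g assume fg: "f \<in> ?W" "g \<in> ?W" "L f = L g"
    have d: "f - g \<in> ?W" using fg subspace_weight_space VS.subspace_diff by blast
    have "lkp (f - g) m = 0" if "m \<in> ?M" for m
      using Ll[of f m] Ll[of g m] that fg(3) by (simp add: lookup_minus)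
    then have "f - g = 0" using weight_space_ballot_key[OF d] by (auto simp: in_keys_iff)
    then show "f = g" by simp
  qed
  \<comment> \<open>A vector outside the span would extend P to an independent set with one more
    element. Its image under \<open>L\<close> stays independent, but lies in the span of only
    \<open>card P\<close> monomials.\<close>
  have "?W \<subseteq> VS.span P"
  proof (rule subsetI, rule ccontr)
    fix v assume v: "v \<in> ?W" "v \<notin> VS.span P"
    then have ind: "VS.independent (insert v P)" using indP by (simp add: VS.independent_insertI)
    have vP: "insert v P \<subseteq> ?W" using v PW by simp
    then have sp: "VS.span (insert v P) \<subseteq> ?W" using VS.span_minimal subspace_weight_space by blast
    have "VS.independent (L ` insert v P)"
      using VP.linear_independent_injective_image[OF lin ind] inj_on_subset[OF injL sp] by blast
    moreover have "L ` insert v P \<subseteq> VS.span ((\<lambda>m. sgl m 1) ` ?M)"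
    proof
      fix x assume "x \<in> L ` insert v P"
      then obtain f where "x = L f" by blast
      also have "L f = (\<Sum>m\<in>?M. mp_scale (lkp f m) (sgl m 1))"
        unfolding L_def by (simp add: mp_scale_def mp_const_def mult_single)
      also have "\<dots> \<in> VS.span ((\<lambda>m. sgl m 1) ` ?M)"
        by (intro VS.span_sum VS.span_scale VS.span_base) auto
      finally show "x \<in> VS.span ((\<lambda>m. sgl m 1) ` ?M)" .
    qed
    ultimately have "card (L ` insert v P) \<le> card ((\<lambda>m. sgl m (1::'k)) ` ?M)"
      using VS.independent_span_bound finite_ballot_monomials by blast
    also have "\<dots> \<le> card ?M" by (rule card_image_le[OF finite_ballot_monomials])
    finally have "card (L ` insert v P) \<le> card P" by (simp add: cardP)
    moreover have "card (L ` insert v P) = Suc (card P)"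
    proof -
      have "v \<notin> P" using v(2) VS.span_base by blast
      then show ?thesis using card_image[OF inj_on_subset[OF injL vP]] cardP(2) by simp
    qed
    ultimately show False by simp
  qed
  then have "VS.dim ?W = card P" using VS.basis_card_eq_dim[OF PW _ indP] by simp
  also have "VS.dim ?W = hilbert_function TYPE('k) n w"
    unfolding hilbert_function_def weight_space_def ..
  finally show ?thesis using cardP(1) by simp
qed

text \<open>One monomial of a nonzero invariant forces both conditions: its exponents make w
  nonnegative, and its equal x- and y-degree makes the weight sum even.\<close>

lemma hilbert_function_eq_0:
  assumes "w \<in> int_weights n" "w \<notin> even_lattice n \<inter> nonneg_weights n"
  shows "hilbert_function TYPE('k::field) n w = 0"
proof -
  interpret VS: vector_space "mp_scale :: 'k \<Rightarrow> _" by (rule vector_space_mp_scale)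
  let ?W = "weight_space TYPE('k) n w"
  have "f = 0" if f: "f \<in> ?W" for f
  proof (rule ccontr)
    assume "f \<noteq> 0"
    then obtain m where m: "m \<in> keys_of f" using ex_in_keys by blast
    have "(\<Sum>i\<in>{1..n}. w i) = int (xdeg n m + ydeg n m)"
      by (rule weight_sum_ballot) (rule weight_space_key(3)[OF f m])
    then have "w \<in> even_lattice n"
      using weight_space_key(2)[OF f m] assms(1) by (simp add: even_lattice_def)
    moreover have "w i \<ge> 0" if "i \<in> {1..n}" for i
      using weight_space_key(3)[OF f m that] by linarith
    then have "w \<in> nonneg_weights n"
      using assms(1) by (auto simp: nonneg_weights_def int_weights_def PiE_iff)
    ultimately show False using assms(2) by blast
  qed
  then have "?W \<subseteq> VS.span {}" by auto
  from VS.basis_card_eq_dim[OF _ this] show ?thesis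
    unfolding hilbert_function_def weight_space_def[of "TYPE('k)", symmetric]
    by (simp add: VS.independent_empty)
qed

section \<open>Counting ballot words\<close>

text \<open>\<beta> is the vector of y-exponents, and \<open>w - \<beta>\<close> that of the
  x-exponents. The final excess d of x over y is kept as a parameter because removing the last
  letter changes it; invariants correspond to d = 0.\<close>

definition ballot_words :: "(nat \<Rightarrow> nat) \<Rightarrow> nat \<Rightarrow> int \<Rightarrow> (nat \<Rightarrow> nat) set" where
  "ballot_words w m d = {\<beta> \<in> {1..m} \<rightarrow>\<^sub>E UNIV. (\<forall>i\<in>{1..m}. \<beta> i \<le> w i) \<and>
     (\<forall>i\<in>{1..m}. (\<Sum>j\<in>{1..i}. \<beta> j) \<le> (\<Sum>j\<in>{1..<i}. w j - \<beta> j)) \<and>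
     (\<Sum>i\<in>{1..m}. int (w i) - 2 * int (\<beta> i)) = d}"

text \<open>The multiplicity of the torus weight d in the tensor product of the first m representations
  \<open>Sym\<^sup>w\<^sup>i\<close>.\<close>

fun weight_mult :: "(nat \<Rightarrow> nat) \<Rightarrow> nat \<Rightarrow> int \<Rightarrow> int" where
  "weight_mult w 0 d = (if d = 0 then 1 else 0)"
| "weight_mult w (Suc m) d = (\<Sum>b\<in>{0..w (Suc m)}. weight_mult w m (d - int (w (Suc m)) + 2 * int b))"

text \<open>The Weyl group symmetry of torus weights, realised in each factor by replacing b with
  its complement \<open>w (Suc m) - b\<close>.\<close>

lemma weight_mult_uminus: "weight_mult w m (- d) = weight_mult w m d"
proof (induction m arbitrary: d)
  case (Suc m)
  let ?k = "w (Suc m)"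
  have "weight_mult w (Suc m) (- d) = (\<Sum>b\<in>{0..?k}. weight_mult w m (- (d + int ?k - 2 * int b)))"
    by (simp add: algebra_simps)
  also have "\<dots> = (\<Sum>b\<in>{0..?k}. weight_mult w m (d + int ?k - 2 * int b))" by (simp only: Suc.IH)
  also have "\<dots> = (\<Sum>b\<in>{0..?k}. weight_mult w m (d - int ?k + 2 * int b))"
    by (rule sum.reindex_bij_witness[of _ "\<lambda>b. ?k - b" "\<lambda>b. ?k - b"]) (auto simp: of_nat_diff algebra_simps)
  finally show ?case by simp
qed auto

lemma finite_ballot_words: "finite (ballot_words w m d)"
proof (rule finite_subset)
  show "ballot_words w m d \<subseteq> {1..m} \<rightarrow>\<^sub>E {..Max (insert 0 (w ` {1..m}))}"
  proof
    fix \<beta> assume "\<beta> \<in> ballot_words w m d"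
    then have e: "\<beta> \<in> {1..m} \<rightarrow>\<^sub>E UNIV" and le: "\<forall>i\<in>{1..m}. \<beta> i \<le> w i"
      unfolding ballot_words_def by blast+
    have "\<beta> i \<in> {..Max (insert 0 (w ` {1..m}))}" if i: "i \<in> {1..m}" for i
    proof -
      have "w i \<le> Max (insert 0 (w ` {1..m}))" using i by (intro Max_ge) auto
      then show ?thesis using le i by (meson atMost_iff order_trans)
    qed
    then show "\<beta> \<in> {1..m} \<rightarrow>\<^sub>E {..Max (insert 0 (w ` {1..m}))}" using e by (simp add: PiE_iff)
  qed
  show "finite ({1..m} \<rightarrow>\<^sub>E {..Max (insert 0 (w ` {1..m}))})" by (intro finite_PiE) auto
qed

text \<open>The ballot condition at the last index compares the last exponent b only with the excess
  accumulated before it, which is \<open>d - w (Suc m) + 2 * b\<close>.\<close>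

lemma ballot_words_Suc:
  "ballot_words w (Suc m) d =
    (\<Union>b\<in>{b. b \<le> w (Suc m) \<and> int b \<le> d - int (w (Suc m)) + 2 * int b}.
       (\<lambda>\<beta>. \<beta>(Suc m := b)) ` ballot_words w m (d - int (w (Suc m)) + 2 * int b))"
  (is "?A = (\<Union>b\<in>?B. ?f b ` ?C b)")
proof -
  let ?n = "Suc m"
  have last: "(\<Sum>j\<in>{1..?n}. \<beta> j) \<le> (\<Sum>j\<in>{1..<?n}. w j - \<beta> j)
      \<longleftrightarrow> int (\<beta> ?n) \<le> (\<Sum>i\<in>{1..m}. int (w i) - 2 * int (\<beta> i))"
    if "\<And>i. i \<in> {1..m} \<Longrightarrow> \<beta> i \<le> w i" for \<beta> :: "nat \<Rightarrow> nat"
  proof -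
    have "int (\<Sum>j\<in>{1..<?n}. w j - \<beta> j) = (\<Sum>i\<in>{1..m}. int (w i) - int (\<beta> i))"
      unfolding of_nat_sum using that by (intro sum.cong) auto
    then have "int (\<Sum>j\<in>{1..<?n}. w j - \<beta> j) - int (\<Sum>j\<in>{1..m}. \<beta> j)
        = (\<Sum>i\<in>{1..m}. int (w i) - 2 * int (\<beta> i))"
      unfolding of_nat_sum by (simp add: sum_subtractf[symmetric] algebra_simps)
    moreover have "(\<Sum>j\<in>{1..?n}. \<beta> j) = (\<Sum>j\<in>{1..m}. \<beta> j) + \<beta> ?n" by simp
    ultimately show ?thesis by linarith
  qed
  show ?thesis
  proof (intro subset_antisym subsetI)
    fix \<beta> assume "\<beta> \<in> ?A"
    then have e: "\<beta> \<in> {1..?n} \<rightarrow>\<^sub>E UNIV" and le: "\<And>i. i \<in> {1..?n} \<Longrightarrow> \<beta> i \<le> w i"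
      and b: "\<And>i. i \<in> {1..?n} \<Longrightarrow> (\<Sum>j\<in>{1..i}. \<beta> j) \<le> (\<Sum>j\<in>{1..<i}. w j - \<beta> j)"
      and d: "(\<Sum>i\<in>{1..?n}. int (w i) - 2 * int (\<beta> i)) = d"
      unfolding ballot_words_def by blast+
    have d': "(\<Sum>i\<in>{1..m}. int (w i) - 2 * int (\<beta> i)) = d - int (w ?n) + 2 * int (\<beta> ?n)"
      using d by simp
    have "\<beta> ?n \<in> ?B" using le[of ?n] b[of ?n] last[of \<beta>] le d' by simp
    moreover have "restrict \<beta> {1..m} \<in> ?C (\<beta> ?n)"
    proof -
      have "(\<Sum>j\<in>{1..i}. restrict \<beta> {1..m} j) \<le> (\<Sum>j\<in>{1..<i}. w j - restrict \<beta> {1..m} j)" if i: "i \<in> {1..m}" for i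
      proof -
        have "(\<Sum>j\<in>{1..i}. restrict \<beta> {1..m} j) = (\<Sum>j\<in>{1..i}. \<beta> j)" using i by (intro sum.cong) auto
        moreover have "(\<Sum>j\<in>{1..<i}. w j - restrict \<beta> {1..m} j) = (\<Sum>j\<in>{1..<i}. w j - \<beta> j)"
          using i by (intro sum.cong) auto
        ultimately show ?thesis using b[of i] i by simp
      qed
      then show ?thesis using le d' unfolding ballot_words_def by auto
    qed
    moreover have "\<beta> = ?f (\<beta> ?n) (restrict \<beta> {1..m})"
    proof
      fix i show "\<beta> i = ?f (\<beta> ?n) (restrict \<beta> {1..m}) i"
        using PiE_arb[OF e, of i] by (cases "i = ?n"; cases "i \<in> {1..m}"; auto)
    qed
    ultimately show "\<beta> \<in> (\<Union>b\<in>?B. ?f b ` ?C b)" by blast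
  next
    fix \<beta> assume "\<beta> \<in> (\<Union>b\<in>?B. ?f b ` ?C b)"
    then obtain b \<gamma> where bB: "b \<in> ?B" and g: "\<gamma> \<in> ?C b" and \<beta>: "\<beta> = \<gamma>(?n := b)" by blast
    have e: "\<gamma> \<in> {1..m} \<rightarrow>\<^sub>E UNIV" and le: "\<And>i. i \<in> {1..m} \<Longrightarrow> \<gamma> i \<le> w i"
      and bl: "\<And>i. i \<in> {1..m} \<Longrightarrow> (\<Sum>j\<in>{1..i}. \<gamma> j) \<le> (\<Sum>j\<in>{1..<i}. w j - \<gamma> j)"
      and d: "(\<Sum>i\<in>{1..m}. int (w i) - 2 * int (\<gamma> i)) = d - int (w ?n) + 2 * int b"
      using g unfolding ballot_words_def by blast+
    have eq: "\<beta> i = \<gamma> i" if "i \<in> {1..m}" for i using that by (simp add: \<beta>)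
    have d\<beta>: "(\<Sum>i\<in>{1..m}. int (w i) - 2 * int (\<beta> i)) = d - int (w ?n) + 2 * int b"
      unfolding d[symmetric] by (intro sum.cong) (simp_all add: eq)
    have "(\<Sum>j\<in>{1..i}. \<beta> j) \<le> (\<Sum>j\<in>{1..<i}. w j - \<beta> j)" if i: "i \<in> {1..?n}" for i
    proof (cases "i = ?n")
      case True
      have "int (\<beta> ?n) \<le> (\<Sum>i\<in>{1..m}. int (w i) - 2 * int (\<beta> i))"
        unfolding d\<beta> using bB by (simp add: \<beta>)
      then show ?thesis unfolding True using last[of \<beta>] le eq by simp
    next
      case False
      then have i: "i \<in> {1..m}" using i by simp
      have "(\<Sum>j\<in>{1..i}. \<beta> j) = (\<Sum>j\<in>{1..i}. \<gamma> j)" using i by (intro sum.cong eq) auto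
      moreover have "(\<Sum>j\<in>{1..<i}. w j - \<beta> j) = (\<Sum>j\<in>{1..<i}. w j - \<gamma> j)"
        using i by (intro sum.cong) (auto simp: eq)
      ultimately show ?thesis using bl[OF i] by simp
    qed
    moreover have "\<beta> \<in> {1..?n} \<rightarrow>\<^sub>E UNIV" using e unfolding \<beta> by (auto simp: PiE_iff extensional_def)
    moreover have "\<beta> i \<le> w i" if "i \<in> {1..?n}" for i
      using that le[of i] bB unfolding \<beta> by (cases "i = ?n") auto
    moreover have "(\<Sum>i\<in>{1..?n}. int (w i) - 2 * int (\<beta> i)) = d" using d\<beta> by (simp add: \<beta>)
    ultimately show "\<beta> \<in> ?A" unfolding ballot_words_def by blast
  qed
qed

lemma card_ballot_words_Suc:
  "card (ballot_words w (Suc m) d) =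
    (\<Sum>b\<in>{b. b \<le> w (Suc m) \<and> int b \<le> d - int (w (Suc m)) + 2 * int b}.
       card (ballot_words w m (d - int (w (Suc m)) + 2 * int b)))"
proof -
  have inj: "inj_on (\<lambda>\<beta>. \<beta>(Suc m := b)) (ballot_words w m d')" for b d'
  proof (rule inj_onI)
    fix \<beta> \<gamma> assume a: "\<beta> \<in> ballot_words w m d'" "\<gamma> \<in> ballot_words w m d'" "\<beta>(Suc m := b) = \<gamma>(Suc m := b)"
    then have e: "\<beta> (Suc m) = \<gamma> (Suc m)" by (auto simp: ballot_words_def PiE_iff extensional_def)
    show "\<beta> = \<gamma>"
    proof
      fix i show "\<beta> i = \<gamma> i" using e fun_cong[OF a(3), of i] by (cases "i = Suc m") auto
    qed
  qed
  have fin: "finite {b. b \<le> w (Suc m) \<and> int b \<le> d - int (w (Suc m)) + 2 * int b}"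
    by (rule finite_subset[of _ "{..w (Suc m)}"]) auto
  show ?thesis unfolding ballot_words_Suc
  proof (subst card_UN_disjoint[OF fin])
    show "\<forall>i\<in>{b. b \<le> w (Suc m) \<and> int b \<le> d - int (w (Suc m)) + 2 * int b}.
       \<forall>j\<in>{b. b \<le> w (Suc m) \<and> int b \<le> d - int (w (Suc m)) + 2 * int b}. i \<noteq> j \<longrightarrow>
       (\<lambda>\<beta>. \<beta>(Suc m := i)) ` ballot_words w m (d - int (w (Suc m)) + 2 * int i) \<inter>
       (\<lambda>\<beta>. \<beta>(Suc m := j)) ` ballot_words w m (d - int (w (Suc m)) + 2 * int j) = {}"
      by (auto dest: fun_cong[of _ _ "Suc m"])
  qed (simp_all add: finite_ballot_words card_image[OF inj])
qed

lemma sum_telescope_step: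
  fixes c :: "int \<Rightarrow> int"
  assumes "a \<le> k"
  shows "(\<Sum>b\<in>{a..k}. c (e + 2 * int b) - c (e + 2 * int b + 2)) = c (e + 2 * int a) - c (e + 2 * int k + 2)"
  using assms by (induction k rule: dec_induct) (simp_all add: algebra_simps)

text \<open>The Clebsch-Gordan rule: adding a representation of highest weight k to one of highest
  weight d' yields weight d exactly when the ballot inequality holds, and the sum over d' telescopes.\<close>

lemma card_ballot_words:
  "d \<ge> 0 \<Longrightarrow> int (card (ballot_words w m d)) = weight_mult w m d - weight_mult w m (d + 2)"
proof (induction m arbitrary: d)
  case 0
  have "ballot_words w 0 d = (if d = 0 then {\<lambda>_. undefined} else {})"
    by (auto simp: ballot_words_def)
  then show ?case using 0 by auto
next
  case (Suc m)
  let ?k = "w (Suc m)"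
  let ?c = "weight_mult w m" and ?e = "d - int ?k"
  \<comment> \<open>The condition \<open>b \<le> d - k + 2 * b\<close> says
    \<open>b \<ge> k - d\<close>, so the admissible b form an interval whose lower end is truncated
    at 0.\<close>
  define b0 where "b0 = nat (int ?k - d)"
  have b0: "b0 \<le> ?k" using Suc.prems by (simp add: b0_def)
  have B: "{b. b \<le> ?k \<and> int b \<le> ?e + 2 * int b} = {b0..?k}"
    by (auto simp: b0_def)
  have "int (card (ballot_words w (Suc m) d))
      = (\<Sum>b\<in>{b0..?k}. int (card (ballot_words w m (?e + 2 * int b))))"
    unfolding card_ballot_words_Suc B by simp
  also have "\<dots> = (\<Sum>b\<in>{b0..?k}. ?c (?e + 2 * int b) - ?c (?e + 2 * int b + 2))"
  proof (rule sum.cong[OF refl])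
    fix b assume "b \<in> {b0..?k}"
    then have "?e + 2 * int b \<ge> 0" by (auto simp: b0_def)
    then show "int (card (ballot_words w m (?e + 2 * int b))) = ?c (?e + 2 * int b) - ?c (?e + 2 * int b + 2)"
      by (rule Suc.IH)
  qed
  also have "\<dots> = ?c (?e + 2 * int b0) - ?c (?e + 2 * int ?k + 2)"
    by (rule sum_telescope_step[OF b0])
  \<comment> \<open>The lower end is \<bar>d - k\<bar>, as in the Clebsch-Gordan rule. By symmetry
    it may be replaced by d - k, the lower end of the full sum over b, and the same telescoping can
    then be read backwards.\<close>
  also have "?c (?e + 2 * int b0) = ?c ?e"
  proof (cases "int ?k \<le> d")
    case False
    then have "?e + 2 * int b0 = - ?e" by (simp add: b0_def)
    then show ?thesis by (simp only: weight_mult_uminus)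
  qed (simp add: b0_def)
  also have "?c ?e - ?c (?e + 2 * int ?k + 2)
      = (\<Sum>b\<in>{0..?k}. ?c (?e + 2 * int b) - ?c (?e + 2 * int b + 2))"
    using sum_telescope_step[of 0 ?k ?c ?e] by simp
  also have "\<dots> = weight_mult w (Suc m) d - weight_mult w (Suc m) (d + 2)"
    by (simp add: sum_subtractf algebra_simps)
  finally show ?case .
qed

lemma card_ballot_monomials:
  assumes "w \<in> nonneg_weights n"
  shows "card (ballot_monomials n w) = card (ballot_words (\<lambda>i. nat (w i)) n 0)"
proof -
  let ?u = "\<lambda>i. nat (w i)"
  let ?f = "\<lambda>m. restrict (\<lambda>i. lkp m (Yc i)) {1..n}"
  have w0: "w i \<ge> 0" if "i \<in> {1..n}" for i using assms that by (auto simp: nonneg_weights_def)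
  have X: "lkp m (Xc i) = ?u i - lkp m (Yc i)" "lkp m (Yc i) \<le> ?u i"
    if "m \<in> ballot_monomials n w" "i \<in> {1..n}" for m i
  proof -
    have "int (lkp m (Xc i) + lkp m (Yc i)) = w i" using that by (simp add: ballot_monomials_def)
    then show "lkp m (Xc i) = ?u i - lkp m (Yc i)" "lkp m (Yc i) \<le> ?u i" by linarith+
  qed
  have "bij_betw ?f (ballot_monomials n w) (ballot_words ?u n 0)"
  proof (rule bij_betw_imageI)
    show "inj_on ?f (ballot_monomials n w)"
    proof (rule inj_onI, rule poly_mapping_eqI)
      fix m m' v assume m: "m \<in> ballot_monomials n w" "m' \<in> ballot_monomials n w" and eq: "?f m = ?f m'"
      have yy: "lkp m (Yc i) = lkp m' (Yc i)" if "i \<in> {1..n}" for i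
        using fun_cong[OF eq, of i] that by simp
      show "lkp m v = lkp m' v"
      proof (cases "v \<in> coord_vars n")
        case True
        then show ?thesis using yy X(1)[OF m(1)] X(1)[OF m(2)] by auto
      next
        case False
        then have "v \<notin> keys_of m" "v \<notin> keys_of m'"
          using m by (auto simp: ballot_monomials_def)
        then show ?thesis by (simp add: in_keys_iff)
      qed
    qed
    show "?f ` ballot_monomials n w = ballot_words ?u n 0"
    proof (intro subset_antisym subsetI)
      fix \<beta> assume "\<beta> \<in> ?f ` ballot_monomials n w"
      then obtain m where m: "m \<in> ballot_monomials n w" and \<beta>: "\<beta> = ?f m" by blast
      have v: "\<beta> i = lkp m (Yc i)" if "i \<in> {1..n}" for i using that by (simp add: \<beta>)
      have "(\<Sum>j\<in>{1..i}. \<beta> j) \<le> (\<Sum>j\<in>{1..<i}. ?u j - \<beta> j)" if i: "i \<in> {1..n}" for i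
      proof -
        have "(\<Sum>j\<in>{1..i}. \<beta> j) = (\<Sum>j\<in>{1..i}. lkp m (Yc j))" using i by (intro sum.cong v) auto
        also have "\<dots> \<le> (\<Sum>j\<in>{1..<i}. lkp m (Xc j))"
          using m i unfolding ballot_monomials_def ballot_def by blast
        also have "\<dots> = (\<Sum>j\<in>{1..<i}. ?u j - \<beta> j)" using i X(1)[OF m] v by (intro sum.cong) auto
        finally show ?thesis .
      qed
      moreover have "(\<Sum>i\<in>{1..n}. int (?u i) - 2 * int (\<beta> i)) = 0"
      proof -
        have "(\<Sum>i\<in>{1..n}. int (?u i) - 2 * int (\<beta> i)) = (\<Sum>i\<in>{1..n}. int (lkp m (Xc i)) - int (lkp m (Yc i)))"
          using X[OF m] v by (intro sum.cong) (auto simp: of_nat_diff)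
        also have "\<dots> = int (xdeg n m) - int (ydeg n m)"
          by (simp add: sum_subtractf xdeg_def ydeg_def)
        finally show ?thesis using m by (simp add: ballot_monomials_def)
      qed
      moreover have "\<beta> \<in> {1..n} \<rightarrow>\<^sub>E UNIV" by (simp add: \<beta>)
      ultimately show "\<beta> \<in> ballot_words ?u n 0"
        unfolding ballot_words_def using X(2)[OF m] v by auto
    next
      fix \<beta> assume b: "\<beta> \<in> ballot_words ?u n 0"
      have e: "\<beta> \<in> {1..n} \<rightarrow>\<^sub>E UNIV" and le: "\<And>i. i \<in> {1..n} \<Longrightarrow> \<beta> i \<le> ?u i"
        and bl: "\<And>i. i \<in> {1..n} \<Longrightarrow> (\<Sum>j\<in>{1..i}. \<beta> j) \<le> (\<Sum>j\<in>{1..<i}. ?u j - \<beta> j)"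
        and d: "(\<Sum>i\<in>{1..n}. int (?u i) - 2 * int (\<beta> i)) = 0"
        using b unfolding ballot_words_def by blast+
      define m where "m = (\<Sum>i\<in>{1..n}. sgl (Xc i) (?u i - \<beta> i) + sgl (Yc i) (\<beta> i))"
      have lx: "lkp m (Xc i) = (if i \<in> {1..n} then ?u i - \<beta> i else 0)"
        and ly: "lkp m (Yc i) = (if i \<in> {1..n} then \<beta> i else 0)" for i
        by (auto simp: m_def lookup_sum lookup_add lookup_single when_def)
      have "keys_of m \<subseteq> coord_vars n"
      proof
        fix v assume "v \<in> keys_of m"
        then show "v \<in> coord_vars n" by (cases v) (auto simp: in_keys_iff lx ly split: if_splits)
      qed
      moreover have "int (lkp m (Xc i) + lkp m (Yc i)) = w i" if "i \<in> {1..n}" for i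
        using that le[OF that] w0[OF that] by (simp add: lx ly)
      moreover have "xdeg n m = ydeg n m"
      proof -
        have "int (xdeg n m) - int (ydeg n m) = (\<Sum>i\<in>{1..n}. int (?u i) - 2 * int (\<beta> i))"
          unfolding xdeg_def ydeg_def of_nat_sum sum_subtractf[symmetric]
          using le by (intro sum.cong) (auto simp: lx ly of_nat_diff)
        then show ?thesis using d by simp
      qed
      moreover have "ballot n m"
        unfolding ballot_def
      proof
        fix i assume i: "i \<in> {1..n}"
        have "(\<Sum>j\<in>{1..i}. lkp m (Yc j)) = (\<Sum>j\<in>{1..i}. \<beta> j)" using i by (intro sum.cong) (auto simp: ly)
        also have "\<dots> \<le> (\<Sum>j\<in>{1..<i}. ?u j - \<beta> j)" by (rule bl[OF i])
        also have "\<dots> = (\<Sum>j\<in>{1..<i}. lkp m (Xc j))" using i by (intro sum.cong) (auto simp: lx)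
        finally show "(\<Sum>j\<in>{1..i}. lkp m (Yc j)) \<le> (\<Sum>j\<in>{1..<i}. lkp m (Xc j))" .
      qed
      ultimately have "m \<in> ballot_monomials n w" unfolding ballot_monomials_def by blast
      moreover have "?f m = \<beta>" using PiE_arb[OF e] by (auto simp: ly restrict_def)
      ultimately show "\<beta> \<in> ?f ` ballot_monomials n w" by blast
    qed
  qed
  then show ?thesis by (rule bij_betw_same_card)
qed

section \<open>The alternating sum\<close>

text \<open>The character of the tensor product, normalised to start in degree 0: the coefficient at
  r belongs to the torus weight that is 2r below the highest one.\<close>

definition char_fps :: "(nat \<Rightarrow> nat) \<Rightarrow> nat \<Rightarrow> int fps" where
  "char_fps w m = (\<Prod>i\<in>{1..m}. \<Sum>b\<in>{0..w i}. fps_X ^ b)"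

lemma weight_mult_eq_fps_nth:
  "weight_mult w m (int (\<Sum>i\<in>{1..m}. w i) - 2 * r) = (if r < 0 then 0 else fps_nth (char_fps w m) (nat r))"
proof (induction m arbitrary: r)
  case 0
  then show ?case by (auto simp: char_fps_def)
next
  case (Suc m)
  let ?k = "w (Suc m)"
  have "weight_mult w (Suc m) (int (\<Sum>i\<in>{1..Suc m}. w i) - 2 * r)
      = (\<Sum>b\<in>{0..?k}. weight_mult w m (int (\<Sum>i\<in>{1..m}. w i) - 2 * (r - int b)))"
    by (simp add: algebra_simps)
  also have "\<dots> = (\<Sum>b\<in>{0..?k}. if r - int b < 0 then 0 else fps_nth (char_fps w m) (nat (r - int b)))"
    by (simp only: Suc.IH)
  also have "\<dots> = (if r < 0 then 0 else (\<Sum>b\<in>{0..?k}. fps_nth (char_fps w m * fps_X ^ b) (nat r)))"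
    by (auto simp: fps_X_power_mult_right_nth nat_diff_distrib' intro!: sum.cong sum.neutral)
  also have "(\<Sum>b\<in>{0..?k}. fps_nth (char_fps w m * fps_X ^ b) (nat r)) = fps_nth (char_fps w (Suc m)) (nat r)"
    by (simp add: char_fps_def fps_sum_nth sum_distrib_left)
  finally show ?case .
qed

text \<open>The negative binomial series; multiplication by one factor \<open>1 - fps_X\<close> is
  Pascal's rule.\<close>

lemma binomial_fps_mult: "Abs_fps (\<lambda>j. int (j + k choose k)) * (1 - fps_X) ^ Suc k = 1"
proof (induction k)
  case 0
  show ?case by (rule fps_ext) (auto simp: ring_distribs fps_mult_fps_X_commute)
next
  case (Suc k)
  have "Abs_fps (\<lambda>j. int (j + Suc k choose Suc k)) * (1 - fps_X) = Abs_fps (\<lambda>j. int (j + k choose k))"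
  proof (rule fps_ext)
    fix j show "fps_nth (Abs_fps (\<lambda>j. int (j + Suc k choose Suc k)) * (1 - fps_X)) j
        = fps_nth (Abs_fps (\<lambda>j. int (j + k choose k))) j"
      by (cases j) (simp_all add: right_diff_distrib)
  qed
  then show ?case using Suc.IH by (simp add: mult.assoc[symmetric])
qed

lemma prod_one_minus_power:
  fixes x :: "'a::comm_ring_1"
  assumes "finite I"
  shows "(\<Prod>i\<in>I. 1 - x ^ e i) = (\<Sum>J\<in>Pow I. (-1) ^ card J * x ^ (\<Sum>i\<in>J. e i))"
  using assms
proof (induction I rule: finite_induct)
  case (insert a I)
  have inj: "inj_on (insert a) (Pow I)" using insert.hyps by (auto simp: inj_on_def)
  have "(\<Sum>J\<in>insert a ` Pow I. (-1) ^ card J * x ^ (\<Sum>i\<in>J. e i))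
      = (\<Sum>J\<in>Pow I. - (x ^ e a * ((-1) ^ card J * x ^ (\<Sum>i\<in>J. e i))))"
    unfolding sum.reindex[OF inj]
  proof (rule sum.cong)
    fix J assume "J \<in> Pow I"
    then have "a \<notin> J" "finite J" using insert.hyps by (auto intro: finite_subset)
    then show "((\<lambda>J. (-1) ^ card J * x ^ (\<Sum>i\<in>J. e i)) \<circ> insert a) J
        = - (x ^ e a * ((-1) ^ card J * x ^ (\<Sum>i\<in>J. e i)))"
      by (simp add: power_add ac_simps)
  qed simp
  then have "(\<Sum>J\<in>Pow (insert a I). (-1) ^ card J * x ^ (\<Sum>i\<in>J. e i))
      = (1 - x ^ e a) * (\<Sum>J\<in>Pow I. (-1) ^ card J * x ^ (\<Sum>i\<in>J. e i))"
    unfolding Pow_insert using insert.hyps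
    by (subst sum.union_disjoint) (auto simp: sum_negf sum_distrib_left left_diff_distrib sum_subtractf)
  then show ?case using insert by simp
qed simp

text \<open>Multiplication by \<open>1 - fps_X\<close> produces differences of consecutive
  coefficients. Each factor of the character is a quotient of \<open>1 - fps_X ^ Suc (w i)\<close>
  by \<open>1 - fps_X\<close>; one of the n denominators cancels, and the remaining n - 1 give
  binomial coefficients with lower entry n - 2.\<close>

lemma char_fps_difference:
  assumes "n \<ge> 2"
  shows "(1 - fps_X) * char_fps w n
    = (\<Sum>J\<in>Pow {1..n}. (-1) ^ card J * fps_X ^ (\<Sum>i\<in>J. Suc (w i))) * Abs_fps (\<lambda>j. int (j + (n - 2) choose (n - 2)))"
proof -
  let ?G = "Abs_fps (\<lambda>j. int (j + (n - 2) choose (n - 2)))"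
  have geo: "(1 - fps_X :: int fps) * (\<Sum>b\<in>{0..k}. fps_X ^ b) = 1 - fps_X ^ Suc k" for k
    using sum_gp_basic[of "fps_X :: int fps" k] by (simp add: atLeast0AtMost)
  have card: "card {1..n} = n" by simp
  have "(1 - fps_X) ^ n * char_fps w n = (\<Prod>i\<in>{1..n}. 1 - fps_X ^ Suc (w i))"
    unfolding char_fps_def geo[symmetric] prod.distrib by (simp add: prod_constant)
  also have "\<dots> = (\<Sum>J\<in>Pow {1..n}. (-1) ^ card J * fps_X ^ (\<Sum>i\<in>J. Suc (w i)))"
    by (rule prod_one_minus_power) simp
  finally have e: "(1 - fps_X) ^ n * char_fps w n = \<dots>" .
  have "n = Suc (Suc (n - 2))" using assms by simp
  then have pw: "(1 - fps_X :: int fps) ^ n = (1 - fps_X) * (1 - fps_X) ^ Suc (n - 2)"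
    by (metis power_Suc)
  have "(1 - fps_X) * char_fps w n = (1 - fps_X) * char_fps w n * (?G * (1 - fps_X) ^ Suc (n - 2))"
    by (simp only: binomial_fps_mult mult_1_right)
  also have "\<dots> = ((1 - fps_X) ^ n * char_fps w n) * ?G"
    unfolding pw by (simp only: ac_simps)
  finally show ?thesis unfolding e .
qed

theorem card_ballot_monomials_alternating_sum:
  assumes n: "n \<ge> 2" and w: "w \<in> even_lattice n" "w \<in> nonneg_weights n" "w \<noteq> zero_weight n"
  shows "int (card (ballot_monomials n w)) = alternating_sum n w"
proof -
  let ?u = "\<lambda>i. nat (w i)"
  have w0: "w i \<ge> 0" if "i \<in> {1..n}" for i using w(2) that by (auto simp: nonneg_weights_def)
  define h where "h = nat (half_weight n w)"
  have tot: "(\<Sum>i\<in>{1..n}. w i) = int (\<Sum>i\<in>{1..n}. ?u i)"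
    unfolding of_nat_sum using w0 by (intro sum.cong) auto
  have hh: "(\<Sum>i\<in>{1..n}. ?u i) = 2 * h" "half_weight n w = int h"
  proof -
    have "even (\<Sum>i\<in>{1..n}. w i)" using w(1) by (simp add: even_lattice_def)
    then have "even (\<Sum>i\<in>{1..n}. ?u i)" unfolding tot by (simp only: even_of_nat_iff)
    then obtain k where k: "(\<Sum>i\<in>{1..n}. ?u i) = 2 * k" by blast
    have hk: "half_weight n w = int k" unfolding half_weight_def tot k by simp
    then have h: "h = k" by (simp add: h_def)
    show "(\<Sum>i\<in>{1..n}. ?u i) = 2 * h" unfolding h by (rule k)
    show "half_weight n w = int h" unfolding h by (rule hk)
  qed
  \<comment> \<open>At h = 0 the index h - 1 would be truncated to 0, and the empty set would fail
    the strict inequality of \<open>alternating_sum\<close>.\<close>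
  have h1: "h \<ge> 1"
  proof (rule ccontr)
    assume "\<not> h \<ge> 1"
    then have "(\<Sum>i\<in>{1..n}. ?u i) = 0" using hh by simp
    then have "w i = 0" if "i \<in> {1..n}" for i using that w0[OF that] by force
    then have "w = zero_weight n"
      using w(2) by (auto simp: zero_weight_def nonneg_weights_def PiE_iff extensional_def restrict_def)
    then show False using w(3) by simp
  qed
  let ?G = "Abs_fps (\<lambda>j. int (j + (n - 2) choose (n - 2)))"
  have "int (card (ballot_monomials n w)) = weight_mult ?u n 0 - weight_mult ?u n 2"
    unfolding card_ballot_monomials[OF w(2)] using card_ballot_words[of 0 ?u n] by simp
  also have "weight_mult ?u n 0 = fps_nth (char_fps ?u n) h"
    using weight_mult_eq_fps_nth[of ?u n "int h"] unfolding hh(1) by simp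
  also have "weight_mult ?u n 2 = fps_nth (char_fps ?u n) (h - 1)"
    using weight_mult_eq_fps_nth[of ?u n "int h - 1"] h1 unfolding hh(1)
    by (simp add: nat_diff_distrib)
  also have "fps_nth (char_fps ?u n) h - fps_nth (char_fps ?u n) (h - 1)
      = fps_nth ((1 - fps_X) * char_fps ?u n) h"
    using h1 by (cases h) (simp_all add: left_diff_distrib)
  also have "\<dots> = (\<Sum>J\<in>Pow {1..n}. (-1) ^ card J *
      (if h < (\<Sum>i\<in>J. Suc (?u i)) then 0 else int (h - (\<Sum>i\<in>J. Suc (?u i)) + (n - 2) choose (n - 2))))"
  proof -
    have c: "fps_nth ((-1) ^ card J * fps_X ^ s * ?G) h
       = (-1) ^ card J * (if h < s then 0 else int (h - s + (n - 2) choose (n - 2)))" for J :: "nat set" and s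
    proof -
      have e: "(-1) ^ card J = (fps_const ((-1) ^ card J) :: int fps)"
        by (metis fps_const_1_eq_1 fps_const_neg fps_const_power)
      show ?thesis
        by (subst e, simp only: mult.assoc fps_mult_left_const_nth fps_X_power_mult_nth) simp
    qed
    show ?thesis unfolding char_fps_difference[OF n] sum_distrib_right fps_sum_nth c ..
  qed
  also have "\<dots> = alternating_sum n w"
    unfolding alternating_sum_def
  proof (rule sum.mono_neutral_cong_right)
    have sJ: "(\<Sum>j\<in>J. w j) = int (\<Sum>j\<in>J. ?u j)" "(\<Sum>i\<in>J. Suc (?u i)) = (\<Sum>j\<in>J. ?u j) + card J"
      if "J \<subseteq> {1..n}" for J
    proof -
      show "(\<Sum>j\<in>J. w j) = int (\<Sum>j\<in>J. ?u j)"
        unfolding of_nat_sum using w0 that by (intro sum.cong) auto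
      show "(\<Sum>i\<in>J. Suc (?u i)) = (\<Sum>j\<in>J. ?u j) + card J"
        using sum.distrib[of ?u "\<lambda>_. 1" J] by simp
    qed
    show "\<forall>J\<in>Pow {1..n} - {J. J \<subseteq> {1..n} \<and> (\<Sum>j\<in>J. w j) < half_weight n w}.
       (-1) ^ card J * (if h < (\<Sum>i\<in>J. Suc (?u i)) then 0
         else int (h - (\<Sum>i\<in>J. Suc (?u i)) + (n - 2) choose (n - 2))) = 0"
    proof
      fix J assume "J \<in> Pow {1..n} - {J. J \<subseteq> {1..n} \<and> (\<Sum>j\<in>J. w j) < half_weight n w}"
      then have J0: "J \<subseteq> {1..n}" "\<not> (\<Sum>j\<in>J. w j) < int h" unfolding hh(2) by blast+
      then have J: "J \<subseteq> {1..n}" "(\<Sum>j\<in>J. ?u j) \<ge> h" unfolding sJ(1)[OF J0(1)] by linarith+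
      \<comment> \<open>The exponent of J is its weight plus its cardinality. A set of weight at
        least h > 0 is nonempty, so its exponent exceeds h and equality on a wall contributes
        nothing.\<close>
      have "J \<noteq> {}" using J(2) h1 by auto
      then have "card J > 0" using J(1) by (meson card_gt_0_iff finite_atLeastAtMost finite_subset)
      then have "h < (\<Sum>i\<in>J. Suc (?u i))" using J sJ(2)[OF J(1)] by simp
      then show "(-1) ^ card J * (if h < (\<Sum>i\<in>J. Suc (?u i)) then 0
         else int (h - (\<Sum>i\<in>J. Suc (?u i)) + (n - 2) choose (n - 2))) = 0" by simp
    qed
    fix J assume "J \<in> {J. J \<subseteq> {1..n} \<and> (\<Sum>j\<in>J. w j) < half_weight n w}"
    then have J: "J \<subseteq> {1..n}" by blast
    define s where "s = (\<Sum>j\<in>J. ?u j) + card J"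
    have a: "half_weight n w - (\<Sum>j\<in>J. w j) + int n - int (card J) - 2 = int h - int s + int (n - 2)"
      using n by (simp add: hh(2) sJ(1)[OF J] s_def)
    have b: "int n - 2 = int (n - 2)" using n by simp
    \<comment> \<open>The upper entry is h - s + n - 2, so the convention for \<open>binom\<close>
      gives 0 exactly when h < s.\<close>
    have "binom (int h - int s + int (n - 2)) (int (n - 2))
        = (if h < s then 0 else int (h - s + (n - 2) choose (n - 2)))"
    proof (cases "h < s")
      case False
      then have "int h - int s + int (n - 2) = int (h - s + (n - 2))" by simp
      then show ?thesis using False by (simp only: binom_def nat_int) simp
    qed (simp add: binom_def)
    then show "(-1) ^ card J * (if h < (\<Sum>i\<in>J. Suc (?u i)) then 0
         else int (h - (\<Sum>i\<in>J. Suc (?u i)) + (n - 2) choose (n - 2))) =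
       (-1) ^ card J * binom (half_weight n w - (\<Sum>j\<in>J. w j) + int n - int (card J) - 2) (int n - 2)"
      unfolding a unfolding b sJ(2)[OF J] s_def[symmetric] by simp
  qed auto
  finally show ?thesis .
qed

section \<open>The support\<close>

lemma half_weight_double: "w \<in> even_lattice n \<Longrightarrow> 2 * half_weight n w = (\<Sum>i\<in>{1..n}. w i)"
  by (simp add: even_lattice_def half_weight_def)

lemma nonneg_weights_ge_0: "w \<in> nonneg_weights n \<Longrightarrow> i \<in> {1..n} \<Longrightarrow> w i \<ge> 0"
  by (auto simp: nonneg_weights_def)

lemma hilbert_function_eq_kostka:
  assumes w: "w \<in> even_lattice n" "w \<in> nonneg_weights n"
  shows "hilbert_function TYPE('k::field) n w =
    kostka [nat (half_weight n w), nat (half_weight n w)] (weight_content n w)"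
  unfolding hilbert_function_eq_card[OF w] kostka_def
  by (rule bij_betw_same_card[OF bij_betw_tableau_monomial[OF w], symmetric])

lemma hilbert_function_zero_weight: "hilbert_function TYPE('k::field) n (zero_weight n) = 1"
proof -
  have z: "zero_weight n \<in> even_lattice n" "zero_weight n \<in> nonneg_weights n"
    by (auto simp: zero_weight_def even_lattice_def int_weights_def nonneg_weights_def)
  let ?u = "\<lambda>i. nat (zero_weight n i)"
  have u: "?u i = 0" if "i \<in> {1..n}" for i using that by (simp add: zero_weight_def)
  have s: "(\<Sum>i\<in>{1..n}. ?u i) = 0" using u by simp
  have f: "char_fps ?u n = 1" unfolding char_fps_def by (rule prod.neutral) (auto simp: u)
  have "weight_mult ?u n 0 = 1" "weight_mult ?u n 2 = 0"
    using weight_mult_eq_fps_nth[of ?u n 0] weight_mult_eq_fps_nth[of ?u n "-1"] unfolding s f by simp_all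
  then have "int (card (ballot_words ?u n 0)) = 1" using card_ballot_words[of 0 ?u n] by simp
  then show ?thesis unfolding hilbert_function_eq_card[OF z] card_ballot_monomials[OF z(2)] by simp
qed

lemma hilbert_function_eq_alternating_sum:
  assumes "n \<ge> 2" "w \<in> even_lattice n" "w \<in> nonneg_weights n" "w \<noteq> zero_weight n"
  shows "int (hilbert_function TYPE('k::field) n w) = alternating_sum n w"
  unfolding hilbert_function_eq_card[OF assms(2,3)] by (rule card_ballot_monomials_alternating_sum[OF assms])

text \<open>The letters y of block j are matched by letters x of earlier blocks. Together with the x
  of block j this bounds \<open>w j\<close> by the total x-degree, which is half the weight.\<close>

lemma ballot_monomial_imp_le_half:
  assumes m: "m \<in> ballot_monomials n w" and j: "j \<in> {1..n}"
  shows "w j \<le> half_weight n w"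
proof -
  have wi: "\<And>i. i \<in> {1..n} \<Longrightarrow> int (lkp m (Xc i) + lkp m (Yc i)) = w i" and xy: "xdeg n m = ydeg n m"
    and b: "ballot n m" using m by (auto simp: ballot_monomials_def)
  have "(\<Sum>i\<in>{1..n}. w i) = int (xdeg n m + ydeg n m)" by (rule weight_sum_ballot[OF wi])
  then have h: "half_weight n w = int (xdeg n m)" unfolding half_weight_def xy by simp
  have "lkp m (Yc j) \<le> (\<Sum>i\<in>{1..j}. lkp m (Yc i))" using j by (intro member_le_sum) auto
  also have "\<dots> \<le> (\<Sum>i\<in>{1..<j}. lkp m (Xc i))" using b j unfolding ballot_def by blast
  finally have "lkp m (Xc j) + lkp m (Yc j) \<le> (\<Sum>i\<in>insert j {1..<j}. lkp m (Xc i))" by simp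
  also have "\<dots> \<le> xdeg n m" unfolding xdeg_def using j by (intro sum_mono2) auto
  finally show ?thesis unfolding h wi[OF j, symmetric] by simp
qed

text \<open>The word that begins with h letters x and ends with h letters y.\<close>

lemma ballot_words_nonempty:
  assumes tot: "(\<Sum>i\<in>{1..n}. u i) = 2 * h" and le: "\<And>i. i \<in> {1..n} \<Longrightarrow> u i \<le> h"
  shows "ballot_words u n 0 \<noteq> {}"
proof -
  define W where "W = (\<lambda>i. \<Sum>j\<in>{1..i}. u j)"
  have W0: "W 0 = 0" and WS: "W (Suc i) = W i + u (Suc i)" for i by (simp_all add: W_def)
  \<comment> \<open>Truncated subtraction makes \<open>W i - h\<close> the number of letters beyond
    position h in the first i blocks; b is its increment.\<close>
  define b where "b = (\<lambda>i. (W i - h) - (W (i - 1) - h))"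
  define \<beta> where "\<beta> = restrict b {1..n}"
  have sb: "(\<Sum>j\<in>{1..i}. b j) = W i - h" for i
    by (induction i) (simp_all add: W0 WS b_def)
  have bu: "b j \<le> u j" if "j \<ge> 1" for j using that by (cases j) (auto simp: b_def WS)
  have sa: "(\<Sum>j\<in>{1..i}. u j - b j) = W i - (W i - h)" for i
  proof (induction i)
    case (Suc i)
    then show ?case by (simp add: WS b_def)
  qed (simp add: W0)
  have v: "\<beta> i = b i" if "i \<in> {1..n}" for i using that by (simp add: \<beta>_def)
  have "(\<Sum>j\<in>{1..i}. \<beta> j) \<le> (\<Sum>j\<in>{1..<i}. u j - \<beta> j)" if i: "i \<in> {1..n}" for i
  proof -
    obtain k where k: "i = Suc k" using i by (cases i) auto
    have "W i \<le> 2 * h" unfolding tot[symmetric] W_def using i by (intro sum_mono2) auto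
    have "(\<Sum>j\<in>{1..i}. \<beta> j) = (\<Sum>j\<in>{1..i}. b j)" using i by (intro sum.cong v) auto
    also have "\<dots> = W i - h" by (rule sb)
    \<comment> \<open>The right side is the minimum of W k and h. The first bound uses
      \<open>u i \<le> h\<close>, the second \<open>W i \<le> 2 * h\<close>.\<close>
    also have "\<dots> \<le> W k - (W k - h)" using le[OF i] \<open>W i \<le> 2 * h\<close> unfolding k WS by auto
    also have "\<dots> = (\<Sum>j\<in>{1..k}. u j - b j)" by (rule sa[symmetric])
    also have "\<dots> = (\<Sum>j\<in>{1..<i}. u j - \<beta> j)"
      unfolding k using i k by (intro sum.cong) (auto simp: v)
    finally show ?thesis .
  qed
  moreover have "(\<Sum>i\<in>{1..n}. int (u i) - 2 * int (\<beta> i)) = 0"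
  proof -
    have "(\<Sum>i\<in>{1..n}. int (u i) - 2 * int (\<beta> i)) = int (W n) - 2 * int (\<Sum>i\<in>{1..n}. b i)"
      by (simp add: sum_subtractf sum_distrib_left W_def v)
    also have "\<dots> = 0" unfolding sb using tot by (simp add: W_def)
    finally show ?thesis .
  qed
  moreover have "\<beta> \<in> {1..n} \<rightarrow>\<^sub>E UNIV" by (simp add: \<beta>_def)
  ultimately have "\<beta> \<in> ballot_words u n 0" unfolding ballot_words_def using bu by (auto simp: v)
  then show ?thesis by blast
qed

lemma hilbert_function_nonzero_iff:
  assumes "w \<in> int_weights n"
  shows "hilbert_function TYPE('k::field) n w \<noteq> 0 \<longleftrightarrow>
    w \<in> even_lattice n \<inter> nonneg_weights n \<and> (\<forall>j\<in>{1..n}. w j \<le> half_weight n w)"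
proof (cases "w \<in> even_lattice n \<inter> nonneg_weights n")
  case True
  then have w: "w \<in> even_lattice n" "w \<in> nonneg_weights n" by auto
  let ?u = "\<lambda>i. nat (w i)"
  have "hilbert_function TYPE('k) n w \<noteq> 0 \<longleftrightarrow> ballot_monomials n w \<noteq> {}"
    unfolding hilbert_function_eq_card[OF w] using finite_ballot_monomials by simp
  also have "\<dots> \<longleftrightarrow> (\<forall>j\<in>{1..n}. w j \<le> half_weight n w)"
  proof
    assume "ballot_monomials n w \<noteq> {}"
    then show "\<forall>j\<in>{1..n}. w j \<le> half_weight n w" using ballot_monomial_imp_le_half by blast
  next
    assume le: "\<forall>j\<in>{1..n}. w j \<le> half_weight n w"
    have "int (\<Sum>i\<in>{1..n}. ?u i) = (\<Sum>i\<in>{1..n}. w i)"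
      unfolding of_nat_sum using nonneg_weights_ge_0[OF w(2)] by (intro sum.cong) auto
    then have tot: "(\<Sum>i\<in>{1..n}. ?u i) = 2 * nat (half_weight n w)"
      using half_weight_double[OF w(1)] by linarith
    have "ballot_words ?u n 0 \<noteq> {}"
      by (rule ballot_words_nonempty[OF tot]) (use le in \<open>auto intro: nat_mono\<close>)
    then have "card (ballot_words ?u n 0) \<noteq> 0" using finite_ballot_words by simp
    then show "ballot_monomials n w \<noteq> {}"
      unfolding card_ballot_monomials[OF w(2), symmetric] by auto
  qed
  finally show ?thesis using True by blast
next
  case False
  then show ?thesis using hilbert_function_eq_0[OF assms False, where 'k='k] by blast
qed

lemma poincare_hilbert_series_eq:
  assumes n: "n \<ge> 2"
  shows "poincare_hilbert_series TYPE('k::field) n =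
       (\<lambda>w. if w = zero_weight n then 1
            else if w \<in> even_lattice n \<inter> nonneg_weights n then alternating_sum n w else 0)"
proof
  fix w :: "nat \<Rightarrow> int"
  have z: "zero_weight n \<in> even_lattice n"
    by (auto simp: zero_weight_def even_lattice_def int_weights_def)
  consider "w = zero_weight n" | "w \<noteq> zero_weight n" "w \<in> even_lattice n" "w \<in> nonneg_weights n"
    | "w \<noteq> zero_weight n" "w \<in> even_lattice n" "w \<notin> nonneg_weights n" | "w \<noteq> zero_weight n" "w \<notin> even_lattice n" by blast
  then show "poincare_hilbert_series TYPE('k) n w = (if w = zero_weight n then 1
            else if w \<in> even_lattice n \<inter> nonneg_weights n then alternating_sum n w else 0)"
  proof cases
    case 1
    then show ?thesis using z by (simp add: poincare_hilbert_series_def hilbert_function_zero_weight)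
  next
    case 2
    then show ?thesis
      using hilbert_function_eq_alternating_sum[OF n 2(2,3,1), where 'k='k] by (simp add: poincare_hilbert_series_def)
  next
    case 3
    then show ?thesis using hilbert_function_eq_0[of w n, where 'k='k]
      by (simp add: poincare_hilbert_series_def even_lattice_def)
  qed (simp add: poincare_hilbert_series_def)
qed

section \<open>Polynomial functions\<close>

text \<open>Polynomiality as a property of functions, so that closure under arithmetic replaces
  explicit manipulation of coefficients.\<close>

definition polyfun :: "nat \<Rightarrow> ((nat \<Rightarrow> real) \<Rightarrow> real) \<Rightarrow> bool" where
  "polyfun n f \<longleftrightarrow> (\<exists>P :: (nat, real) mpoly. mp_in_vars {1..n} P \<and> (\<forall>x. f x = mp_eval id x P))"

lemma semiring_hom_id: "semiring_hom id"
  by (simp add: semiring_hom_def)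

lemma polyfun_const: "polyfun n (\<lambda>_. c)"
proof -
  have "mp_in_vars {1..n} (mp_const c)" by (simp add: mp_in_vars_def mp_const_def)
  then show ?thesis unfolding polyfun_def by (intro exI[of _ "mp_const c"]) (simp add: semiring_hom_id)
qed

lemma polyfun_var: "i \<in> {1..n} \<Longrightarrow> polyfun n (\<lambda>x. x i)"
proof -
  assume "i \<in> {1..n}"
  then have "mp_in_vars {1..n} (mp_var i)" by (simp add: mp_in_vars_def mp_var_def)
  then show ?thesis unfolding polyfun_def by (intro exI[of _ "mp_var i"]) (simp add: semiring_hom_id)
qed

lemma polyfun_add: "polyfun n f \<Longrightarrow> polyfun n g \<Longrightarrow> polyfun n (\<lambda>x. f x + g x)"
proof -
  assume "polyfun n f" "polyfun n g"
  then obtain P Q where PQ: "mp_in_vars {1..n} P" "\<And>x. f x = mp_eval id x P" "mp_in_vars {1..n} Q" "\<And>x. g x = mp_eval id x Q"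
    unfolding polyfun_def by blast
  have "mp_in_vars {1..n} (P + Q)" using PQ keys_add[of P Q] unfolding mp_in_vars_def by blast
  then show ?thesis unfolding polyfun_def
    using PQ by (intro exI[of _ "P + Q"]) (simp add: mp_eval_add[OF semiring_hom_id])
qed

lemma polyfun_mult: "polyfun n f \<Longrightarrow> polyfun n g \<Longrightarrow> polyfun n (\<lambda>x. f x * g x)"
proof -
  assume "polyfun n f" "polyfun n g"
  then obtain P Q where PQ: "mp_in_vars {1..n} P" "\<And>x. f x = mp_eval id x P" "mp_in_vars {1..n} Q" "\<And>x. g x = mp_eval id x Q"
    unfolding polyfun_def by blast
  have "mp_in_vars {1..n} (P * Q)"
    unfolding mp_in_vars_def
  proof
    fix m assume "m \<in> keys_of (P * Q)"
    then obtain a b where "m = a + b" "a \<in> keys_of P" "b \<in> keys_of Q"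
      using keys_mult[of P Q] by blast
    then show "keys_of m \<subseteq> {1..n}"
      using PQ(1,3) keys_add_subset[of a "{1..n}" b] unfolding mp_in_vars_def by blast
  qed
  then show ?thesis unfolding polyfun_def
    using PQ by (intro exI[of _ "P * Q"]) (simp add: mp_eval_mult[OF semiring_hom_id])
qed

lemma polyfun_sum: "(\<And>i. i \<in> A \<Longrightarrow> polyfun n (f i)) \<Longrightarrow> polyfun n (\<lambda>x. \<Sum>i\<in>A. f i x)"
  by (induction A rule: infinite_finite_induct) (auto intro: polyfun_const polyfun_add)

lemma polyfun_prod: "(\<And>i. i \<in> A \<Longrightarrow> polyfun n (f i)) \<Longrightarrow> polyfun n (\<lambda>x. \<Prod>i\<in>A. f i x)"
  by (induction A rule: infinite_finite_induct) (auto intro: polyfun_const polyfun_mult)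

lemma polyfun_diff: "polyfun n f \<Longrightarrow> polyfun n g \<Longrightarrow> polyfun n (\<lambda>x. f x - g x)"
  using polyfun_add[OF _ polyfun_mult[OF polyfun_const[of n "-1"]], of f g] by simp

lemma polyfun_gbinomial: "polyfun n f \<Longrightarrow> polyfun n (\<lambda>x. f x gchoose k)"
  unfolding gbinomial_prod_rev divide_inverse
  by (intro polyfun_mult polyfun_const polyfun_prod polyfun_diff)

lemma polyfun_imp_polynomial_on_cone:
  assumes "polyfun n g" "\<And>w. w \<in> even_lattice n \<Longrightarrow> real_weight n w \<in> C \<Longrightarrow> f w = g (real_weight n w)"
  shows "polynomial_on_cone n f C"
  using assms unfolding polyfun_def polynomial_on_cone_def by metis

section \<open>The polynomials of the Hilbert function\<close>

abbreviation wsum :: "(nat \<Rightarrow> real) \<Rightarrow> nat set \<Rightarrow> real" where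
  "wsum v J \<equiv> \<Sum>j\<in>J. v j"

abbreviation whalf :: "nat \<Rightarrow> (nat \<Rightarrow> real) \<Rightarrow> real" where
  "whalf n v \<equiv> (\<Sum>j\<in>{1..n}. v j) / 2"

text \<open>The alternating sum over a frozen family of index sets, with the truncated
  \<open>binom\<close> replaced by \<open>gchoose\<close>, which is a polynomial in its upper
  entry.\<close>

definition chamber_poly :: "nat \<Rightarrow> nat set set \<Rightarrow> (nat \<Rightarrow> real) \<Rightarrow> real" where
  "chamber_poly n \<J> v =
     (\<Sum>J\<in>\<J>. (-1) ^ card J * ((whalf n v - wsum v J - real (card J) + real n - 2) gchoose (n - 2)))"

lemma polyfun_chamber_poly: "\<J> \<subseteq> Pow {1..n} \<Longrightarrow> polyfun n (chamber_poly n \<J>)"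
  unfolding chamber_poly_def[abs_def] divide_inverse
  by (intro polyfun_sum polyfun_mult polyfun_const polyfun_gbinomial polyfun_diff polyfun_add polyfun_var) blast+

lemma wsum_real_weight: "J \<subseteq> {1..n} \<Longrightarrow> wsum (real_weight n w) J = of_int (\<Sum>j\<in>J. w j)"
  unfolding of_int_sum by (rule sum.cong) (auto simp: real_weight_def)

lemma whalf_real_weight: "w \<in> even_lattice n \<Longrightarrow> whalf n (real_weight n w) = of_int (half_weight n w)"
  using half_weight_double[of w n] wsum_real_weight[of "{1..n}" n w]
  by (metis nonzero_mult_div_cancel_left of_int_mult of_int_numeral order_refl zero_neq_numeral)

text \<open>The complement of a light set weighs more than half, so it is not a single point and has
  at least two elements. This keeps the upper entry of the binomial coefficient nonnegative, where
  \<open>gchoose\<close> and \<open>binom\<close> agree.\<close>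

lemma light_card_le:
  assumes le: "\<And>j. j \<in> {1..n} \<Longrightarrow> v j \<le> whalf n v" and nn: "\<And>j. j \<in> {1..n} \<Longrightarrow> 0 \<le> v j"
    and J: "J \<subseteq> {1..n}" "wsum v J < whalf n v"
  shows "card J + 2 \<le> n"
proof (rule ccontr)
  assume c: "\<not> card J + 2 \<le> n"
  have fin: "finite J" using J(1) finite_subset by blast
  have s: "wsum v {1..n} = wsum v J + wsum v ({1..n} - J)"
    using sum.subset_diff[OF J(1)] by (simp add: add.commute)
  have "card ({1..n} - J) = n - card J" using J(1) fin by (simp add: card_Diff_subset)
  then have "card ({1..n} - J) \<le> 1" using c by simp
  then obtain j where "{1..n} - J \<subseteq> {j}"
    using card_le_Suc0_iff_eq[of "{1..n} - J"] by (cases "{1..n} - J = {}") auto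
  then have "{1..n} - J = {} \<or> {1..n} - J = {j} \<and> j \<in> {1..n}" by auto
  moreover have "wsum v {1..n} \<ge> 0" by (rule sum_nonneg) (rule nn)
  ultimately have "wsum v ({1..n} - J) \<le> whalf n v"
  proof (elim disjE conjE)
    assume "{1..n} - J = {j}" "j \<in> {1..n}"
    then show ?thesis using le[of j] by (simp only: sum.insert sum.empty finite.emptyI empty_iff simp_thms add_0_right)
  next
    assume e: "{1..n} - J = {}" "wsum v {1..n} \<ge> 0"
    show ?thesis unfolding e(1) using e(2) by simp
  qed
  then show False using s J(2) by (simp add: field_simps)
qed

text \<open>On the closed cone the summands with \<open>|w\<^sub>J| = |w|/2\<close> vanish, except that of the empty set at the
  origin, where it supplies the value 1. Hence the exception at the origin disappears.\<close>

lemma hilbert_function_eq_chamber_poly: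
  assumes n: "n \<ge> 2" and w: "w \<in> even_lattice n"
    and nn: "\<And>j. j \<in> {1..n} \<Longrightarrow> 0 \<le> real_weight n w j"
    and le: "\<And>j. j \<in> {1..n} \<Longrightarrow> real_weight n w j \<le> whalf n (real_weight n w)"
    and \<J>: "\<J> \<subseteq> Pow {1..n}" "{} \<in> \<J>" "\<And>J. J \<in> \<J> \<Longrightarrow> card J + 2 \<le> n"
    and less: "\<And>J. J \<subseteq> {1..n} \<Longrightarrow> wsum (real_weight n w) J < whalf n (real_weight n w) \<Longrightarrow> J \<in> \<J>"
    and le': "\<And>J. J \<in> \<J> \<Longrightarrow> wsum (real_weight n w) J \<le> whalf n (real_weight n w)"
  shows "real (hilbert_function TYPE('k::field) n w) = chamber_poly n \<J> (real_weight n w)"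
proof -
  let ?h = "half_weight n w"
  define a where "a = (\<lambda>J. ?h - (\<Sum>j\<in>J. w j) + int n - int (card J) - 2)"
  have wn: "w \<in> nonneg_weights n"
    using nn w by (auto simp: nonneg_weights_def even_lattice_def int_weights_def real_weight_def PiE_iff)
  have fin: "finite \<J>" using \<J>(1) by (rule finite_subset) simp
  have wJ: "(\<Sum>j\<in>J. w j) \<le> ?h" if "J \<in> \<J>" for J
  proof -
    have "J \<subseteq> {1..n}" using that \<J>(1) by blast
    then show ?thesis using le'[OF that] unfolding whalf_real_weight[OF w] by (simp only: wsum_real_weight of_int_le_iff)
  qed
  have strict: "J \<in> \<J>" if "J \<subseteq> {1..n}" "(\<Sum>j\<in>J. w j) < ?h" for J
    using less[OF that(1)] that(2)
    unfolding whalf_real_weight[OF w] wsum_real_weight[OF that(1)] by (simp only: of_int_less_iff)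
  have trm: "(whalf n (real_weight n w) - wsum (real_weight n w) J - real (card J) + real n - 2) gchoose (n - 2)
      = of_int (binom (a J) (int n - 2))" if J: "J \<in> \<J>" for J
  proof -
    have e1: "whalf n (real_weight n w) - wsum (real_weight n w) J - real (card J) + real n - 2 = of_int (a J)"
    proof -
      have "J \<subseteq> {1..n}" using J \<J>(1) by blast
      then show ?thesis unfolding whalf_real_weight[OF w] a_def by (simp only: wsum_real_weight)
    qed
    have a0: "a J \<ge> 0" using wJ[OF J] \<J>(3)[OF J] by (simp add: a_def)
    then have e2: "of_int (a J) = real (nat (a J))" by simp
    have e3: "binom (a J) (int n - 2) = int (nat (a J) choose (n - 2))"
    proof -
      have i: "int n - 2 = int (n - 2)" using n by simp
      show ?thesis
      proof (cases "int (n - 2) \<le> a J")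
        case False
        then have "nat (a J) choose (n - 2) = 0" using a0 by (intro binomial_eq_0) linarith
        then show ?thesis using False unfolding binom_def i by simp
      qed (simp only: binom_def i nat_int of_nat_0_le_iff simp_thms if_True)
    qed
    show ?thesis by (simp only: e1 e2 e3 of_int_of_nat_eq binomial_gbinomial)
  qed
  have cp: "chamber_poly n \<J> (real_weight n w) = of_int (\<Sum>J\<in>\<J>. (-1) ^ card J * binom (a J) (int n - 2))"
    unfolding chamber_poly_def of_int_sum using trm by (intro sum.cong) auto
  \<comment> \<open>On the wall the upper entry drops to n - 2 - \<bar>J\<bar>, below the lower
    entry as soon as J is nonempty.\<close>
  have eqh: "binom (a J) (int n - 2) = 0" if J: "J \<in> \<J>" "(\<Sum>j\<in>J. w j) = ?h" "J \<noteq> {}" for J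
  proof -
    have "finite J" using J(1) \<J>(1) by (meson PowD finite_atLeastAtMost finite_subset subsetD)
    then have "card J > 0" using J(3) by (simp add: card_gt_0_iff)
    then show ?thesis using J(2) by (simp add: binom_def a_def)
  qed
  have "int (hilbert_function TYPE('k) n w) = (\<Sum>J\<in>\<J>. (-1) ^ card J * binom (a J) (int n - 2))"
  proof (cases "w = zero_weight n")
    case True
    have h0: "?h = 0" and s0: "(\<Sum>j\<in>J. w j) = 0" if "J \<subseteq> {1..n}" for J
      using that unfolding True by (auto simp: zero_weight_def half_weight_def intro!: sum.neutral)
    have "(\<Sum>J\<in>\<J>. (-1) ^ card J * binom (a J) (int n - 2)) = (\<Sum>J\<in>{{}}. (-1) ^ card J * binom (a J) (int n - 2))"
    proof (rule sum.mono_neutral_right[OF fin])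
      show "{{}} \<subseteq> \<J>" using \<J>(2) by simp
      show "\<forall>J\<in>\<J> - {{}}. (-1) ^ card J * binom (a J) (int n - 2) = 0"
      proof
        fix J assume J: "J \<in> \<J> - {{}}"
        then have "J \<subseteq> {1..n}" using \<J>(1) by blast
        then have "(\<Sum>j\<in>J. w j) = ?h" using s0[of J] h0[of J] by simp
        then show "(-1) ^ card J * binom (a J) (int n - 2) = 0" using eqh[of J] J by simp
      qed
    qed
    also have "\<dots> = 1" using h0[of "{}"] n by (simp add: a_def binom_def)
    finally show ?thesis unfolding True by (simp add: hilbert_function_zero_weight)
  next
    case False
    have hpos: "?h > 0"
    proof (rule ccontr)
      assume "\<not> ?h > 0"
      then have "(\<Sum>i\<in>{1..n}. w i) \<le> 0" using half_weight_double[OF w] by simp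
      then have "w i = 0" if "i \<in> {1..n}" for i
        using that nonneg_weights_ge_0[OF wn] sum_nonneg_eq_0_iff[of "{1..n}" w] sum_nonneg[of "{1..n}" w] by force
      then have "w = zero_weight n"
        using wn by (auto simp: zero_weight_def nonneg_weights_def PiE_iff extensional_def restrict_def)
      then show False using False by simp
    qed
    have "int (hilbert_function TYPE('k) n w) = alternating_sum n w"
      by (rule hilbert_function_eq_alternating_sum[OF n w wn False])
    also have "\<dots> = (\<Sum>J | J \<subseteq> {1..n} \<and> (\<Sum>j\<in>J. w j) < ?h. (-1) ^ card J * binom (a J) (int n - 2))"
      unfolding alternating_sum_def a_def ..
    also have "\<dots> = (\<Sum>J\<in>\<J>. (-1) ^ card J * binom (a J) (int n - 2))"
    proof (rule sum.mono_neutral_left[OF fin])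
      show "{J. J \<subseteq> {1..n} \<and> (\<Sum>j\<in>J. w j) < ?h} \<subseteq> \<J>" using strict by blast
      show "\<forall>J\<in>\<J> - {J. J \<subseteq> {1..n} \<and> (\<Sum>j\<in>J. w j) < ?h}. (-1) ^ card J * binom (a J) (int n - 2) = 0"
      proof
        fix J assume J: "J \<in> \<J> - {J. J \<subseteq> {1..n} \<and> (\<Sum>j\<in>J. w j) < ?h}"
        then have "\<not> (\<Sum>j\<in>J. w j) < ?h" using \<J>(1) by blast
        then have e: "(\<Sum>j\<in>J. w j) = ?h" using wJ[of J] J by simp
        then have "J \<noteq> {}" using hpos by auto
        then show "(-1) ^ card J * binom (a J) (int n - 2) = 0" using eqh[of J] e J by simp
      qed
    qed
    finally show ?thesis .
  qed
  then have "real_of_int (int (hilbert_function TYPE('k) n w)) = chamber_poly n \<J> (real_weight n w)"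
    unfolding cp by (rule arg_cong)
  then show ?thesis by simp
qed

text \<open>The family is arbitrary, so there are finitely many cells by construction. Families that
  come from no regular weight give cones of smaller dimension.\<close>

definition closed_cell :: "nat \<Rightarrow> nat set set \<Rightarrow> (nat \<Rightarrow> real) set" where
  "closed_cell n \<Q> = {v \<in> {1..n} \<rightarrow>\<^sub>E UNIV. (\<forall>j\<in>{1..n}. 0 \<le> v j \<and> v j \<le> whalf n v) \<and>
     (\<forall>J\<in>Pow {1..n}. if J \<in> \<Q> then wsum v J \<le> whalf n v else whalf n v \<le> wsum v J)}"

lemma polyhedral_cone_closed_cell: "polyhedral_cone n (closed_cell n \<Q>)"
proof -
  define ind :: "nat set \<Rightarrow> nat \<Rightarrow> real" where "ind = (\<lambda>J i. if i \<in> J then 1 else 0)"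
  define A where "A = (\<lambda>j. ind {j}) ` {1..n} \<union> (\<lambda>j i. 1 / 2 - ind {j} i) ` {1..n} \<union>
     (\<lambda>J i. if J \<in> \<Q> then 1 / 2 - ind J i else ind J i - 1 / 2) ` Pow {1..n}"
  have i: "(\<Sum>i\<in>{1..n}. ind J i * v i) = wsum v J" if "J \<subseteq> {1..n}" for J and v :: "nat \<Rightarrow> real"
    using that by (simp add: ind_def if_distrib[of "\<lambda>x. x * _"] sum.If_cases Int_absorb1 cong: if_cong)
  have h: "(\<Sum>i\<in>{1..n}. (1 / 2 - ind J i) * v i) = whalf n v - wsum v J"
    "(\<Sum>i\<in>{1..n}. (ind J i - 1 / 2) * v i) = wsum v J - whalf n v" if "J \<subseteq> {1..n}" for J v
    unfolding left_diff_distrib sum_subtractf i[OF that] by (simp_all add: sum_divide_distrib)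
  have "closed_cell n \<Q> = {w \<in> {1..n} \<rightarrow>\<^sub>E UNIV. \<forall>a\<in>A. 0 \<le> (\<Sum>i\<in>{1..n}. a i * w i)}"
    unfolding closed_cell_def
  proof (rule Collect_cong, rule conj_cong[OF refl])
    fix v :: "nat \<Rightarrow> real"
    have "(\<forall>a\<in>A. 0 \<le> (\<Sum>i\<in>{1..n}. a i * v i)) \<longleftrightarrow>
       (\<forall>j\<in>{1..n}. 0 \<le> (\<Sum>i\<in>{1..n}. ind {j} i * v i)) \<and>
       (\<forall>j\<in>{1..n}. 0 \<le> (\<Sum>i\<in>{1..n}. (1 / 2 - ind {j} i) * v i)) \<and>
       (\<forall>J\<in>Pow {1..n}. 0 \<le> (\<Sum>i\<in>{1..n}. (if J \<in> \<Q> then 1 / 2 - ind J i else ind J i - 1 / 2) * v i))"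
      unfolding A_def by (simp only: ball_Un ball_simps conj_assoc)
    also have "\<dots> \<longleftrightarrow> (\<forall>j\<in>{1..n}. 0 \<le> v j) \<and> (\<forall>j\<in>{1..n}. v j \<le> whalf n v) \<and>
       (\<forall>J\<in>Pow {1..n}. if J \<in> \<Q> then wsum v J \<le> whalf n v else whalf n v \<le> wsum v J)"
    proof (intro conj_cong ball_cong refl)
      fix j assume "j \<in> {1..n}"
      then have "{j} \<subseteq> {1..n}" by simp
      then show "(0 \<le> (\<Sum>i\<in>{1..n}. ind {j} i * v i)) = (0 \<le> v j)"
        "(0 \<le> (\<Sum>i\<in>{1..n}. (1 / 2 - ind {j} i) * v i)) = (v j \<le> whalf n v)"
        using i[of "{j}" v] h(1)[of "{j}" v] by simp_all
    next
      fix J assume "J \<in> Pow {1..n}"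
      then show "(0 \<le> (\<Sum>i\<in>{1..n}. (if J \<in> \<Q> then 1 / 2 - ind J i else ind J i - 1 / 2) * v i)) =
        (if J \<in> \<Q> then wsum v J \<le> whalf n v else whalf n v \<le> wsum v J)"
        using h[of J v] by simp
    qed
    finally show "((\<forall>j\<in>{1..n}. 0 \<le> v j \<and> v j \<le> whalf n v) \<and>
      (\<forall>J\<in>Pow {1..n}. if J \<in> \<Q> then wsum v J \<le> whalf n v else whalf n v \<le> wsum v J)) =
      (\<forall>a\<in>A. 0 \<le> (\<Sum>i\<in>{1..n}. a i * v i))" by blast
  qed
  moreover have "finite A" by (simp add: A_def)
  ultimately show ?thesis unfolding polyhedral_cone_def by blast
qed

lemma polynomial_on_closed_cell:
  assumes n: "n \<ge> 2"
  shows "polynomial_on_cone n (\<lambda>w. real (hilbert_function TYPE('k::field) n w)) (closed_cell n \<Q>)"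
proof -
  \<comment> \<open>An arbitrary family need not consist of small sets or contain the empty set.
    Light sets have at most n - 2 elements, so discarding larger ones loses none; the empty set is
    added because it carries the value at the origin.\<close>
  define \<J> where "\<J> = {J. J \<subseteq> {1..n} \<and> card J + 2 \<le> n \<and> (J = {} \<or> J \<in> \<Q>)}"
  have "polyfun n (chamber_poly n \<J>)" by (rule polyfun_chamber_poly) (auto simp: \<J>_def)
  then show ?thesis
  proof (rule polyfun_imp_polynomial_on_cone)
    fix w assume w: "w \<in> even_lattice n" and C: "real_weight n w \<in> closed_cell n \<Q>"
    let ?v = "real_weight n w"
    have nn: "0 \<le> ?v j" and le: "?v j \<le> whalf n ?v" if "j \<in> {1..n}" for j
      using C that by (auto simp: closed_cell_def)
    have Q: "if J \<in> \<Q> then wsum ?v J \<le> whalf n ?v else whalf n ?v \<le> wsum ?v J" if "J \<subseteq> {1..n}" for J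
      using C that unfolding closed_cell_def by blast
    show "real (hilbert_function TYPE('k) n w) = chamber_poly n \<J> ?v"
    proof (rule hilbert_function_eq_chamber_poly[OF n w nn le])
      show "J \<in> \<J>" if "J \<subseteq> {1..n}" "wsum ?v J < whalf n ?v" for J
        using light_card_le[OF le nn that] Q[OF that(1)] that unfolding \<J>_def by (auto split: if_splits)
      show "wsum ?v J \<le> whalf n ?v" if "J \<in> \<J>" for J
      proof (cases "J = {}")
        case True
        have "wsum ?v {1..n} \<ge> 0" by (rule sum_nonneg) (rule nn)
        then show ?thesis using True by simp
      next
        case False
        then show ?thesis using Q[of J] that by (auto simp: \<J>_def)
      qed
    qed (use n in \<open>auto simp: \<J>_def\<close>)
  qed
qed

theorem piecewise_polynomial_hilbert_function:
  assumes n: "n \<ge> 2"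
  shows "piecewise_polynomial n (\<lambda>w. real (hilbert_function TYPE('k::field) n w))"
  unfolding piecewise_polynomial_def
proof (intro exI conjI ballI)
  let ?\<C> = "closed_cell n ` Pow (Pow {1..n})"
  show "finite ?\<C>" by simp
  show "polyhedral_cone n C" if "C \<in> ?\<C>" for C using that polyhedral_cone_closed_cell by blast
  show "polynomial_on_cone n (\<lambda>w. real (hilbert_function TYPE('k) n w)) C" if "C \<in> ?\<C>" for C
    using that polynomial_on_closed_cell[OF n] by blast
  have "real (hilbert_function TYPE('k) n w) \<noteq> 0 \<longleftrightarrow> real_weight n w \<in> \<Union>?\<C>" if w: "w \<in> even_lattice n" for w
  proof -
    let ?v = "real_weight n w"
    have wi: "w \<in> int_weights n" using w by (simp add: even_lattice_def)
    have "real (hilbert_function TYPE('k) n w) \<noteq> 0 \<longleftrightarrow> (\<forall>j\<in>{1..n}. 0 \<le> w j \<and> w j \<le> half_weight n w)"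
      using hilbert_function_nonzero_iff[OF wi, where 'k='k] w wi
      by (auto simp: nonneg_weights_def int_weights_def PiE_iff)
    also have "\<dots> \<longleftrightarrow> (\<forall>j\<in>{1..n}. 0 \<le> ?v j \<and> ?v j \<le> whalf n ?v)"
      unfolding whalf_real_weight[OF w] by (auto simp: real_weight_def)
    also have "\<dots> \<longleftrightarrow> ?v \<in> \<Union>?\<C>"
    proof
      assume a: "\<forall>j\<in>{1..n}. 0 \<le> ?v j \<and> ?v j \<le> whalf n ?v"
      have "?v \<in> {1..n} \<rightarrow>\<^sub>E UNIV" by (simp add: real_weight_def)
      then have "?v \<in> closed_cell n {J \<in> Pow {1..n}. wsum ?v J \<le> whalf n ?v}"
        using a unfolding closed_cell_def by auto
      moreover have "closed_cell n {J \<in> Pow {1..n}. wsum ?v J \<le> whalf n ?v} \<in> ?\<C>" by (rule imageI) blast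
      ultimately show "?v \<in> \<Union>?\<C>" by (rule UnionI[rotated])
    next
      assume "?v \<in> \<Union>?\<C>"
      then obtain \<Q> where "?v \<in> closed_cell n \<Q>" by blast
      then show "\<forall>j\<in>{1..n}. 0 \<le> ?v j \<and> ?v j \<le> whalf n ?v" unfolding closed_cell_def by blast
    qed
    finally show ?thesis .
  qed
  then show "{w \<in> even_lattice n. real (hilbert_function TYPE('k) n w) \<noteq> 0} =
      {w \<in> even_lattice n. real_weight n w \<in> \<Union>?\<C>}" by blast
qed

section \<open>Distinct chambers have distinct polynomials\<close>

definition flip :: "'a \<Rightarrow> 'a set \<Rightarrow> 'a set" where
  "flip i J = (if i \<in> J then J - {i} else insert i J)"

lemma in_flip_iff: "x \<in> flip i J \<longleftrightarrow> (x \<in> J) \<noteq> (x = i)"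
  by (auto simp: flip_def)

lemma flip_flip [simp]: "flip i (flip i J) = J"
  unfolding set_eq_iff in_flip_iff by blast

lemma flip_commute: "flip i (flip j J) = flip j (flip i J)"
  unfolding set_eq_iff in_flip_iff by blast

lemma flip_subset: "J \<subseteq> I \<Longrightarrow> i \<in> I \<Longrightarrow> flip i J \<subseteq> I"
  by (auto simp: flip_def)

text \<open>A function on the cube with adjacency eigenvalue \<open>n - 2\<close> has directional differences that are
  harmonic on the facets, hence constant by the maximum principle.\<close>

lemma cube_eigenfunction_eq_0:
  fixes s :: "nat set \<Rightarrow> real"
  assumes eig: "\<And>J. J \<subseteq> {1..n} \<Longrightarrow> (\<Sum>k\<in>{1..n}. s (flip k J)) = (real n - 2) * s J"
    and z: "s {} = 0" "\<And>i. i \<in> {1..n} \<Longrightarrow> s {i} = 0"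
    and J: "J \<subseteq> {1..n}"
  shows "s J = 0"
proof -
  have diff_le: "s J - s (flip i J) \<le> 0" if i: "i \<in> {1..n}" and J: "J \<subseteq> {1..n}" for i J
  proof -
    define d where "d = (\<lambda>J. s J - s (flip i J))"
    let ?C = "Pow {1..n}"
    \<comment> \<open>The difference d changes sign under \<open>flip i\<close>. Moving this term
      across raises the eigenvalue from n - 2 to n - 1, the number of remaining directions, so d is
      the mean of its neighbours.\<close>
    have harm: "(\<Sum>k\<in>{1..n} - {i}. d (flip k J)) = (real n - 1) * d J" if J: "J \<subseteq> {1..n}" for J
    proof -
      have "(\<Sum>k\<in>{1..n}. d (flip k J)) = (real n - 2) * d J"
        using eig[OF J] eig[OF flip_subset[OF J i]]
        by (simp add: d_def sum_subtractf flip_commute[of i] right_diff_distrib)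
      moreover have "(\<Sum>k\<in>{1..n}. d (flip k J)) = d (flip i J) + (\<Sum>k\<in>{1..n} - {i}. d (flip k J))"
        using i by (intro sum.remove) auto
      moreover have "d (flip i J) = - d J" by (simp add: d_def)
      ultimately show ?thesis by (simp add: algebra_simps)
    qed
    define M where "M = Max (d ` ?C)"
    have dM: "d J \<le> M" if "J \<subseteq> {1..n}" for J unfolding M_def using that by (intro Max_ge) auto
    have step: "d (flip k J) = M" if J: "J \<subseteq> {1..n}" "d J = M" and k: "k \<in> {1..n} - {i}" for k J
    proof (rule ccontr)
      assume ne: "d (flip k J) \<noteq> M"
      have kle: "d (flip l J) \<le> M" if "l \<in> {1..n} - {i}" for l
        using dM flip_subset[OF J(1), of l] that by blast
      have "d (flip k J) < M" using ne kle[OF k] by simp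
      then have "(\<Sum>l\<in>{1..n} - {i}. d (flip l J)) < (\<Sum>l\<in>{1..n} - {i}. M)"
        using k kle by (intro sum_strict_mono_ex1) auto
      also have "\<dots> = (real n - 1) * M" using i by (simp add: of_nat_diff)
      finally show False using harm[OF J(1)] J(2) by simp
    qed
    \<comment> \<open>Equality in the mean value spreads the maximum to every neighbour. Removing
      all elements other than i leads to {} or {i}, where d vanishes by the normalisation of
      s.\<close>
    have reach: "d (K \<inter> {i}) = M" if "finite L" "K \<subseteq> {1..n}" "d K = M" "L = K - {i}" for K L
      using that
    proof (induction L arbitrary: K rule: finite_induct)
      case empty
      then have "K \<inter> {i} = K" by auto
      then show ?case using empty by simp
    next
      case (insert l L)
      have lK: "l \<in> K - {i}" unfolding insert.prems(3)[symmetric] by simp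
      then have l: "l \<in> K" "l \<noteq> i" "l \<in> {1..n} - {i}" using insert.prems(1) by blast+
      have L: "L = K - {l} - {i}" using insert.prems(3) insert.hyps(2) by blast
      have f: "flip l K = K - {l}" using l by (simp add: flip_def)
      have "d (flip l K) = M" by (rule step[OF insert.prems(1,2) l(3)])
      then have "d ((K - {l}) \<inter> {i}) = M"
        unfolding f using insert.prems(1) by (intro insert.IH[OF _ _ L]) auto
      moreover have "(K - {l}) \<inter> {i} = K \<inter> {i}" using l by auto
      ultimately show ?case by simp
    qed
    obtain K where K: "K \<subseteq> {1..n}" "d K = M"
    proof -
      have "M \<in> d ` ?C" unfolding M_def by (rule Max_in) auto
      then show thesis using that by blast
    qed
    have "finite (K - {i})" using K(1) by (meson finite_Diff finite_atLeastAtMost finite_subset)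
    from reach[OF this K refl] have "d (K \<inter> {i}) = M" .
    moreover have "K \<inter> {i} = {} \<or> K \<inter> {i} = {i}" by auto
    moreover have "d {} = 0" "d {i} = 0" using z i by (simp_all add: d_def flip_def)
    ultimately have "M = 0" by metis
    then show ?thesis using dM[OF J] by (simp add: d_def)
  qed
  have eq: "s J = s (flip i J)" if i: "i \<in> {1..n}" and J: "J \<subseteq> {1..n}" for i J
    using diff_le[OF i J] diff_le[OF i flip_subset[OF J i]] by simp
  have "finite J" using J finite_subset by blast
  then show ?thesis using J
  proof (induction J rule: finite_induct)
    case (insert i J)
    then have "s (insert i J) = s (flip i J)" by (simp add: flip_def)
    then show ?case using eq[of i J] insert by simp
  qed (rule z)
qed

section \<open>Values at integral points and the eigenvalue equation\<close>

definition sdiff :: "'a set \<Rightarrow> 'a set \<Rightarrow> 'a set" where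
  "sdiff J K = (J - K) \<union> (K - J)"

lemma card_sdiff:
  assumes "finite J" "finite K"
  shows "card (sdiff J K) + 2 * card (J \<inter> K) = card J + card K"
proof -
  have "card (sdiff J K) = card (J - K) + card (K - J)"
    unfolding sdiff_def using assms by (intro card_Un_disjoint) auto
  moreover have "card J = card (J - K) + card (J \<inter> K)"
    using card_Int_Diff[of J K] assms by simp
  moreover have "card K = card (K - J) + card (J \<inter> K)"
    using card_Int_Diff[of K J] assms by (simp add: Int_commute)
  ultimately show ?thesis by simp
qed

text \<open>The integers 1, ..., n - 2 are roots in d. At d = n - 1 and d = n the upper entries are
  -1 and -2, and negation of the upper entry gives the signs and the factor n - 1.\<close>

lemma gbinomial_negative_values:
  assumes n: "n \<ge> 2"
  shows "d = 0 \<Longrightarrow> ((real n - 2 - real d) gchoose (n - 2)) = 1"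
    "0 < d \<Longrightarrow> d + 2 \<le> n \<Longrightarrow> ((real n - 2 - real d) gchoose (n - 2)) = 0"
    "d + 1 = n \<Longrightarrow> ((real n - 2 - real d) gchoose (n - 2)) = (-1) ^ n"
    "d = n \<Longrightarrow> ((real n - 2 - real d) gchoose (n - 2)) = (-1) ^ n * (real n - 1)"
proof -
  have m1: "(-1 :: real) ^ (n - 2) = (-1) ^ n"
  proof -
    obtain k where "n = 2 + k" using n by (auto simp: le_iff_add)
    then show ?thesis by (simp add: power_add)
  qed
  show "d = 0 \<Longrightarrow> ((real n - 2 - real d) gchoose (n - 2)) = 1"
  proof -
    assume "d = 0"
    then have e: "real n - 2 - real d = real (n - 2)" using n by (simp add: of_nat_diff)
    show ?thesis unfolding e binomial_gbinomial[symmetric] by simp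
  qed
  show "0 < d \<Longrightarrow> d + 2 \<le> n \<Longrightarrow> ((real n - 2 - real d) gchoose (n - 2)) = 0"
  proof -
    assume d: "0 < d" "d + 2 \<le> n"
    then have e: "real n - 2 - real d = real (n - 2 - d)" by (simp add: of_nat_diff)
    show ?thesis unfolding e binomial_gbinomial[symmetric] using d by (simp add: binomial_eq_0)
  qed
  show "d + 1 = n \<Longrightarrow> ((real n - 2 - real d) gchoose (n - 2)) = (-1) ^ n"
  proof -
    assume "d + 1 = n"
    then have e: "real n - 2 - real d = - 1" by auto
    have "1 + real (n - 2) - 1 = real (n - 2)" by simp
    then have "((-1 :: real) gchoose (n - 2)) = (-1) ^ (n - 2) * (real (n - 2) gchoose (n - 2))"
      using gbinomial_minus[of "1::real" "n - 2"] by metis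
    also have "real (n - 2) gchoose (n - 2) = 1" unfolding binomial_gbinomial[symmetric] by simp
    finally show ?thesis unfolding e m1 by simp
  qed
  show "d = n \<Longrightarrow> ((real n - 2 - real d) gchoose (n - 2)) = (-1) ^ n * (real n - 1)"
  proof -
    assume d: "d = n"
    have "(real (n - 1) gchoose (n - 2)) = real (n - 1)"
    proof -
      have "n - 1 = Suc (n - 2)" using n by simp
      then show ?thesis by (metis binomial_Suc_n binomial_gbinomial)
    qed
    moreover have "2 + real (n - 2) - 1 = real (n - 1)" using n by (simp add: of_nat_diff)
    ultimately have g: "((-2 :: real) gchoose (n - 2)) = (-1) ^ (n - 2) * real (n - 1)"
      using gbinomial_minus[of "2::real" "n - 2"] by metis
    have e: "real n - 2 - real d = - 2" using d by simp
    show ?thesis unfolding e g m1 using n by (simp add: of_nat_diff)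
  qed
qed

text \<open>Here \<open>s\<close> is the difference of the indicator functions of two families. At the integral point
  \<open>-2 \<cdot> 1\<^sub>K\<close> the summand of J depends only on the distance of J and K in the cube, and all summands
  vanish except those at distances 0, n - 1 and n.\<close>

lemma cube_eigenfunction_from_values:
  fixes s :: "nat set \<Rightarrow> real"
  assumes n: "n \<ge> 2"
    and odd: "\<And>J. J \<subseteq> {1..n} \<Longrightarrow> s ({1..n} - J) = - s J"
    and vals: "\<And>K. K \<subseteq> {1..n} \<Longrightarrow>
       (\<Sum>J\<in>Pow {1..n}. s J * (-1) ^ card J * ((real n - 2 - real (card (sdiff J K))) gchoose (n - 2))) = 0"
    and K: "K \<subseteq> {1..n}"
  shows "(\<Sum>k\<in>{1..n}. s (flip k K)) = (real n - 2) * s K"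
proof -
  let ?I = "{1..n}"
  define p where "p = (\<lambda>d :: nat. (real n - 2 - real d) gchoose (n - 2))"
  have p: "p 0 = 1" "\<And>d. 0 < d \<Longrightarrow> d + 2 \<le> n \<Longrightarrow> p d = 0" "p (n - 1) = (-1) ^ n" "p n = (-1) ^ n * (real n - 1)"
  proof -
    show "p 0 = 1" unfolding p_def by (rule gbinomial_negative_values(1)[OF n refl])
    show "0 < d \<Longrightarrow> d + 2 \<le> n \<Longrightarrow> p d = 0" for d unfolding p_def by (rule gbinomial_negative_values(2)[OF n])
    show "p (n - 1) = (-1) ^ n" unfolding p_def by (rule gbinomial_negative_values(3)[OF n]) (use n in simp)
    show "p n = (-1) ^ n * (real n - 1)" unfolding p_def by (rule gbinomial_negative_values(4)[OF n refl])
  qed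
  have finK: "finite K" using K finite_subset by blast
  \<comment> \<open>Recentring the cube at K: with L = \<open>sdiff J K\<close> the distance from J
    to K is \<open>card L\<close>, and J is recovered as \<open>sdiff L K\<close>.\<close>
  define f where "f = (\<lambda>L. s (sdiff L K) * (-1) ^ card (sdiff L K) * p (card L))"
  have ss: "sdiff (sdiff L K) K = L" for L by (auto simp: sdiff_def)
  have "(\<Sum>J\<in>Pow ?I. s J * (-1) ^ card J * p (card (sdiff J K))) = (\<Sum>L\<in>Pow ?I. f L)"
  proof (rule sum.reindex_bij_witness[of _ "\<lambda>L. sdiff L K" "\<lambda>L. sdiff L K"])
    show "sdiff L K \<in> Pow ?I" if "L \<in> Pow ?I" for L using that K unfolding sdiff_def by blast
    then show "sdiff L K \<in> Pow ?I" if "L \<in> Pow ?I" for L using that .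
  qed (simp_all only: ss f_def)
  then have z: "(\<Sum>L\<in>Pow ?I. f L) = 0" using vals[OF K] by (simp add: p_def)
  \<comment> \<open>These are the sets at distance n - 1 from the centre. Every set other than
    these, {} and the full set has between 1 and n - 2 elements, so its summand is 0.\<close>
  let ?co = "(\<lambda>i. ?I - {i}) ` ?I"
  have "(\<Sum>L\<in>Pow ?I. f L) = (\<Sum>L\<in>insert {} (insert ?I ?co). f L)"
  proof (rule sum.mono_neutral_right)
    show "\<forall>L\<in>Pow ?I - insert {} (insert ?I ?co). f L = 0"
    proof
      fix L assume L: "L \<in> Pow ?I - insert {} (insert ?I ?co)"
      then have LI: "L \<subseteq> ?I" "L \<noteq> {}" "L \<noteq> ?I" and co: "L \<notin> ?co" by auto
      have finL: "finite L" using LI finite_subset by blast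
      have c0: "card L > 0" using LI finL by (simp add: card_gt_0_iff)
      obtain i where i: "i \<in> ?I" "i \<notin> L" using LI by blast
      have "L \<noteq> ?I - {i}" using co i by blast
      then obtain j where j: "j \<in> ?I" "j \<notin> L" "j \<noteq> i" using LI i by blast
      have "card (insert i (insert j L)) \<le> card ?I" using i j LI by (intro card_mono) auto
      then have "card L + 2 \<le> n" using i j finL by simp
      then show "f L = 0" using p(2)[OF c0] by (simp add: f_def)
    qed
  qed auto
  also have "\<dots> = f {} + (f ?I + (\<Sum>L\<in>?co. f L))"
  proof -
    have ne: "?I \<noteq> {}" "{} \<notin> ?co" "?I \<notin> ?co"
    proof -
      show "?I \<noteq> {}" using n by auto
      show "{} \<notin> ?co"
      proof
        assume "{} \<in> ?co"
        then obtain i where "?I - {i} = {}" by blast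
        then have "card ?I \<le> card {i}" by (intro card_mono) auto
        then show False using n by simp
      qed
      show "?I \<notin> ?co" by blast
    qed
    then show ?thesis by (subst sum.insert) (auto simp: sum.insert)
  qed
  also have "(\<Sum>L\<in>?co. f L) = (\<Sum>i\<in>?I. f (?I - {i}))"
    by (subst sum.reindex) (auto simp: inj_on_def)
  finally have eq: "f {} + (f ?I + (\<Sum>i\<in>?I. f (?I - {i}))) = 0" using z by simp
  have cc: "(-1 :: real) ^ card (?I - J) = (-1) ^ n * (-1) ^ card J" if "J \<subseteq> ?I" for J
  proof -
    have "finite J" using that finite_subset by blast
    then have "card (?I - J) = n - card J" "card J \<le> n"
      using that card_mono[of ?I J] by (simp_all add: card_Diff_subset)
    then have "(-1 :: real) ^ n = (-1) ^ card (?I - J) * (-1) ^ card J" by (simp flip: power_add)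
    then show ?thesis by (simp flip: power_mult_distrib)
  qed
  have nn: "(-1 :: real) ^ n * (-1) ^ n = 1" by (simp flip: power_mult_distrib)
  let ?e = "(-1 :: real) ^ card K"
  have f1: "f {} = ?e * s K"
  proof -
    have "sdiff {} K = K" by (auto simp: sdiff_def)
    then show ?thesis by (simp add: f_def p)
  qed
  have f2: "f ?I = - ?e * (real n - 1) * s K"
  proof -
    have e: "sdiff ?I K = ?I - K" using K by (auto simp: sdiff_def)
    have ci: "card ?I = n" by simp
    have "f ?I = - s K * ((-1) ^ n * ?e) * ((-1) ^ n * (real n - 1))"
      by (simp only: f_def e ci p odd[OF K] cc[OF K])
    also have "\<dots> = - s K * ?e * ((-1) ^ n * (-1) ^ n) * (real n - 1)" by (simp only: ac_simps)
    finally show ?thesis unfolding nn by simp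
  qed
  have f3: "f (?I - {i}) = ?e * s (flip i K)" if i: "i \<in> ?I" for i
  proof -
    have fs: "flip i K \<subseteq> ?I" by (rule flip_subset[OF K i])
    have e1: "sdiff (?I - {i}) K = ?I - flip i K" using K i by (auto simp: sdiff_def flip_def)
    have e2: "(-1 :: real) ^ card (flip i K) = - ?e"
    proof (cases "i \<in> K")
      case True
      then have c: "card K = Suc (card (K - {i}))" using finK by (rule card.remove[rotated])
      have "flip i K = K - {i}" using True by (simp add: flip_def)
      then show ?thesis unfolding c by (simp only: power_Suc mult_minus1 minus_minus)
    next
      case False
      then show ?thesis using finK by (simp add: flip_def)
    qed
    have e3: "card (?I - {i}) = n - 1" using i by simp
    have "f (?I - {i}) = - s (flip i K) * ((-1) ^ n * - ?e) * (-1) ^ n"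
      by (simp only: f_def p e1 odd[OF fs] cc[OF fs] e2 e3)
    also have "\<dots> = s (flip i K) * ?e * ((-1) ^ n * (-1) ^ n)" by (simp add: ac_simps)
    finally show ?thesis unfolding nn by simp
  qed
  \<comment> \<open>Oddness sends the antipode of K back to K with factor -(n - 1), and the
    neighbours of the antipode back to the neighbours of K. Thus 1 - (n - 1) = -(n - 2) produces the
    eigenvalue.\<close>
  have "?e * (s K - (real n - 1) * s K + (\<Sum>i\<in>?I. s (flip i K))) = 0"
    using eq f3 unfolding f1 f2 by (simp add: sum_distrib_left algebra_simps)
  then have "s K - (real n - 1) * s K + (\<Sum>i\<in>?I. s (flip i K)) = 0" by simp
  then show ?thesis by (simp add: algebra_simps)
qed

section \<open>Polynomial functions on cones\<close>

text \<open>One degree bound serves for all variables and all values of the others, so a single grid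
  size can be chosen in advance.\<close>

lemma polyfun_separately_polynomial:
  assumes "polyfun n f"
  shows "\<exists>D. \<forall>w i. \<exists>q :: real poly. deg q \<le> D \<and> (\<forall>t. f (w(i := t)) = poly q t)"
proof -
  obtain P where P: "\<And>x. f x = mp_eval id x P" using assms unfolding polyfun_def by blast
  define D where "D = (\<Sum>m\<in>keys_of P. \<Sum>v\<in>keys_of m. lkp m v)"
  have "\<exists>q :: real poly. deg q \<le> D \<and> (\<forall>t. f (w(i := t)) = poly q t)" for w i
  proof -
    define \<alpha> :: "nat \<Rightarrow> real poly" where "\<alpha> = (\<lambda>j. if j = i then [:0, 1:] else [:w j:])"
    define q where "q = mp_eval (\<lambda>c. [:c:]) \<alpha> P"
    have da: "deg (\<alpha> v ^ k) \<le> k" for v k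
      by (rule order_trans[OF degree_power_le]) (simp add: \<alpha>_def)
    have "deg (\<Prod>v\<in>A. \<alpha> v ^ lkp m v) \<le> (\<Sum>v\<in>A. lkp m v)" for A m
      by (induction A rule: infinite_finite_induct)
        (auto intro!: order_trans[OF degree_mult_le] add_mono da)
    then have dm: "deg (monomial_eval \<alpha> m) \<le> (\<Sum>v\<in>keys_of m. lkp m v)" for m
      unfolding monomial_eval_def .
    have "deg q \<le> D"
      unfolding q_def mp_eval_alt
    proof (rule degree_sum_le)
      fix m assume m: "m \<in> keys_of P"
      have "deg ([:lkp P m:] * monomial_eval \<alpha> m)
          \<le> deg [:lkp P m:] + deg (monomial_eval \<alpha> m)"
        by (rule degree_mult_le)
      also have "\<dots> \<le> (\<Sum>v\<in>keys_of m. lkp m v)" using dm[of m] by simp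
      also have "\<dots> \<le> D" unfolding D_def by (rule member_le_sum[OF m]) auto
      finally show "deg ([:lkp P m:] * monomial_eval \<alpha> m) \<le> D" .
    qed simp
    moreover have "f (w(i := t)) = poly q t" for t
    proof -
      have h: "semiring_hom (\<lambda>p :: real poly. poly p t)" by (intro semiring_homI) auto
      have v: "(\<lambda>v. poly (\<alpha> v) t) = w(i := t)" by (auto simp: \<alpha>_def)
      show ?thesis unfolding q_def hom_mp_eval[OF h] v P by (simp add: id_def)
    qed
    ultimately show ?thesis by blast
  qed
  then show ?thesis by blast
qed

text \<open>Vanishing on a grid with more than D points per side, eliminated one coordinate at a
  time. The base point \<open>w0\<close> varies in the induction because each step freezes one more
  coordinate at a grid value.\<close>

lemma separately_polynomial_eq_0:
  fixes f :: "(nat \<Rightarrow> real) \<Rightarrow> real"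
  assumes sep: "\<And>w i. \<exists>q :: real poly. deg q \<le> D \<and> (\<forall>t. f (w(i := t)) = poly q t)"
    and A: "\<And>i. finite (A i)" "\<And>i. card (A i) > D"
    and z: "\<And>w. (\<And>i. i \<in> {1..k} \<Longrightarrow> w i \<in> A i) \<Longrightarrow> (\<And>i. i \<notin> {1..k} \<Longrightarrow> w i = w0 i) \<Longrightarrow> f w = 0"
    and w: "\<And>i. i \<notin> {1..k} \<Longrightarrow> w i = w0 i"
  shows "f w = 0"
  using z w
proof (induction k arbitrary: w w0)
  case 0
  then show ?case by simp
next
  case (Suc k)
  obtain q :: "real poly" where q: "deg q \<le> D" "\<And>t. f (w(Suc k := t)) = poly q t"
    using sep[of w "Suc k"] by blast
  have "poly q a = 0" if a: "a \<in> A (Suc k)" for a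
  proof -
    have "f (w(Suc k := a)) = 0"
    proof (rule Suc.IH[of "w0(Suc k := a)"])
      fix u assume u: "\<And>i. i \<in> {1..k} \<Longrightarrow> u i \<in> A i" "\<And>i. i \<notin> {1..k} \<Longrightarrow> u i = (w0(Suc k := a)) i"
      show "f u = 0"
      proof (rule Suc.prems(1))
        fix i assume i: "i \<in> {1..Suc k}"
        show "u i \<in> A i"
        proof (cases "i = Suc k")
          case True
          then show ?thesis using u(2)[of "Suc k"] a by simp
        next
          case False
          then show ?thesis using u(1)[of i] i by simp
        qed
      next
        fix i assume i: "i \<notin> {1..Suc k}"
        then have "i \<noteq> Suc k" "i \<notin> {1..k}" by auto
        then show "u i = w0 i" using u(2)[of i] by simp
      qed
    next
      fix i assume i: "i \<notin> {1..k}"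
      show "(w(Suc k := a)) i = (w0(Suc k := a)) i"
        using Suc.prems(2)[of i] i by (cases "i = Suc k") auto
    qed
    then show ?thesis using q(2) by simp
  qed
  then have "A (Suc k) \<subseteq> {t. poly q t = 0}" by blast
  then have "q = 0"
    using card_mono[OF poly_roots_finite, of q "A (Suc k)"] card_poly_roots_bound[of q] A(2)[of "Suc k"] q(1)
    by linarith
  then show ?case using q(2)[of "w (Suc k)"] by simp
qed

section \<open>Open cones in the effective cone\<close>

lemma effective_coneD: "v \<in> effective_cone n \<Longrightarrow> i \<in> {1..n} \<Longrightarrow> 0 \<le> v i"
  by (auto simp: effective_cone_def)

lemma effective_coneI:
  "(\<And>i. i \<in> {1..n} \<Longrightarrow> 0 \<le> v i) \<Longrightarrow> (\<And>i. i \<notin> {1..n} \<Longrightarrow> v i = undefined) \<Longrightarrow> v \<in> effective_cone n"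
  by (auto simp: effective_cone_def PiE_iff extensional_def)

text \<open>For finitely many coordinates the product topology has the boxes of equal side length as
  neighbourhoods. Extensionality of S puts nearby points inside the product sets, which fix the
  value outside [n].\<close>

lemma openin_cone_iff:
  fixes n :: nat
  assumes S: "S \<subseteq> {1..n} \<rightarrow>\<^sub>E UNIV"
  shows "openin (subtopology (powertop_real {1..n}) S) U \<longleftrightarrow>
    U \<subseteq> S \<and> (\<forall>u\<in>U. \<exists>\<epsilon>>0. \<forall>v\<in>S. (\<forall>i\<in>{1..n}. \<bar>v i - u i\<bar> < \<epsilon>) \<longrightarrow> v \<in> U)"
proof
  assume "openin (subtopology (powertop_real {1..n}) S) U"
  then obtain T where T: "openin (powertop_real {1..n}) T" and U: "U = T \<inter> S"
    unfolding openin_subtopology by blast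
  have "\<exists>\<epsilon>>0. \<forall>v\<in>S. (\<forall>i\<in>{1..n}. \<bar>v i - u i\<bar> < \<epsilon>) \<longrightarrow> v \<in> U" if u: "u \<in> U" for u
  proof -
    have "u \<in> T" using u U by blast
    then obtain B where B: "\<forall>i\<in>{1..n}. openin euclideanreal (B i)" "u \<in> Pi\<^sub>E {1..n} B" "Pi\<^sub>E {1..n} B \<subseteq> T"
      using T unfolding openin_product_topology_alt by blast
    have "\<exists>e>0. \<forall>t. \<bar>t - u i\<bar> < e \<longrightarrow> t \<in> B i" if i: "i \<in> {1..n}" for i
    proof -
      have "open (B i)" using B(1) i by simp
      moreover have "u i \<in> B i" using PiE_mem[OF B(2) i] .
      ultimately show ?thesis unfolding open_real by blast
    qed
    then obtain e where e: "\<And>i. i \<in> {1..n} \<Longrightarrow> e i > 0 \<and> (\<forall>t. \<bar>t - u i\<bar> < e i \<longrightarrow> t \<in> B i)"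
      by metis
    define \<epsilon> where "\<epsilon> = Min (insert 1 (e ` {1..n}))"
    have pos: "\<epsilon> > 0" unfolding \<epsilon>_def using e by (subst Min_gr_iff) auto
    have le: "\<epsilon> \<le> e i" if "i \<in> {1..n}" for i unfolding \<epsilon>_def using that by (intro Min_le) auto
    have "v \<in> U" if v: "v \<in> S" and d: "\<forall>i\<in>{1..n}. \<bar>v i - u i\<bar> < \<epsilon>" for v
    proof -
      have "v i \<in> B i" if i: "i \<in> {1..n}" for i using e[OF i] d i le[OF i] by fastforce
      then have "v \<in> Pi\<^sub>E {1..n} B" using v S by (auto simp: PiE_iff)
      then show ?thesis using B(3) v U by blast
    qed
    then show ?thesis using pos by blast
  qed
  then show "U \<subseteq> S \<and> (\<forall>u\<in>U. \<exists>\<epsilon>>0. \<forall>v\<in>S. (\<forall>i\<in>{1..n}. \<bar>v i - u i\<bar> < \<epsilon>) \<longrightarrow> v \<in> U)"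
    using U by blast
next
  assume a: "U \<subseteq> S \<and> (\<forall>u\<in>U. \<exists>\<epsilon>>0. \<forall>v\<in>S. (\<forall>i\<in>{1..n}. \<bar>v i - u i\<bar> < \<epsilon>) \<longrightarrow> v \<in> U)"
  then obtain \<epsilon> where e: "\<And>u. u \<in> U \<Longrightarrow> \<epsilon> u > 0"
    and eU: "\<And>u v. u \<in> U \<Longrightarrow> v \<in> S \<Longrightarrow> (\<forall>i\<in>{1..n}. \<bar>v i - u i\<bar> < \<epsilon> u) \<Longrightarrow> v \<in> U"
    by metis
  define T where "T = (\<Union>u\<in>U. Pi\<^sub>E {1..n} (\<lambda>i. ball (u i) (\<epsilon> u)))"
  have "openin (powertop_real {1..n}) T"
    unfolding T_def by (intro openin_Union) (auto simp: openin_PiE)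
  moreover have "U = T \<inter> S"
  proof (intro subset_antisym subsetI)
    fix u assume u: "u \<in> U"
    then have "u \<in> {1..n} \<rightarrow>\<^sub>E UNIV" using a S by blast
    then have "u \<in> Pi\<^sub>E {1..n} (\<lambda>i. ball (u i) (\<epsilon> u))" using e[OF u] by (auto simp: PiE_iff)
    then show "u \<in> T \<inter> S" using u a unfolding T_def by blast
  next
    fix v assume v: "v \<in> T \<inter> S"
    then obtain u where u: "u \<in> U" "v \<in> Pi\<^sub>E {1..n} (\<lambda>i. ball (u i) (\<epsilon> u))" unfolding T_def by blast
    then have "\<forall>i\<in>{1..n}. \<bar>v i - u i\<bar> < \<epsilon> u"
      by (auto simp: PiE_iff dist_real_def abs_minus_commute)
    then show "v \<in> U" using eU[OF u(1)] v by blast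
  qed
  ultimately show "openin (subtopology (powertop_real {1..n}) S) U"
    unfolding openin_subtopology by blast
qed

lemma effective_cone_subset: "effective_cone n \<subseteq> {1..n} \<rightarrow>\<^sub>E UNIV"
  by (auto simp: effective_cone_def)

definition open_cone :: "nat \<Rightarrow> (nat \<Rightarrow> real) set \<Rightarrow> bool" where
  "open_cone n U \<longleftrightarrow> openin (subtopology (powertop_real {1..n}) (effective_cone n)) U \<and>
     (\<forall>w\<in>U. \<forall>t>0. (\<lambda>i\<in>{1..n}. t * w i) \<in> U)"

lemma open_cone_subset: "open_cone n U \<Longrightarrow> U \<subseteq> effective_cone n"
  unfolding open_cone_def by (simp only: openin_cone_iff[OF effective_cone_subset])

lemma open_cone_ball:
  assumes "open_cone n U" "u \<in> U"
  obtains \<epsilon> where "\<epsilon> > 0"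
    "\<And>v. v \<in> effective_cone n \<Longrightarrow> (\<And>i. i \<in> {1..n} \<Longrightarrow> \<bar>v i - u i\<bar> < \<epsilon>) \<Longrightarrow> v \<in> U"
proof -
  have "\<exists>\<epsilon>>0. \<forall>v\<in>effective_cone n. (\<forall>i\<in>{1..n}. \<bar>v i - u i\<bar> < \<epsilon>) \<longrightarrow> v \<in> U"
    using assms unfolding open_cone_def by (simp only: openin_cone_iff[OF effective_cone_subset])
  then obtain \<epsilon> where "\<epsilon> > 0" "\<forall>v\<in>effective_cone n. (\<forall>i\<in>{1..n}. \<bar>v i - u i\<bar> < \<epsilon>) \<longrightarrow> v \<in> U"
    by (elim exE conjE)
  then show thesis by (intro that[of \<epsilon>]) simp_all
qed

lemma open_cone_scale: "open_cone n U \<Longrightarrow> w \<in> U \<Longrightarrow> t > 0 \<Longrightarrow> (\<lambda>i\<in>{1..n}. t * w i) \<in> U"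
  by (simp add: open_cone_def)

lemma open_cone_Int: "open_cone n U \<Longrightarrow> open_cone n V \<Longrightarrow> open_cone n (U \<inter> V)"
  unfolding open_cone_def by (simp add: openin_Int)

lemma open_cone_linear:
  assumes fin: "finite A"
  shows "open_cone n {v \<in> effective_cone n. \<forall>a\<in>A. 0 < (\<Sum>i\<in>{1..n}. a i * v i)}"
  unfolding open_cone_def
proof (intro conjI ballI allI impI)
  let ?U = "{v \<in> effective_cone n. \<forall>a\<in>A. 0 < (\<Sum>i\<in>{1..n}. a i * v i)}"
  show "openin (subtopology (powertop_real {1..n}) (effective_cone n)) ?U"
    unfolding openin_cone_iff[OF effective_cone_subset]
  proof (intro conjI ballI)
    fix u assume u: "u \<in> ?U"
    \<comment> \<open>A change of less than \<epsilon> in every coordinate moves the linear form a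
      by less than \<open_bound>.\<close>
    define C where "C = (\<lambda>a. 1 + (\<Sum>i\<in>{1..n}. \<bar>a i :: real\<bar>))"
    have C: "C a > 0" for a unfolding C_def by (intro add_pos_nonneg sum_nonneg) auto
    define \<epsilon> where "\<epsilon> = Min (insert 1 ((\<lambda>a. (\<Sum>i\<in>{1..n}. a i * u i) / C a) ` A))"
    have pos: "\<epsilon> > 0" unfolding \<epsilon>_def using u fin C by (subst Min_gr_iff) auto
    have le: "\<epsilon> \<le> (\<Sum>i\<in>{1..n}. a i * u i) / C a" if "a \<in> A" for a
      unfolding \<epsilon>_def using that fin by (intro Min_le) auto
    have "v \<in> ?U" if v: "v \<in> effective_cone n" and d: "\<forall>i\<in>{1..n}. \<bar>v i - u i\<bar> < \<epsilon>" for v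
    proof -
      have "0 < (\<Sum>i\<in>{1..n}. a i * v i)" if a: "a \<in> A" for a
      proof -
        have "(\<Sum>i\<in>{1..n}. a i * u i) - (\<Sum>i\<in>{1..n}. a i * v i) = (\<Sum>i\<in>{1..n}. a i * (u i - v i))"
          by (simp add: sum_subtractf right_diff_distrib)
        also have "\<dots> \<le> (\<Sum>i\<in>{1..n}. \<bar>a i\<bar> * \<epsilon>)"
        proof (rule sum_mono)
          fix i assume "i \<in> {1..n}"
          then have "\<bar>u i - v i\<bar> \<le> \<epsilon>" using d by (simp add: abs_minus_commute less_imp_le)
          then have "\<bar>a i * (u i - v i)\<bar> \<le> \<bar>a i\<bar> * \<epsilon>" unfolding abs_mult by (intro mult_left_mono) auto
          then show "a i * (u i - v i) \<le> \<bar>a i\<bar> * \<epsilon>" by linarith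
        qed
        also have "\<dots> = (C a - 1) * \<epsilon>" by (simp add: C_def sum_distrib_right)
        also have "\<dots> < C a * \<epsilon>" using pos by (simp add: algebra_simps)
        also have "\<dots> \<le> (\<Sum>i\<in>{1..n}. a i * u i)" using le[OF a] C[of a] by (simp add: field_simps)
        finally show ?thesis by simp
      qed
      then show ?thesis using v by blast
    qed
    then show "\<exists>\<epsilon>>0. \<forall>v\<in>effective_cone n. (\<forall>i\<in>{1..n}. \<bar>v i - u i\<bar> < \<epsilon>) \<longrightarrow> v \<in> ?U" using pos by blast
  qed auto
  fix v and t :: real assume v: "v \<in> ?U" and t: "t > 0"
  have "(\<Sum>i\<in>{1..n}. a i * (\<lambda>i\<in>{1..n}. t * v i) i) = t * (\<Sum>i\<in>{1..n}. a i * v i)" for a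
    unfolding sum_distrib_left by (rule sum.cong) auto
  moreover have "(\<lambda>i\<in>{1..n}. t * v i) \<in> effective_cone n"
    using v t effective_coneD[of v n] by (intro effective_coneI) auto
  ultimately show "(\<lambda>i\<in>{1..n}. t * v i) \<in> ?U" using v t by simp
qed

text \<open>A nonempty open cone contains arbitrarily large boxes of points with even coordinates, namely
  inside a large multiple of a small box around one of its points.\<close>

lemma open_cone_lattice_box:
  assumes U: "open_cone n U" "u \<in> U"
  obtains a :: "nat \<Rightarrow> int" where "\<And>w. w \<in> int_weights n \<Longrightarrow>
    (\<And>i. i \<in> {1..n} \<Longrightarrow> \<exists>b\<in>{0..M}. w i = 2 * (a i + int b)) \<Longrightarrow> w \<in> even_lattice n \<and> real_weight n w \<in> U"
proof -
  obtain \<epsilon> where e: "\<epsilon> > 0"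
    and eU: "\<And>v. v \<in> effective_cone n \<Longrightarrow> (\<And>i. i \<in> {1..n} \<Longrightarrow> \<bar>v i - u i\<bar> < \<epsilon>) \<Longrightarrow> v \<in> U"
    using open_cone_ball[OF U] by metis
  have u0: "u i \<ge> 0" if "i \<in> {1..n}" for i using open_cone_subset[OF U(1)] U(2) effective_coneD that by blast
  \<comment> \<open>Rounding up to an even number costs less than 2 and the box adds at most 2M, so
    the whole box lies within 2M + 3 above t u. Division by t brings it within \<epsilon> of u, and
    moving only upwards keeps it in the effective cone.\<close>
  define t where "t = (2 * real M + 3) / \<epsilon>"
  have t: "t > 0" "t * \<epsilon> = 2 * real M + 3" using e by (simp_all add: t_def)
  define a where "a = (\<lambda>i. \<lceil>t * u i / 2\<rceil>)"
  show thesis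
  proof (rule that[of a])
    fix w assume w: "w \<in> int_weights n"
      and b: "\<And>i. i \<in> {1..n} \<Longrightarrow> \<exists>b\<in>{0..M}. w i = 2 * (a i + int b)"
    have ev: "even (\<Sum>i\<in>{1..n}. w i)" by (rule dvd_sum) (use b in fastforce)
    define v where "v = (\<lambda>i\<in>{1..n}. real_of_int (w i) / t)"
    have bd: "t * u i \<le> real_of_int (w i) \<and> real_of_int (w i) < t * u i + t * \<epsilon>" if i: "i \<in> {1..n}" for i
    proof -
      obtain c where c: "c \<le> M" "w i = 2 * (a i + int c)" using b[OF i] by auto
      have "t * u i / 2 \<le> of_int (a i)" "of_int (a i) < t * u i / 2 + 1" unfolding a_def by linarith+
      then show ?thesis using c t(2) by simp
    qed
    have v: "u i \<le> v i \<and> v i < u i + \<epsilon>" if i: "i \<in> {1..n}" for i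
      using bd[OF i] t(1) i by (simp add: v_def pos_le_divide_eq pos_divide_less_eq algebra_simps)
    have "v \<in> U"
    proof (rule eU)
      show "v \<in> effective_cone n"
      proof (rule effective_coneI)
        show "0 \<le> v i" if "i \<in> {1..n}" for i using v[OF that] u0[OF that] by linarith
        show "v i = undefined" if "i \<notin> {1..n}" for i using that unfolding v_def by (simp only: restrict_apply if_False)
      qed
      show "\<bar>v i - u i\<bar> < \<epsilon>" if "i \<in> {1..n}" for i using v[OF that] by linarith
    qed
    then have "(\<lambda>i\<in>{1..n}. t * v i) \<in> U" using open_cone_scale[OF U(1) _ t(1)] by blast
    moreover have "(\<lambda>i\<in>{1..n}. t * v i) = real_weight n w"
      using t(1) by (auto simp: v_def real_weight_def restrict_def)
    ultimately show "w \<in> even_lattice n \<and> real_weight n w \<in> U" using w ev by (simp add: even_lattice_def)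
  qed
qed

lemma open_cone_lattice_point:
  assumes "open_cone n U" "u \<in> U"
  shows "\<exists>w\<in>even_lattice n. real_weight n w \<in> U"
proof -
  obtain a :: "nat \<Rightarrow> int" where a: "\<And>w. w \<in> int_weights n \<Longrightarrow>
    (\<And>i. i \<in> {1..n} \<Longrightarrow> \<exists>b\<in>{0..0::nat}. w i = 2 * (a i + int b)) \<Longrightarrow> w \<in> even_lattice n \<and> real_weight n w \<in> U"
    using open_cone_lattice_box[OF assms, of 0] by metis
  have "(\<lambda>i\<in>{1..n}. 2 * a i) \<in> even_lattice n \<and> real_weight n (\<lambda>i\<in>{1..n}. 2 * a i) \<in> U"
    by (rule a) (auto simp: int_weights_def)
  then show ?thesis by blast
qed

text \<open>Zariski density: the even points of an open cone contain grids of every size, in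
  particular one larger than the degree of the difference.\<close>

lemma polyfun_eq_if_eq_on_open_cone:
  assumes U: "open_cone n U" "u \<in> U" and f: "polyfun n f" and g: "polyfun n g"
    and eq: "\<And>w. w \<in> even_lattice n \<Longrightarrow> real_weight n w \<in> U \<Longrightarrow> f (real_weight n w) = g (real_weight n w)"
    and x: "x \<in> {1..n} \<rightarrow>\<^sub>E UNIV"
  shows "f x = g x"
proof -
  define F where "F = (\<lambda>x. f x - g x)"
  have "polyfun n F" unfolding F_def by (rule polyfun_diff[OF f g])
  then obtain D where D: "\<And>w i. \<exists>q :: real poly. deg q \<le> D \<and> (\<forall>t. F (w(i := t)) = poly q t)"
    using polyfun_separately_polynomial by blast
  obtain a :: "nat \<Rightarrow> int" where a: "\<And>w. w \<in> int_weights n \<Longrightarrow>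
    (\<And>i. i \<in> {1..n} \<Longrightarrow> \<exists>b\<in>{0..D}. w i = 2 * (a i + int b)) \<Longrightarrow> w \<in> even_lattice n \<and> real_weight n w \<in> U"
    using open_cone_lattice_box[OF U, of D] by metis
  define A where "A = (\<lambda>i. (\<lambda>b::nat. real_of_int (2 * (a i + int b))) ` {0..D})"
  have "F x = 0"
  proof (rule separately_polynomial_eq_0[OF D, where k = n and A = A and ?w0.0 = "\<lambda>_. undefined"])
    show "finite (A i)" for i by (simp add: A_def)
    show "D < card (A i)" for i
      unfolding A_def by (subst card_image) (auto simp: inj_on_def)
    show "x i = undefined" if "i \<notin> {1..n}" for i using x that by (rule PiE_arb)
    fix v :: "nat \<Rightarrow> real" assume v: "\<And>i. i \<in> {1..n} \<Longrightarrow> v i \<in> A i" "\<And>i. i \<notin> {1..n} \<Longrightarrow> v i = undefined"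
    have "\<exists>b. b \<in> {0..D} \<and> v i = real_of_int (2 * (a i + int b))" if "i \<in> {1..n}" for i
      using v(1)[OF that] unfolding A_def by blast
    then obtain b where b: "\<And>i. i \<in> {1..n} \<Longrightarrow> b i \<in> {0..D} \<and> v i = real_of_int (2 * (a i + int (b i)))"
      by metis
    define w where "w = (\<lambda>i\<in>{1..n}. 2 * (a i + int (b i)))"
    have "w \<in> even_lattice n \<and> real_weight n w \<in> U"
      by (rule a) (use b in \<open>auto simp: w_def int_weights_def\<close>)
    moreover have "real_weight n w = v"
    proof
      fix i show "real_weight n w i = v i"
        using b[of i] v(2)[of i] by (cases "i \<in> {1..n}") (simp_all add: real_weight_def w_def)
    qed
    ultimately show "F v = 0" using eq unfolding F_def by auto
  qed
  then show ?thesis by (simp add: F_def)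
qed

section \<open>Chambers and domains of polynomiality\<close>

definition light :: "nat \<Rightarrow> (nat \<Rightarrow> real) \<Rightarrow> nat set set" where
  "light n v = {J. J \<subseteq> {1..n} \<and> wsum v J < whalf n v}"

text \<open>The bound on the coordinates will turn out to express that the semistable locus is
  nonempty, so these are the weights of the GIT fan off all walls.\<close>

definition regular_weights :: "nat \<Rightarrow> (nat \<Rightarrow> real) set" where
  "regular_weights n = {v \<in> effective_cone n. (\<forall>j\<in>{1..n}. v j \<le> whalf n v) \<and>
     (\<forall>J. J \<subseteq> {1..n} \<longrightarrow> wsum v J \<noteq> whalf n v)}"

text \<open>The common combinatorial form to which both GIT chambers and domains of polynomiality
  are reduced.\<close>

definition cell :: "nat \<Rightarrow> (nat \<Rightarrow> real) \<Rightarrow> (nat \<Rightarrow> real) set" where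
  "cell n w = {v \<in> regular_weights n. light n v = light n w}"

lemma wsum_complement: "J \<subseteq> {1..n} \<Longrightarrow> wsum v ({1..n} - J) = 2 * whalf n v - wsum v J"
  using sum.subset_diff[of J "{1..n}" v] by simp

lemma regular_weights_effective: "v \<in> regular_weights n \<Longrightarrow> v \<in> effective_cone n"
  by (simp add: regular_weights_def)

lemma regular_weights_less: "v \<in> regular_weights n \<Longrightarrow> j \<in> {1..n} \<Longrightarrow> v j < whalf n v"
proof -
  assume v: "v \<in> regular_weights n" and j: "j \<in> {1..n}"
  have "v j \<le> whalf n v" using v j by (simp add: regular_weights_def)
  moreover have "wsum v {j} \<noteq> whalf n v"
  proof -
    have "{j} \<subseteq> {1..n}" using j by simp
    then show ?thesis using v unfolding regular_weights_def by blast
  qed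
  ultimately show ?thesis by simp
qed

lemma light_complement:
  assumes v: "v \<in> regular_weights n" and J: "J \<subseteq> {1..n}"
  shows "{1..n} - J \<in> light n v \<longleftrightarrow> J \<notin> light n v"
proof -
  have "wsum v J \<noteq> whalf n v" using v J by (simp add: regular_weights_def)
  then show ?thesis unfolding light_def using J wsum_complement[OF J, of v] by auto
qed

lemma empty_in_light:
  assumes v: "v \<in> regular_weights n"
  shows "{} \<in> light n v"
proof -
  have "wsum v {1..n} \<ge> 0"
    by (rule sum_nonneg) (rule effective_coneD[OF regular_weights_effective[OF v]])
  moreover have "wsum v {} \<noteq> whalf n v" using v unfolding regular_weights_def by blast
  ultimately show ?thesis by (simp add: light_def)
qed

lemma singleton_in_light:
  assumes "v \<in> regular_weights n" "j \<in> {1..n}"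
  shows "{j} \<in> light n v"
  using regular_weights_less[OF assms] assms(2) by (simp add: light_def)

text \<open>Singletons are light at every regular weight, so the strict inequalities already contain
  the coordinate bounds. Openness and convexity of cells are read off from this form.\<close>

lemma cell_eq_strict_inequalities:
  assumes w: "w \<in> regular_weights n"
  shows "cell n w = {v \<in> effective_cone n. \<forall>J. J \<subseteq> {1..n} \<longrightarrow>
     (if J \<in> light n w then wsum v J < whalf n v else whalf n v < wsum v J)}"
proof (intro subset_antisym subsetI)
  fix v assume "v \<in> cell n w"
  then have v: "v \<in> regular_weights n" and l: "light n v = light n w" by (auto simp: cell_def)
  have "if J \<in> light n w then wsum v J < whalf n v else whalf n v < wsum v J" if J: "J \<subseteq> {1..n}" for J
  proof -
    have "wsum v J \<noteq> whalf n v" using v J by (simp add: regular_weights_def)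
    then show ?thesis unfolding l[symmetric] unfolding light_def using J by auto
  qed
  then show "v \<in> {v \<in> effective_cone n. \<forall>J. J \<subseteq> {1..n} \<longrightarrow>
     (if J \<in> light n w then wsum v J < whalf n v else whalf n v < wsum v J)}"
    using regular_weights_effective[OF v] by blast
next
  fix v assume v: "v \<in> {v \<in> effective_cone n. \<forall>J. J \<subseteq> {1..n} \<longrightarrow>
     (if J \<in> light n w then wsum v J < whalf n v else whalf n v < wsum v J)}"
  then have e: "v \<in> effective_cone n" and
    c: "\<And>J. J \<subseteq> {1..n} \<Longrightarrow> if J \<in> light n w then wsum v J < whalf n v else whalf n v < wsum v J" by blast+
  have lt: "wsum v J < whalf n v \<longleftrightarrow> J \<in> light n w" and ne: "wsum v J \<noteq> whalf n v" if "J \<subseteq> {1..n}" for J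
    using c[OF that] by (auto split: if_splits)
  have "v j \<le> whalf n v" if j: "j \<in> {1..n}" for j
    using lt[of "{j}"] singleton_in_light[OF w j] j by simp
  then have "v \<in> regular_weights n" using e ne unfolding regular_weights_def by blast
  moreover have "light n v = light n w"
  proof -
    have "light n w \<subseteq> Pow {1..n}" by (auto simp: light_def)
    then show ?thesis using lt unfolding light_def[of n v] by blast
  qed
  ultimately show "v \<in> cell n w" by (simp add: cell_def)
qed

lemma open_cone_cell:
  assumes w: "w \<in> regular_weights n"
  shows "open_cone n (cell n w)"
proof -
  define ind :: "nat set \<Rightarrow> nat \<Rightarrow> real" where "ind = (\<lambda>J i. if i \<in> J then 1 else 0)"
  define f where "f = (\<lambda>J i. if J \<in> light n w then 1 / 2 - ind J i else ind J i - 1 / 2)"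
  have i: "(\<Sum>i\<in>{1..n}. ind J i * v i) = wsum v J" if "J \<subseteq> {1..n}" for J and v :: "nat \<Rightarrow> real"
    using that by (simp add: ind_def if_distrib[of "\<lambda>x. x * _"] sum.If_cases Int_absorb1 cong: if_cong)
  have h: "(\<Sum>i\<in>{1..n}. (1 / 2 - ind J i) * v i) = whalf n v - wsum v J"
    "(\<Sum>i\<in>{1..n}. (ind J i - 1 / 2) * v i) = wsum v J - whalf n v" if "J \<subseteq> {1..n}" for J v
    unfolding left_diff_distrib sum_subtractf i[OF that] by (simp_all add: sum_divide_distrib)
  have fJ: "0 < (\<Sum>i\<in>{1..n}. f J i * v i) \<longleftrightarrow>
      (if J \<in> light n w then wsum v J < whalf n v else whalf n v < wsum v J)" if "J \<subseteq> {1..n}" for J v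
    unfolding f_def using h[OF that, of v] by simp
  have "cell n w = {v \<in> effective_cone n. \<forall>a\<in>f ` Pow {1..n}. 0 < (\<Sum>i\<in>{1..n}. a i * v i)}"
    unfolding cell_eq_strict_inequalities[OF w] ball_simps Pow_iff Ball_def
    using fJ by (intro Collect_cong conj_cong refl all_cong) blast
  then show ?thesis using open_cone_linear[of "f ` Pow {1..n}" n] by simp
qed

lemma hilbert_function_on_regular:
  assumes n: "n \<ge> 2" and w: "w \<in> even_lattice n" and r: "real_weight n w \<in> regular_weights n"
  shows "real (hilbert_function TYPE('k::field) n w) = chamber_poly n (light n (real_weight n w)) (real_weight n w)"
    and "hilbert_function TYPE('k::field) n w \<noteq> 0"
proof -
  let ?v = "real_weight n w"
  have nn: "0 \<le> ?v j" if "j \<in> {1..n}" for j using effective_coneD[OF regular_weights_effective[OF r] that] .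
  have le: "?v j \<le> whalf n ?v" if "j \<in> {1..n}" for j using regular_weights_less[OF r that] by simp
  show "real (hilbert_function TYPE('k) n w) = chamber_poly n (light n ?v) ?v"
    by (rule hilbert_function_eq_chamber_poly[OF n w nn le])
      (use empty_in_light[OF r] light_card_le[OF le nn] in \<open>auto simp: light_def\<close>)
  have wi: "w \<in> int_weights n" using w by (simp add: even_lattice_def)
  have "0 \<le> w j \<and> w j \<le> half_weight n w" if j: "j \<in> {1..n}" for j
    using nn[OF j] le[OF j] j unfolding whalf_real_weight[OF w] by (simp add: real_weight_def)
  then have "w \<in> nonneg_weights n \<and> (\<forall>j\<in>{1..n}. w j \<le> half_weight n w)"
    using wi by (auto simp: nonneg_weights_def int_weights_def PiE_iff)
  then show "hilbert_function TYPE('k) n w \<noteq> 0"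
    using hilbert_function_nonzero_iff[OF wi, where 'k='k] w by blast
qed

lemma polynomial_open_cone_cell:
  assumes n: "n \<ge> 2" and w: "w \<in> regular_weights n"
  shows "polynomial_open_cone n (\<lambda>w. real (hilbert_function TYPE('k::field) n w)) (cell n w)"
proof -
  have "w \<in> cell n w" using w by (simp add: cell_def)
  moreover have "polynomial_on_cone n (\<lambda>w. real (hilbert_function TYPE('k) n w)) (cell n w)"
  proof (rule polyfun_imp_polynomial_on_cone)
    show "polyfun n (chamber_poly n (light n w))" by (rule polyfun_chamber_poly) (auto simp: light_def)
    fix u assume "u \<in> even_lattice n" "real_weight n u \<in> cell n w"
    then show "real (hilbert_function TYPE('k) n u) = chamber_poly n (light n w) (real_weight n u)"
      using hilbert_function_on_regular(1)[OF n, of u, where 'k='k] by (simp add: cell_def)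
  qed
  moreover have "real (hilbert_function TYPE('k) n u) \<noteq> 0"
    if "u \<in> even_lattice n" "real_weight n u \<in> cell n w" for u
    using hilbert_function_on_regular(2)[OF n that(1), where 'k='k] that(2) by (simp add: cell_def)
  ultimately show ?thesis
    using open_cone_cell[OF w] unfolding polynomial_open_cone_def open_cone_def by blast
qed

lemma light_eq_if_chamber_poly_eq:
  assumes n: "n \<ge> 2" and v: "v \<in> regular_weights n" and v': "v' \<in> regular_weights n"
    and eq: "\<And>x. x \<in> {1..n} \<rightarrow>\<^sub>E UNIV \<Longrightarrow> chamber_poly n (light n v) x = chamber_poly n (light n v') x"
  shows "light n v = light n v'"
proof -
  let ?I = "{1..n}"
  define s :: "nat set \<Rightarrow> real" where "s = (\<lambda>J. of_bool (J \<in> light n v) - of_bool (J \<in> light n v'))"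
  have sub: "light n u \<subseteq> Pow ?I" for u by (auto simp: light_def)
  \<comment> \<open>At a regular weight exactly one of J and its complement is light.\<close>
  have odd: "s (?I - J) = - s J" if "J \<subseteq> ?I" for J
    unfolding s_def light_complement[OF v that] light_complement[OF v' that] by simp
  have vals: "(\<Sum>J\<in>Pow ?I. s J * (-1) ^ card J * ((real n - 2 - real (card (sdiff J K))) gchoose (n - 2))) = 0"
    if K: "K \<subseteq> ?I" for K
  proof -
    define x :: "nat \<Rightarrow> real" where "x = (\<lambda>i\<in>?I. if i \<in> K then - 2 else 0)"
    define g where "g = (\<lambda>J. (-1) ^ card J * ((real n - 2 - real (card (sdiff J K))) gchoose (n - 2)))"
    have finK: "finite K" using K finite_subset by blast
    have ws: "wsum x J = - 2 * real (card (J \<inter> K))" if J: "J \<subseteq> ?I" for J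
    proof -
      have fJ: "finite J" using J finite_subset by blast
      have "wsum x J = (\<Sum>i\<in>J. if i \<in> K then - 2 else 0)"
        by (rule sum.cong) (use J in \<open>auto simp: x_def\<close>)
      then show ?thesis using fJ by (simp add: sum.If_cases)
    qed
    have "?I \<inter> K = K" using K by blast
    then have wh: "whalf n x = - real (card K)" using ws[of ?I] by simp
    \<comment> \<open>At this point half the weight is -\<bar>K\<bar> and J weighs -2 times the size
      of its intersection with K. Subtracting \<bar>J\<bar> leaves minus the cube distance of J and
      K.\<close>
    have arg: "whalf n x - wsum x J - real (card J) + real n - 2 = real n - 2 - real (card (sdiff J K))"
      if J: "J \<subseteq> ?I" for J
    proof -
      have fJ: "finite J" using J finite_subset by blast
      have "real (card (sdiff J K)) + 2 * real (card (J \<inter> K)) = real (card J) + real (card K)"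
        using arg_cong[OF card_sdiff[OF fJ finK], of real] by simp
      then show ?thesis unfolding wh ws[OF J] by simp
    qed
    have cp: "chamber_poly n (light n u) x = (\<Sum>J\<in>Pow ?I. of_bool (J \<in> light n u) * g J)" for u
    proof -
      have "chamber_poly n (light n u) x = (\<Sum>J\<in>light n u. g J)"
        unfolding chamber_poly_def g_def
      proof (rule sum.cong[OF refl])
        fix J assume "J \<in> light n u"
        then have "J \<subseteq> ?I" using sub by blast
        then show "(-1) ^ card J * ((whalf n x - wsum x J - real (card J) + real n - 2) gchoose (n - 2))
            = (-1) ^ card J * ((real n - 2 - real (card (sdiff J K))) gchoose (n - 2))"
          by (simp only: arg)
      qed
      also have "\<dots> = (\<Sum>J\<in>Pow ?I. of_bool (J \<in> light n u) * g J)"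
        by (rule sum.mono_neutral_cong_left) (use sub[of u] in auto)
      finally show ?thesis .
    qed
    have "x \<in> ?I \<rightarrow>\<^sub>E UNIV" by (simp add: x_def)
    from eq[OF this] have "(\<Sum>J\<in>Pow ?I. s J * g J) = 0"
      unfolding cp s_def left_diff_distrib sum_subtractf by simp
    then show ?thesis unfolding g_def by (simp add: mult.assoc)
  qed
  have eig: "(\<Sum>k\<in>?I. s (flip k J)) = (real n - 2) * s J" if "J \<subseteq> ?I" for J
    by (rule cube_eigenfunction_from_values[OF n odd vals that])
  have s0: "s J = 0" if "J \<subseteq> ?I" for J
  proof (rule cube_eigenfunction_eq_0[OF eig _ _ that])
    show "s {} = 0" using empty_in_light[OF v] empty_in_light[OF v'] by (simp add: s_def)
    show "s {i} = 0" if "i \<in> ?I" for i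
      using singleton_in_light[OF v that] singleton_in_light[OF v' that] by (simp add: s_def)
  qed
  have "J \<in> light n v \<longleftrightarrow> J \<in> light n v'" if "J \<subseteq> ?I" for J
    using s0[OF that] by (auto simp: s_def of_bool_def split: if_splits)
  then show ?thesis using sub by blast
qed

text \<open>Increasing a single coordinate by a small amount leaves all walls and moves to a prescribed side
  of those walls that contain the given point.\<close>

lemma open_cone_perturb:
  assumes U: "open_cone n U" and v: "v \<in> U" and j: "j \<in> {1..n}"
  obtains u where "u \<in> U"
    "\<And>K. K \<subseteq> {1..n} \<Longrightarrow> wsum v K < whalf n v \<Longrightarrow> wsum u K < whalf n u"
    "\<And>K. K \<subseteq> {1..n} \<Longrightarrow> wsum v K > whalf n v \<Longrightarrow> wsum u K > whalf n u"
    "\<And>K. K \<subseteq> {1..n} \<Longrightarrow> wsum v K = whalf n v \<Longrightarrow> j \<in> K \<Longrightarrow> wsum u K > whalf n u"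
    "\<And>K. K \<subseteq> {1..n} \<Longrightarrow> wsum v K = whalf n v \<Longrightarrow> j \<notin> K \<Longrightarrow> wsum u K < whalf n u"
proof -
  obtain \<epsilon> where e: "\<epsilon> > 0"
    and eU: "\<And>x. x \<in> effective_cone n \<Longrightarrow> (\<And>i. i \<in> {1..n} \<Longrightarrow> \<bar>x i - v i\<bar> < \<epsilon>) \<Longrightarrow> x \<in> U"
    using open_cone_ball[OF U v] by metis
  define D where "D = insert \<epsilon> ((\<lambda>K. \<bar>wsum v K - whalf n v\<bar>) ` {K \<in> Pow {1..n}. wsum v K \<noteq> whalf n v})"
  have fin: "finite D" by (simp add: D_def)
  define t where "t = Min D / 2"
  have "Min D > 0" using e fin by (subst Min_gr_iff) (auto simp: D_def)
  then have t: "t > 0" by (simp add: t_def)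
  have tD: "t < d" if "d \<in> D" for d using Min_le[OF fin that] t by (simp add: t_def)
  have te: "t < \<epsilon>" by (rule tD) (simp add: D_def)
  have tK: "t < \<bar>wsum v K - whalf n v\<bar>" if "K \<subseteq> {1..n}" "wsum v K \<noteq> whalf n v" for K
    by (rule tD) (use that in \<open>auto simp: D_def\<close>)
  define u where "u = (\<lambda>i\<in>{1..n}. v i + (if i = j then t else 0))"
  have ve: "v \<in> effective_cone n" using open_cone_subset[OF U] v by blast
  have us: "wsum u K = wsum v K + (if j \<in> K then t else 0)" if K: "K \<subseteq> {1..n}" for K
  proof -
    have fK: "finite K" using K finite_subset by blast
    have "wsum u K = (\<Sum>i\<in>K. v i + (if i = j then t else 0))"
      by (rule sum.cong) (use K in \<open>auto simp: u_def\<close>)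
    then show ?thesis using fK by (simp add: sum.distrib)
  qed
  \<comment> \<open>Half the total grows by t / 2, so sets that contain j gain t / 2 against it and
    the others lose t / 2. This breaks every tie, and the choice of t protects every strict
    inequality.\<close>
  have uh: "whalf n u = whalf n v + t / 2" using us[of "{1..n}"] j by (simp add: add_divide_distrib)
  show thesis
  proof (rule that[of u])
    show "u \<in> U"
    proof (rule eU)
      show "u \<in> effective_cone n"
      proof (rule effective_coneI)
        show "0 \<le> u i" if "i \<in> {1..n}" for i using effective_coneD[OF ve that] t that by (simp add: u_def)
        show "u i = undefined" if "i \<notin> {1..n}" for i using that unfolding u_def by (simp only: restrict_apply if_False)
      qed
      show "\<bar>u i - v i\<bar> < \<epsilon>" if "i \<in> {1..n}" for i using that te t e by (simp add: u_def)
    qed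
    fix K assume K: "K \<subseteq> {1..n}"
    show "wsum v K < whalf n v \<Longrightarrow> wsum u K < whalf n u"
      using tK[OF K] t unfolding us[OF K] uh by (auto simp: abs_if split: if_splits)
    show "wsum v K > whalf n v \<Longrightarrow> wsum u K > whalf n u"
      using tK[OF K] t unfolding us[OF K] uh by (auto simp: abs_if split: if_splits)
    show "wsum v K = whalf n v \<Longrightarrow> j \<in> K \<Longrightarrow> wsum u K > whalf n u"
      using t unfolding us[OF K] uh by simp
    show "wsum v K = whalf n v \<Longrightarrow> j \<notin> K \<Longrightarrow> wsum u K < whalf n u"
      using t unfolding us[OF K] uh by simp
  qed
qed

text \<open>A point with a coordinate of at least half the weight would bring in lattice points
  outside the support. A point on a wall would bring in regular points on both sides of it. Regular
  points of two chambers would force two distinct chamber polynomials to agree.\<close>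

lemma polynomial_open_cone_subset_cell:
  assumes n: "n \<ge> 2"
    and V: "polynomial_open_cone n (\<lambda>w. real (hilbert_function TYPE('k::field) n w)) V"
  shows "\<exists>w\<in>regular_weights n. V \<subseteq> cell n w"
proof -
  let ?I = "{1..n}"
  have oV: "open_cone n V" and ne: "V \<noteq> {}"
    and nz: "\<And>w. w \<in> even_lattice n \<Longrightarrow> real_weight n w \<in> V \<Longrightarrow> hilbert_function TYPE('k) n w \<noteq> 0"
    and pV: "polynomial_on_cone n (\<lambda>w. real (hilbert_function TYPE('k) n w)) V"
    using V unfolding polynomial_open_cone_def open_cone_def by auto
  have Ve: "v \<in> effective_cone n" if "v \<in> V" for v using open_cone_subset[OF oV] that by blast
  \<comment> \<open>If the bound fails or is attained, raising coordinate j leads strictly outside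
    it. The open half-space there meets V in an open cone, hence in an even lattice point where the
    Hilbert function is 0.\<close>
  have inner: "v j < whalf n v" if v: "v \<in> V" and j: "j \<in> ?I" for v j
  proof (rule ccontr)
    assume a: "\<not> v j < whalf n v"
    have jI: "{j} \<subseteq> ?I" using j by simp
    obtain u where u: "u \<in> V" "wsum u {j} > whalf n u"
    proof -
      obtain u where "u \<in> V" "wsum v {j} > whalf n v \<Longrightarrow> wsum u {j} > whalf n u"
        "wsum v {j} = whalf n v \<Longrightarrow> wsum u {j} > whalf n u"
        using open_cone_perturb[OF oV v j] jI by (metis singletonI)
      then show thesis using that[of u] a by (cases "wsum v {j} = whalf n v") auto
    qed
    define c :: "nat \<Rightarrow> real" where "c = (\<lambda>i. (if i = j then 1 else 0) - 1 / 2)"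
    have cs: "(\<Sum>i\<in>?I. c i * x i) = x j - whalf n x" for x :: "nat \<Rightarrow> real"
      using j unfolding c_def left_diff_distrib sum_subtractf
      by (simp add: if_distrib[of "\<lambda>y. y * _"] sum_divide_distrib cong: if_cong)
    let ?H = "{x \<in> effective_cone n. \<forall>a\<in>{c}. 0 < (\<Sum>i\<in>?I. a i * x i)}"
    have "open_cone n (V \<inter> ?H)" by (rule open_cone_Int[OF oV open_cone_linear]) simp
    moreover have "u \<in> V \<inter> ?H"
    proof -
      have "0 < (\<Sum>i\<in>?I. c i * u i)" unfolding cs using u(2) by simp
      then show ?thesis using u(1) Ve[OF u(1)] by blast
    qed
    ultimately obtain w where w: "w \<in> even_lattice n" "real_weight n w \<in> V \<inter> ?H"
      using open_cone_lattice_point by blast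
    from w(2) have "0 < (\<Sum>i\<in>?I. c i * real_weight n w i)" by blast
    then have "real_weight n w j > whalf n (real_weight n w)" unfolding cs by simp
    then have "w j > half_weight n w"
      unfolding whalf_real_weight[OF w(1)] using j by (simp add: real_weight_def)
    then have "hilbert_function TYPE('k) n w = 0"
      using hilbert_function_nonzero_iff[of w n, where 'k='k] w(1) j
      by (force simp: even_lattice_def)
    then show False using nz w by blast
  qed
  have reg: "v \<in> regular_weights n" if "v \<in> V" "\<And>K. K \<subseteq> ?I \<Longrightarrow> wsum v K \<noteq> whalf n v" for v
    using Ve[OF that(1)] inner[OF that(1)] that(2) unfolding regular_weights_def by (simp add: less_imp_le)
  obtain P :: "(nat, real) mpoly" where P: "mp_in_vars ?I P"
    "\<And>w. w \<in> even_lattice n \<Longrightarrow> real_weight n w \<in> V \<Longrightarrow>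
        real (hilbert_function TYPE('k) n w) = mp_eval id (real_weight n w) P"
    using pV unfolding polynomial_on_cone_def by blast
  \<comment> \<open>On the open cone where V meets the cell of v, both polynomials compute the
    Hilbert function; density extends the equality to all points.\<close>
  have poly: "chamber_poly n (light n v) x = mp_eval id x P"
    if v: "v \<in> V" "v \<in> regular_weights n" and x: "x \<in> ?I \<rightarrow>\<^sub>E UNIV" for v x
  proof (rule polyfun_eq_if_eq_on_open_cone[OF _ _ _ _ _ x])
    show "open_cone n (V \<inter> cell n v)" by (rule open_cone_Int[OF oV open_cone_cell[OF v(2)]])
    show "v \<in> V \<inter> cell n v" using v by (simp add: cell_def)
    show "polyfun n (chamber_poly n (light n v))" by (rule polyfun_chamber_poly) (auto simp: light_def)
    show "polyfun n (\<lambda>x. mp_eval id x P)" using P(1) unfolding polyfun_def by blast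
    fix w assume w: "w \<in> even_lattice n" "real_weight n w \<in> V \<inter> cell n v"
    then have r: "real_weight n w \<in> regular_weights n" "light n (real_weight n w) = light n v"
      by (auto simp: cell_def)
    show "chamber_poly n (light n v) (real_weight n w) = mp_eval id (real_weight n w) P"
      using hilbert_function_on_regular(1)[OF n w(1) r(1), where 'k='k] P(2)[OF w(1)] w(2) r(2) by simp
  qed
  have same: "light n v = light n v'"
    if "v \<in> V" "v \<in> regular_weights n" "v' \<in> V" "v' \<in> regular_weights n" for v v'
    by (rule light_eq_if_chamber_poly_eq[OF n that(2,4)]) (simp add: poly that)
  have VR: "v \<in> regular_weights n" if v: "v \<in> V" for v
  proof (rule reg[OF v])
    fix K assume K: "K \<subseteq> ?I"
    show "wsum v K \<noteq> whalf n v"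
    proof
      assume eq: "wsum v K = whalf n v"
      have one: "1 \<in> ?I" using n by simp
      \<comment> \<open>The empty set and the full set balance only at total weight 0. Otherwise
        there are indices inside and outside K, and raising either of them pushes v off all walls to
        opposite sides of the wall of K.\<close>
      have "whalf n v > 0" using inner[OF v one] effective_coneD[OF Ve[OF v] one] by simp
      then have "K \<noteq> {}" "K \<noteq> ?I" using eq by auto
      then obtain j j' where j: "j \<in> ?I" "j \<in> K" "j' \<in> ?I" "j' \<notin> K" using K by blast
      obtain u where u: "u \<in> V" "wsum u K > whalf n u" "\<And>K. K \<subseteq> ?I \<Longrightarrow> wsum u K \<noteq> whalf n u"
        by (rule open_cone_perturb[OF oV v j(1)]) (metis K eq j(2) less_irrefl linorder_neqE_linordered_idom)
      obtain u' where u': "u' \<in> V" "wsum u' K < whalf n u'" "\<And>K. K \<subseteq> ?I \<Longrightarrow> wsum u' K \<noteq> whalf n u'"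
        by (rule open_cone_perturb[OF oV v j(3)]) (metis K eq j(4) less_irrefl linorder_neqE_linordered_idom)
      have "light n u = light n u'"
        by (rule same[OF u(1) reg[OF u(1,3)] u'(1) reg[OF u'(1,3)]])
      moreover have "K \<in> light n u'" "K \<notin> light n u" using u(2) u'(2) K by (auto simp: light_def)
      ultimately show False by simp
    qed
  qed
  obtain w where w: "w \<in> V" using ne by blast
  have "V \<subseteq> cell n w"
  proof
    fix v assume v: "v \<in> V"
    show "v \<in> cell n w" unfolding cell_def using VR[OF v] same[OF v VR[OF v] w VR[OF w]] by simp
  qed
  then show ?thesis using VR[OF w] by blast
qed

text \<open>Every cell is a polynomial open cone, every polynomial open cone lies in a cell, and
  cells that meet coincide; so the maximal ones are the cells.\<close>

theorem polynomiality_domains_eq_cells: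
  assumes n: "n \<ge> 2"
  shows "polynomiality_domains n (\<lambda>w. real (hilbert_function TYPE('k::field) n w)) = cell n ` regular_weights n"
proof (intro subset_antisym subsetI)
  fix U assume "U \<in> polynomiality_domains n (\<lambda>w. real (hilbert_function TYPE('k) n w))"
  then have U: "polynomial_open_cone n (\<lambda>w. real (hilbert_function TYPE('k) n w)) U"
    and max: "\<And>V. polynomial_open_cone n (\<lambda>w. real (hilbert_function TYPE('k) n w)) V \<Longrightarrow> U \<subseteq> V \<Longrightarrow> V = U"
    unfolding polynomiality_domains_def by blast+
  obtain w where w: "w \<in> regular_weights n" "U \<subseteq> cell n w"
    using polynomial_open_cone_subset_cell[OF n U] by blast
  have "cell n w = U" by (rule max[OF polynomial_open_cone_cell[OF n w(1)] w(2)])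
  then show "U \<in> cell n ` regular_weights n" using w(1) by blast
next
  fix U assume "U \<in> cell n ` regular_weights n"
  then obtain w where w: "w \<in> regular_weights n" and U: "U = cell n w" by blast
  have "V = U" if V: "polynomial_open_cone n (\<lambda>w. real (hilbert_function TYPE('k) n w)) V" and UV: "U \<subseteq> V" for V
  proof -
    obtain w' where w': "w' \<in> regular_weights n" "V \<subseteq> cell n w'"
      using polynomial_open_cone_subset_cell[OF n V] by blast
    have "w \<in> cell n w'" using w UV w'(2) unfolding U cell_def by blast
    then have "cell n w' = cell n w" by (simp add: cell_def)
    then show ?thesis using UV w'(2) U by blast
  qed
  then show "U \<in> polynomiality_domains n (\<lambda>w. real (hilbert_function TYPE('k) n w))"
    unfolding polynomiality_domains_def using polynomial_open_cone_cell[OF n w, where 'k='k] U by blast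
qed

section \<open>GIT chambers\<close>

text \<open>Over a finite field the product of all x - a, increased by 1, is a nonconstant
  polynomial without a root.\<close>

lemma infinite_UNIV_alg_closed: "infinite (UNIV :: 'a::alg_closed_field set)"
proof
  assume fin: "finite (UNIV :: 'a set)"
  define p :: "'a poly" where "p = (\<Prod>a\<in>UNIV. [:- a, 1:])"
  have ne: "(\<Prod>a\<in>A. [:- a, 1:]) \<noteq> (0 :: 'a poly)" if "finite A" for A using that by simp
  have "deg p = (\<Sum>a\<in>(UNIV :: 'a set). 1)"
    unfolding p_def by (subst degree_prod_eq_sum_degree) auto
  then have "deg p > 0" using fin by (simp add: card_gt_0_iff)
  then have "deg (p + 1) > 0" by (subst degree_add_eq_left) auto
  then obtain x where "poly (p + 1) x = 0" using alg_closed_imp_poly_has_root by blast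
  moreover have "poly p x = 0" unfolding p_def poly_prod using fin by (intro prod_zero) auto
  ultimately show False by simp
qed

definition slope_line :: "'a::field \<Rightarrow> ('a \<times> 'a) set" where
  "slope_line a = {(c * 1, c * a) | c. True}"

lemma slope_line_in_proj_line: "slope_line a \<in> proj_line"
  unfolding slope_line_def proj_line_def by (intro CollectI exI[of _ 1] exI[of _ a]) auto

lemma slope_line_inject: "slope_line a = slope_line b \<Longrightarrow> a = b"
proof -
  assume eq: "slope_line a = slope_line b"
  have "(1, a) \<in> slope_line a" unfolding slope_line_def by (intro CollectI exI[of _ 1]) auto
  then have "(1, a) \<in> slope_line b" by (simp only: eq)
  then show "a = b" unfolding slope_line_def by auto
qed

text \<open>A configuration in which exactly the points with index in J collide.\<close>

lemma ex_collision_configuration: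
  assumes J: "J \<subseteq> {1..n}"
  shows "\<exists>p q0. p \<in> configurations n \<and> q0 \<in> proj_line \<and> {j. j \<in> {1..n} \<and> p j = q0} = J \<and>
     (\<forall>q :: ('K::alg_closed_field \<times> 'K) set. q \<noteq> q0 \<longrightarrow>
        (\<exists>i\<in>{1..n}. {j. j \<in> {1..n} \<and> p j = q} = {i}) \<or> {j. j \<in> {1..n} \<and> p j = q} = {})"
proof -
  obtain g :: "nat \<Rightarrow> 'K" where g: "inj g"
    using infinite_countable_subset[OF infinite_UNIV_alg_closed] by blast
  \<comment> \<open>The label 0 is not an index in [n], so the collision point differs from all the
    others.\<close>
  define p where "p = (\<lambda>j\<in>{1..n}. slope_line (g (if j \<in> J then 0 else j)))"
  have pc: "p \<in> configurations n" unfolding configurations_def p_def using slope_line_in_proj_line by auto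
  have pj: "p j = slope_line (g (if j \<in> J then 0 else j))" if "j \<in> {1..n}" for j
    unfolding p_def using that by simp
  have inj: "slope_line (g a) = slope_line (g b) \<longleftrightarrow> a = b" for a b
    using slope_line_inject[of "g a" "g b"] injD[OF g] by auto
  have J0: "{j. j \<in> {1..n} \<and> p j = slope_line (g 0)} = J"
    using J by (auto simp: pj inj split: if_splits)
  have main: "(\<exists>i\<in>{1..n}. {j. j \<in> {1..n} \<and> p j = q} = {i}) \<or> {j. j \<in> {1..n} \<and> p j = q} = {}"
    if q: "q \<noteq> slope_line (g 0)" for q
  proof (cases "\<exists>i\<in>{1..n}. p i = q")
    case True
    then obtain i where i: "i \<in> {1..n}" "p i = q" by blast
    have "i \<notin> J"
    proof
      assume "i \<in> J"
      then have "p i = slope_line (g 0)" unfolding pj[OF i(1)] by simp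
      then show False using i(2) q by simp
    qed
    then have qi: "q = slope_line (g i)" using i(2) unfolding pj[OF i(1)] by simp
    have "j = i" if "j \<in> {1..n}" "p j = q" for j
    proof -
      have "(if j \<in> J then 0 else j) = i" using that(2) unfolding qi pj[OF that(1)] inj .
      then show ?thesis using i(1) by (simp split: if_splits)
    qed
    then have "{j. j \<in> {1..n} \<and> p j = q} = {i}" using i by blast
    then show ?thesis using i(1) by blast
  qed blast
  show ?thesis
    by (intro exI[of _ p] exI[of _ "slope_line (g 0)"] conjI pc slope_line_in_proj_line J0 allI impI main)
qed

lemma semistable_configuration_le_half:
  assumes p: "p \<in> semistable_locus TYPE('k::field) n v" and j: "j \<in> {1..n}" and v: "v \<in> effective_cone n"
  shows "v j \<le> whalf n v"
proof -
  have pc: "p \<in> configurations n" using p by (simp add: semistable_locus_def)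
  then have pj: "p j \<in> proj_line" using j by (auto simp: configurations_def)
  have "v j = wsum v {j}" by simp
  also have "\<dots> \<le> wsum v {i. i \<in> {1..n} \<and> p i = p j}"
    by (rule sum_mono2) (use j effective_coneD[OF v] in auto)
  also have "\<dots> \<le> whalf n v" using p pj by (simp add: semistable_locus_def)
  finally show ?thesis .
qed

lemma G_effective_cone_le_half:
  "v \<in> G_effective_cone TYPE('k::field) n \<Longrightarrow> j \<in> {1..n} \<Longrightarrow> v j \<le> whalf n v"
  unfolding G_effective_cone_def by (blast intro: semistable_configuration_le_half)

text \<open>One configuration tests one set J for all weights simultaneously: its other fibres are
  empty or single points, whose inequalities hold throughout the cone. Equal semistable loci
  therefore give the same closed inequalities.\<close>

lemma collision_configuration:
  fixes n :: nat
  assumes J: "J \<subseteq> {1..n}"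
  shows "\<exists>p. (\<forall>u\<in>effective_cone n. (\<forall>j\<in>{1..n}. u j \<le> whalf n u) \<longrightarrow>
       (p \<in> semistable_locus TYPE('k::field) n u \<longleftrightarrow> wsum u J \<le> whalf n u)) \<and>
     (\<forall>u. p \<in> stable_locus TYPE('k) n u \<longrightarrow> wsum u J < whalf n u)"
proof -
  obtain p :: "nat \<Rightarrow> ('k alg_closure \<times> 'k alg_closure) set" and q0 where pc: "p \<in> configurations n"
    and q0: "q0 \<in> proj_line" "{j. j \<in> {1..n} \<and> p j = q0} = J"
    and q: "\<forall>q. q \<noteq> q0 \<longrightarrow> (\<exists>i\<in>{1..n}. {j. j \<in> {1..n} \<and> p j = q} = {i}) \<or> {j. j \<in> {1..n} \<and> p j = q} = {}"
    using ex_collision_configuration[OF J, where 'K="'k alg_closure"] by (elim exE conjE)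
  show ?thesis
  proof (intro exI[of _ p] conjI ballI allI impI)
    fix u :: "nat \<Rightarrow> real"
    assume u: "u \<in> effective_cone n" and le: "\<forall>j\<in>{1..n}. u j \<le> whalf n u"
    have h0: "0 \<le> whalf n u" using sum_nonneg[of "{1..n}" u] effective_coneD[OF u] by simp
    show "p \<in> semistable_locus TYPE('k) n u \<longleftrightarrow> wsum u J \<le> whalf n u"
    proof
      assume "p \<in> semistable_locus TYPE('k) n u"
      then have "wsum u {j. j \<in> {1..n} \<and> p j = q0} \<le> whalf n u" using q0(1) unfolding semistable_locus_def by blast
      then show "wsum u J \<le> whalf n u" unfolding q0(2) .
    next
      assume a: "wsum u J \<le> whalf n u"
      have "wsum u {j. j \<in> {1..n} \<and> p j = q'} \<le> whalf n u" for q'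
      proof (cases "q' = q0")
        case True
        then show ?thesis using a q0(2) by simp
      next
        case False
        from q[rule_format, OF False] show ?thesis
        proof
          assume "\<exists>i\<in>{1..n}. {j. j \<in> {1..n} \<and> p j = q'} = {i}"
          then obtain i where i: "i \<in> {1..n}" "{j. j \<in> {1..n} \<and> p j = q'} = {i}" by blast
          show ?thesis unfolding i(2) using le i(1) by simp
        next
          assume e: "{j. j \<in> {1..n} \<and> p j = q'} = {}"
          show ?thesis unfolding e using h0 by simp
        qed
      qed
      then show "p \<in> semistable_locus TYPE('k) n u" using pc unfolding semistable_locus_def by blast
    qed
  next
    fix u :: "nat \<Rightarrow> real"
    assume "p \<in> stable_locus TYPE('k) n u"
    then have "wsum u {j. j \<in> {1..n} \<and> p j = q0} < whalf n u" using q0(1) unfolding stable_locus_def by blast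
    then show "wsum u J < whalf n u" unfolding q0(2) .
  qed
qed

text \<open>Each point collides at least with itself, which gives the bound. Conversely the test
  configuration for J = {} consists of distinct points, and it is semistable under the
  bound.\<close>

lemma G_effective_cone_iff:
  "v \<in> G_effective_cone TYPE('k::field) n \<longleftrightarrow> v \<in> effective_cone n \<and> (\<forall>j\<in>{1..n}. v j \<le> whalf n v)"
proof
  assume v: "v \<in> G_effective_cone TYPE('k) n"
  then show "v \<in> effective_cone n \<and> (\<forall>j\<in>{1..n}. v j \<le> whalf n v)"
    using G_effective_cone_le_half[OF v] unfolding G_effective_cone_def by blast
next
  assume v: "v \<in> effective_cone n \<and> (\<forall>j\<in>{1..n}. v j \<le> whalf n v)"
  have "0 \<le> whalf n v" using sum_nonneg[of "{1..n}" v] effective_coneD[of v n] v by simp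
  then have e: "wsum v {} \<le> whalf n v" by simp
  obtain p :: "nat \<Rightarrow> ('k alg_closure \<times> 'k alg_closure) set" where
    p: "\<forall>u\<in>effective_cone n. (\<forall>j\<in>{1..n}. u j \<le> whalf n u) \<longrightarrow>
       (p \<in> semistable_locus TYPE('k) n u \<longleftrightarrow> wsum u {} \<le> whalf n u)"
    using collision_configuration[of "{}" n, where 'k='k] by blast
  have "p \<in> semistable_locus TYPE('k) n v" using p v e by blast
  then show "v \<in> G_effective_cone TYPE('k) n" using v unfolding G_effective_cone_def by blast
qed

lemma regular_weights_iff_stable:
  assumes w: "w \<in> G_effective_cone TYPE('k::field) n"
  shows "semistable_locus TYPE('k) n w = stable_locus TYPE('k) n w \<longleftrightarrow> w \<in> regular_weights n"
proof
  have we: "w \<in> effective_cone n" and le: "\<And>j. j \<in> {1..n} \<Longrightarrow> w j \<le> whalf n w"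
    using w unfolding G_effective_cone_iff by blast+
  {
    assume eq: "semistable_locus TYPE('k) n w = stable_locus TYPE('k) n w"
    have "wsum w J \<noteq> whalf n w" if J: "J \<subseteq> {1..n}" for J
    proof
      assume h: "wsum w J = whalf n w"
      obtain p :: "nat \<Rightarrow> ('k alg_closure \<times> 'k alg_closure) set" where
        p: "p \<in> semistable_locus TYPE('k) n w \<longleftrightarrow> wsum w J \<le> whalf n w"
        "p \<in> stable_locus TYPE('k) n w \<longrightarrow> wsum w J < whalf n w"
        using collision_configuration[OF J, where 'k='k] we le by blast
      then show False unfolding eq using h by simp
    qed
    then show "w \<in> regular_weights n" using we le unfolding regular_weights_def by blast
  next
    assume r: "w \<in> regular_weights n"
    have "wsum w {j. j \<in> {1..n} \<and> p j = q} \<le> whalf n w \<longleftrightarrow> wsum w {j. j \<in> {1..n} \<and> p j = q} < whalf n w"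
      for p :: "nat \<Rightarrow> ('k alg_closure \<times> 'k alg_closure) set" and q
    proof -
      have "{j. j \<in> {1..n} \<and> p j = q} \<subseteq> {1..n}" by blast
      then have "wsum w {j. j \<in> {1..n} \<and> p j = q} \<noteq> whalf n w" using r unfolding regular_weights_def by blast
      then show ?thesis by linarith
    qed
    then show "semistable_locus TYPE('k) n w = stable_locus TYPE('k) n w"
      unfolding semistable_locus_def stable_locus_def by simp
  }
qed

lemma GIT_class_eq_cell:
  assumes w: "w \<in> regular_weights n"
  shows "{v \<in> effective_cone n. semistable_locus TYPE('k::field) n v = semistable_locus TYPE('k) n w} = cell n w"
proof (intro subset_antisym subsetI)
  have we: "w \<in> effective_cone n" and wle: "\<And>j. j \<in> {1..n} \<Longrightarrow> w j \<le> whalf n w"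
    using w unfolding regular_weights_def by blast+
  have wG: "w \<in> G_effective_cone TYPE('k) n" using we wle unfolding G_effective_cone_iff by blast
  fix v
  {
    assume "v \<in> {v \<in> effective_cone n. semistable_locus TYPE('k) n v = semistable_locus TYPE('k) n w}"
    then have ve: "v \<in> effective_cone n" and eq: "semistable_locus TYPE('k) n v = semistable_locus TYPE('k) n w" by auto
    have "v \<in> G_effective_cone TYPE('k) n" using wG ve eq unfolding G_effective_cone_def by simp
    then have vle: "\<And>j. j \<in> {1..n} \<Longrightarrow> v j \<le> whalf n v" unfolding G_effective_cone_iff by blast
    have iff: "wsum v J \<le> whalf n v \<longleftrightarrow> wsum w J < whalf n w" if J: "J \<subseteq> {1..n}" for J
    proof -
      obtain p :: "nat \<Rightarrow> ('k alg_closure \<times> 'k alg_closure) set" where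
        p: "\<forall>u\<in>effective_cone n. (\<forall>j\<in>{1..n}. u j \<le> whalf n u) \<longrightarrow>
          (p \<in> semistable_locus TYPE('k) n u \<longleftrightarrow> wsum u J \<le> whalf n u)"
        using collision_configuration[OF J, where 'k='k] by blast
      have "p \<in> semistable_locus TYPE('k) n v \<longleftrightarrow> wsum v J \<le> whalf n v"
        "p \<in> semistable_locus TYPE('k) n w \<longleftrightarrow> wsum w J \<le> whalf n w"
        using p ve vle we wle by blast+
      then have "wsum v J \<le> whalf n v \<longleftrightarrow> wsum w J \<le> whalf n w" unfolding eq by blast
      moreover have "wsum w J \<noteq> whalf n w" using w J unfolding regular_weights_def by blast
      ultimately show ?thesis by linarith
    qed
    \<comment> \<open>On the wall of J both J and its complement satisfy the closed inequality for
      v. Both would then be light for w, although their w-weights add up to the total.\<close>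
    have ne: "wsum v J \<noteq> whalf n v" if J: "J \<subseteq> {1..n}" for J
    proof
      assume h: "wsum v J = whalf n v"
      have J': "{1..n} - J \<subseteq> {1..n}" by blast
      have "wsum w J < whalf n w" using iff[OF J] h by simp
      moreover have "wsum w ({1..n} - J) < whalf n w"
        using iff[OF J'] h unfolding wsum_complement[OF J] by simp
      ultimately show False unfolding wsum_complement[OF J] by linarith
    qed
    have "v \<in> regular_weights n" using ve vle ne unfolding regular_weights_def by blast
    moreover have "light n v = light n w"
    proof -
      have "wsum v J < whalf n v \<longleftrightarrow> wsum w J < whalf n w" if J: "J \<subseteq> {1..n}" for J
        using iff[OF J] ne[OF J] by linarith
      then show ?thesis unfolding light_def by blast
    qed
    ultimately show "v \<in> cell n w" by (simp add: cell_def)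
  next
    assume "v \<in> cell n w"
    then have v: "v \<in> regular_weights n" and l: "light n v = light n w" by (auto simp: cell_def)
    have le_iff: "wsum v J \<le> whalf n v \<longleftrightarrow> wsum w J \<le> whalf n w" if J: "J \<subseteq> {1..n}" for J
    proof -
      have "wsum v J \<noteq> whalf n v" "wsum w J \<noteq> whalf n w" using v w J unfolding regular_weights_def by blast+
      moreover have "wsum v J < whalf n v \<longleftrightarrow> wsum w J < whalf n w" using l J unfolding light_def by blast
      ultimately show ?thesis by linarith
    qed
    have "wsum v {j. j \<in> {1..n} \<and> p j = q} \<le> whalf n v \<longleftrightarrow> wsum w {j. j \<in> {1..n} \<and> p j = q} \<le> whalf n w"
      for p :: "nat \<Rightarrow> ('k alg_closure \<times> 'k alg_closure) set" and q by (rule le_iff) blast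
    then have "semistable_locus TYPE('k) n v = semistable_locus TYPE('k) n w"
      unfolding semistable_locus_def by (simp only:)
    then show "v \<in> {v \<in> effective_cone n. semistable_locus TYPE('k) n v = semistable_locus TYPE('k) n w}"
      using regular_weights_effective[OF v] by blast
  }
qed

theorem GIT_chambers_eq_cells: "GIT_chambers TYPE('k::field) n = cell n ` regular_weights n"
proof (intro subset_antisym subsetI)
  fix U assume "U \<in> GIT_chambers TYPE('k) n"
  then obtain w where w: "w \<in> G_effective_cone TYPE('k) n" "semistable_locus TYPE('k) n w = stable_locus TYPE('k) n w"
    and U: "U = {v \<in> effective_cone n. semistable_locus TYPE('k) n v = semistable_locus TYPE('k) n w}"
    unfolding GIT_chambers_def by blast
  have "w \<in> regular_weights n" using regular_weights_iff_stable[OF w(1)] w(2) by simp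
  then show "U \<in> cell n ` regular_weights n" using GIT_class_eq_cell[where 'k='k] U by blast
next
  fix U assume "U \<in> cell n ` regular_weights n"
  then obtain w where w: "w \<in> regular_weights n" and U: "U = cell n w" by blast
  have wG: "w \<in> G_effective_cone TYPE('k) n"
    using w unfolding G_effective_cone_iff regular_weights_def by blast
  show "U \<in> GIT_chambers TYPE('k) n"
    unfolding GIT_chambers_def U GIT_class_eq_cell[OF w, where 'k='k, symmetric]
    using wG w regular_weights_iff_stable[OF wG] by blast
qed

lemma regular_weights_eq_minus_walls:
  "G_effective_cone TYPE('k::field) n - (\<Union>J\<in>Pow {1..n}. wall n J) = regular_weights n"
  unfolding set_eq_iff Diff_iff G_effective_cone_iff wall_def regular_weights_def by blast

text \<open>The cell is given by strict linear inequalities and nonnegativity, so it contains the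
  segment from w to each of its points and is a union of connected sets through w.\<close>

lemma connectedin_cell:
  assumes w: "w \<in> regular_weights n"
  shows "connectedin (powertop_real {1..n}) (cell n w)"
proof -
  let ?T = "powertop_real {1..n}"
  have sub: "cell n w \<subseteq> {1..n} \<rightarrow>\<^sub>E UNIV"
    using open_cone_subset[OF open_cone_cell[OF w]] effective_cone_subset by blast
  define seg where "seg = (\<lambda>v (t::real). \<lambda>i\<in>{1..n}. (1 - t) * w i + t * v i)"
  have con: "connectedin ?T (seg v ` {0..1})" for v
  proof (rule connectedin_continuous_map_image)
    show "continuous_map euclideanreal ?T (seg v)"
      unfolding continuous_map_componentwise seg_def
      by (auto intro!: continuous_intros)
    show "connectedin euclideanreal {0..1::real}" by simp
  qed
  have inC: "seg v t \<in> cell n w" if v: "v \<in> cell n w" and t: "t \<in> {0..1}" for v t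
  proof -
    have ve: "v \<in> effective_cone n" and we: "w \<in> effective_cone n"
      using v w regular_weights_effective by (auto simp: cell_def)
    have ws: "wsum (seg v t) J = (1 - t) * wsum w J + t * wsum v J" if J: "J \<subseteq> {1..n}" for J
    proof -
      have "wsum (seg v t) J = (\<Sum>i\<in>J. (1 - t) * w i + t * v i)"
        by (rule sum.cong) (use J in \<open>auto simp: seg_def\<close>)
      then show ?thesis by (simp add: sum.distrib sum_distrib_left)
    qed
    have wh: "whalf n (seg v t) = (1 - t) * whalf n w + t * whalf n v" unfolding ws[OF subset_refl] by (simp add: add_divide_distrib)
    \<comment> \<open>For t > 0 the strict inequality at v suffices; at t = 0 it must come from
      w.\<close>
    have cmp: "(1 - t) * a + t * b < (1 - t) * a' + t * b'" if "a < a'" "b < b'" for a b a' b' :: real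
    proof (cases "t = 0")
      case False
      then have "t * b < t * b'" "(1 - t) * a \<le> (1 - t) * a'" using that t by (auto intro: mult_left_mono)
      then show ?thesis by linarith
    qed (use that in simp)
    have wC: "w \<in> cell n w" using w by (simp add: cell_def)
    have ineq: "if J \<in> light n w then wsum x J < whalf n x else whalf n x < wsum x J"
      if "x \<in> cell n w" "J \<subseteq> {1..n}" for x J
      using that(1) unfolding cell_eq_strict_inequalities[OF w] using that(2) by blast
    have "if J \<in> light n w then wsum (seg v t) J < whalf n (seg v t) else whalf n (seg v t) < wsum (seg v t) J"
      if J: "J \<subseteq> {1..n}" for J
    proof (cases "J \<in> light n w")
      case True
      then have lt: "wsum w J < whalf n w" "wsum v J < whalf n v"
        using ineq[OF wC J] ineq[OF v J] by simp_all
      show ?thesis unfolding ws[OF J] wh using True cmp[OF lt] by (simp only: if_True)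
    next
      case False
      then have lt: "whalf n w < wsum w J" "whalf n v < wsum v J"
        using ineq[OF wC J] ineq[OF v J] by simp_all
      show ?thesis unfolding ws[OF J] wh using False cmp[OF lt] by (simp only: if_False)
    qed
    moreover have "seg v t \<in> effective_cone n"
    proof (rule effective_coneI)
      show "0 \<le> seg v t i" if "i \<in> {1..n}" for i
        using effective_coneD[OF ve that] effective_coneD[OF we that] t that by (simp add: seg_def)
      show "seg v t i = undefined" if "i \<notin> {1..n}" for i
        using that unfolding seg_def by (simp only: restrict_apply if_False)
    qed
    ultimately show ?thesis unfolding cell_eq_strict_inequalities[OF w] by blast
  qed
  have ends: "seg v 0 = w" "seg v 1 = v" if v: "v \<in> cell n w" for v
  proof -
    have "w \<in> {1..n} \<rightarrow>\<^sub>E UNIV" "v \<in> {1..n} \<rightarrow>\<^sub>E UNIV"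
      using v sub w effective_cone_subset regular_weights_effective by blast+
    then show "seg v 0 = w" "seg v 1 = v" unfolding seg_def by (auto simp: PiE_iff extensional_def)
  qed
  have eq: "cell n w = \<Union>((\<lambda>v. seg v ` {0..1}) ` cell n w)"
  proof (intro subset_antisym subsetI)
    fix v assume v: "v \<in> cell n w"
    then have "v \<in> seg v ` {0..1}" using ends(2)[OF v] by (intro image_eqI[of _ _ 1]) auto
    then show "v \<in> \<Union>((\<lambda>v. seg v ` {0..1}) ` cell n w)" using v by blast
  next
    fix x assume "x \<in> \<Union>((\<lambda>v. seg v ` {0..1}) ` cell n w)"
    then show "x \<in> cell n w" using inC by blast
  qed
  show ?thesis
  proof (subst eq, rule connectedin_Union)
    show "connectedin ?T S" if "S \<in> (\<lambda>v. seg v ` {0..1}) ` cell n w" for S using that con by blast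
    have "w \<in> seg v ` {0..1}" if "v \<in> cell n w" for v
      using ends(1)[OF that] by (intro image_eqI[of _ _ 0]) auto
    then show "\<Inter>((\<lambda>v. seg v ` {0..1}) ` cell n w) \<noteq> {}" by blast
  qed
qed

text \<open>The cells are connected and partition the complement of the walls into relatively open
  sets. Each cell is thus also closed, hence a component.\<close>

theorem GIT_chambers_eq_components:
  "GIT_chambers TYPE('k::field) n =
       connected_components_of (subtopology (powertop_real {1..n})
         (G_effective_cone TYPE('k) n - (\<Union>J\<in>Pow {1..n}. wall n J)))"
proof -
  let ?R = "regular_weights n"
  let ?T = "subtopology (powertop_real {1..n}) ?R"
  have RP: "?R \<subseteq> {1..n} \<rightarrow>\<^sub>E UNIV" using regular_weights_effective effective_cone_subset by blast
  have top: "topspace ?T = ?R" using RP by (simp add: Int_absorb1)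
  have sub: "cell n w \<subseteq> ?R" for w by (auto simp: cell_def)
  have op: "openin ?T (cell n w)" if w: "w \<in> ?R" for w
  proof -
    have "openin (subtopology (powertop_real {1..n}) (effective_cone n)) (cell n w)"
      using open_cone_cell[OF w] by (simp add: open_cone_def)
    then obtain S where "openin (powertop_real {1..n}) S" "cell n w = S \<inter> effective_cone n"
      unfolding openin_subtopology by blast
    moreover have "cell n w = S \<inter> ?R" if "cell n w = S \<inter> effective_cone n" for S
      using that sub[of w] regular_weights_effective by blast
    ultimately show ?thesis unfolding openin_subtopology by blast
  qed
  have cl: "closedin ?T (cell n w)" if w: "w \<in> ?R" for w
  proof -
    have "?R - cell n w = \<Union>(cell n ` (?R - cell n w))" unfolding cell_def by auto
    moreover have "openin ?T (\<Union>(cell n ` (?R - cell n w)))" by (rule openin_Union) (use op in blast)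
    ultimately show ?thesis unfolding closedin_def top using sub[of w] by simp
  qed
  have comp: "connected_component_of_set ?T w = cell n w" if w: "w \<in> ?R" for w
  proof (rule subset_antisym)
    have wC: "w \<in> cell n w" using w by (simp add: cell_def)
    have "connectedin ?T (connected_component_of_set ?T w)" by (rule connectedin_connected_component_of)
    from connectedin_clopen_cases[OF this cl[OF w] op[OF w]]
    show "connected_component_of_set ?T w \<subseteq> cell n w"
    proof
      assume d: "disjnt (connected_component_of_set ?T w) (cell n w)"
      have "w \<in> connected_component_of_set ?T w" using w top by (simp add: connected_component_of_refl)
      then show ?thesis using d wC unfolding disjnt_def by blast
    qed
    have "connectedin ?T (cell n w)" using connectedin_cell[OF w] sub[of w] by (simp add: connectedin_subtopology)
    then show "cell n w \<subseteq> connected_component_of_set ?T w" using wC by (rule connected_component_of_maximal)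
  qed
  have "connected_components_of ?T = cell n ` ?R"
    unfolding connected_components_of_def top by (rule image_cong[OF refl comp])
  then show ?thesis unfolding regular_weights_eq_minus_walls GIT_chambers_eq_cells by simp
qed

theorem mainTheorem4:
  fixes n :: nat
  assumes "n \<ge> 2"
  shows
    "\<comment> \<open>(a)\<close>
     (\<forall>w \<in> even_lattice n \<inter> nonneg_weights n.
        hilbert_function TYPE('k::field) n w =
          kostka [nat (half_weight n w), nat (half_weight n w)] (weight_content n w))
   \<and> {w \<in> int_weights n. hilbert_function TYPE('k) n w \<noteq> 0} =
       {w \<in> even_lattice n \<inter> nonneg_weights n. \<forall>j\<in>{1..n}. w j \<le> half_weight n w}
   \<and> \<comment> \<open>(b)\<close>
     (\<forall>w \<in> even_lattice n \<inter> nonneg_weights n. w \<noteq> zero_weight n \<longrightarrow>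
        int (hilbert_function TYPE('k) n w) = alternating_sum n w)
   \<and> hilbert_function TYPE('k) n (zero_weight n) = 1
   \<and> poincare_hilbert_series TYPE('k) n =
       (\<lambda>w. if w = zero_weight n then 1
            else if w \<in> even_lattice n \<inter> nonneg_weights n then alternating_sum n w else 0)
   \<and> \<comment> \<open>(c)\<close>
     piecewise_polynomial n (\<lambda>w. real (hilbert_function TYPE('k) n w))
   \<and> polynomiality_domains n (\<lambda>w. real (hilbert_function TYPE('k) n w)) = GIT_chambers TYPE('k) n
   \<and> GIT_chambers TYPE('k) n =
       connected_components_of (subtopology (powertop_real {1..n})
         (G_effective_cone TYPE('k) n - (\<Union>J\<in>Pow {1..n}. wall n J)))"
proof (intro conjI ballI impI)
  show "hilbert_function TYPE('k) n w =
      kostka [nat (half_weight n w), nat (half_weight n w)] (weight_content n w)"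
    if "w \<in> even_lattice n \<inter> nonneg_weights n" for w
    using that by (intro hilbert_function_eq_kostka) blast+
  have "even_lattice n \<subseteq> int_weights n" by (auto simp: even_lattice_def)
  then show "{w \<in> int_weights n. hilbert_function TYPE('k) n w \<noteq> 0} =
      {w \<in> even_lattice n \<inter> nonneg_weights n. \<forall>j\<in>{1..n}. w j \<le> half_weight n w}"
    using hilbert_function_nonzero_iff[where 'k='k] by blast
  show "int (hilbert_function TYPE('k) n w) = alternating_sum n w"
    if "w \<in> even_lattice n \<inter> nonneg_weights n" "w \<noteq> zero_weight n" for w
    using that assms by (intro hilbert_function_eq_alternating_sum) blast+
  show "polynomiality_domains n (\<lambda>w. real (hilbert_function TYPE('k) n w)) = GIT_chambers TYPE('k) n"
    unfolding polynomiality_domains_eq_cells[OF assms] GIT_chambers_eq_cells ..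
qed (rule hilbert_function_zero_weight poincare_hilbert_series_eq[OF assms]
    piecewise_polynomial_hilbert_function[OF assms] GIT_chambers_eq_components)+

end
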